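(* Let $\Phi:\mathbb Z_{>0}\to\mathbb Z_{>0}$ be a non-decreasing function such that at least one of the following holds: (a) for all integers $i\ge 1$, $\Phi(i)\ge i^3$ and $\Phi(3i)\ge 3\Phi(i)$; (b) for all integers $i\ge2$, $\Phi(i)\ge i^{\,1+\log_3(2)+\log_3\log_3(i)}$. Then there exists a torsion-free, finitely generated, 3-step solvable group $G$ such that $\mathrm{Cl}_G\simeq\Phi$. Furthermore, if $\Phi$ is computable, then $G$ can be chosen to be recursively presented.
   Context: For a group $G$ with finite generating set $S$, $\|g\|_S$ is the word norm (least $k$ such that $g$ is a product of $k$ elements of $S\cup S^{-1}$), $g_1\sim g_2$ denotes conjugacy, and the conjugator length function is $$\mathrm{Cl}_{G,S}(n)=\max_{\|g_1\|_S,\|g_2\|_S\le n,\ g_1\sim g_2}\ \min\{\|h\|_S : h\in G,\ hg_1h^{-1}=g_2\}.$$ For functions $f,g$ on the positive integers with non-negative real values, $f\prec g$ (equivalently $g\succ f$) means there is an integer $C\ge1$ with $f(n)\le C\,g(Cn)$ for all $n\ge1$; $f\simeq g$ means $f\prec g$ and $g\prec f$. Up to $\simeq$, $\mathrm{Cl}_{G,S}$ does not depend on $S$, so one writes $\mathrm{Cl}_G$. 3-step solvable means solvable of derived length 3. Recursively presented means having a presentation with finitely many (or a computable set of) generators and a recursively enumerable set of relators. *)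

theory Defs
  imports Complex_Main "HOL-Library.Nat_Bijection" "HOL-Algebra.Solvable_Groups"
begin

section \<open>Word norm and conjugator length function\<close>

definition finite_generating_set :: "('a, 'b) monoid_scheme \<Rightarrow> 'a set \<Rightarrow> bool" where
  "finite_generating_set G S \<longleftrightarrow> finite S \<and> S \<subseteq> carrier G \<and> generate G S = carrier G"

definition finitely_generated :: "('a, 'b) monoid_scheme \<Rightarrow> bool" where
  "finitely_generated G \<longleftrightarrow> (\<exists>S. finite_generating_set G S)"

definition word_norm :: "('a, 'b) monoid_scheme \<Rightarrow> 'a set \<Rightarrow> 'a \<Rightarrow> nat" where
  "word_norm G S g =
    (LEAST k. \<exists>ws. length ws = k \<and> set ws \<subseteq> S \<union> m_inv G ` S \<and> foldr (mult G) ws \<one>\<^bsub>G\<^esub> = g)"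

definition conjugates :: "('a, 'b) monoid_scheme \<Rightarrow> 'a \<Rightarrow> 'a \<Rightarrow> 'a \<Rightarrow> bool" where
  "conjugates G h g\<^sub>1 g\<^sub>2 \<longleftrightarrow> h \<in> carrier G \<and> h \<otimes>\<^bsub>G\<^esub> g\<^sub>1 \<otimes>\<^bsub>G\<^esub> inv\<^bsub>G\<^esub> h = g\<^sub>2"

definition conjugate :: "('a, 'b) monoid_scheme \<Rightarrow> 'a \<Rightarrow> 'a \<Rightarrow> bool" where
  "conjugate G g\<^sub>1 g\<^sub>2 \<longleftrightarrow> (\<exists>h. conjugates G h g\<^sub>1 g\<^sub>2)"

text \<open>If \<open>S\<close> is a finite generating set of a group, then balls are finite, so that \<^const>\<open>Max\<close> is
  applied to a finite set; this set is nonempty because of the pair \<open>(\<one>, \<one>)\<close>.\<close>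

definition conjugator_length :: "('a, 'b) monoid_scheme \<Rightarrow> 'a set \<Rightarrow> nat \<Rightarrow> nat" where
  "conjugator_length G S n =
    Max {LEAST k. \<exists>h. conjugates G h g\<^sub>1 g\<^sub>2 \<and> word_norm G S h = k | g\<^sub>1 g\<^sub>2.
           g\<^sub>1 \<in> carrier G \<and> g\<^sub>2 \<in> carrier G \<and>
           word_norm G S g\<^sub>1 \<le> n \<and> word_norm G S g\<^sub>2 \<le> n \<and> conjugate G g\<^sub>1 g\<^sub>2}"


section \<open>Asymptotic comparison\<close>

text \<open>A function on the positive integers is represented by a function on \<^typ>\<open>nat\<close> whose value
  at \<open>0\<close> is never used.\<close>

definition asymp_le :: "(nat \<Rightarrow> real) \<Rightarrow> (nat \<Rightarrow> real) \<Rightarrow> bool" where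
  "asymp_le f g \<longleftrightarrow> (\<exists>C\<ge>1. \<forall>n\<ge>1. f n \<le> real C * g (C * n))"

definition asymp_equiv :: "(nat \<Rightarrow> real) \<Rightarrow> (nat \<Rightarrow> real) \<Rightarrow> bool" where
  "asymp_equiv f g \<longleftrightarrow> asymp_le f g \<and> asymp_le g f"


section \<open>Torsion-freeness and derived length\<close>

definition torsion_free :: "('a, 'b) monoid_scheme \<Rightarrow> bool" where
  "torsion_free G \<longleftrightarrow> (\<forall>x\<in>carrier G. \<forall>n::nat. n > 0 \<longrightarrow> x [^]\<^bsub>G\<^esub> n = \<one>\<^bsub>G\<^esub> \<longrightarrow> x = \<one>\<^bsub>G\<^esub>)"

definition derived_length :: "('a, 'b) monoid_scheme \<Rightarrow> nat" where
  "derived_length G = (LEAST n. (derived G ^^ n) (carrier G) = {\<one>\<^bsub>G\<^esub>})"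


section \<open>Computability\<close>

text \<open>Terms for partial recursive functions on tuples of natural numbers. \<open>rec_eval f xs y\<close> means
  that \<open>f\<close> is defined on \<open>xs\<close> with value \<open>y\<close>. \<open>Mu f\<close> is unbounded minimization in the first
  argument and requires that \<open>f\<close> is defined on all smaller candidates.\<close>

datatype recf = Zero | Succ | Proj nat | Comp recf "recf list" | Prec recf recf | Mu recf

inductive rec_eval :: "recf \<Rightarrow> nat list \<Rightarrow> nat \<Rightarrow> bool" where
  zero: "rec_eval Zero xs 0"
| succ: "rec_eval Succ [x] (Suc x)"
| proj: "i < length xs \<Longrightarrow> rec_eval (Proj i) xs (xs ! i)"
| comp: "list_all2 (\<lambda>g y. rec_eval g xs y) gs ys \<Longrightarrow> rec_eval f ys z \<Longrightarrow> rec_eval (Comp f gs) xs z"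
| prec_0: "rec_eval f xs y \<Longrightarrow> rec_eval (Prec f g) (0 # xs) y"
| prec_Suc: "rec_eval (Prec f g) (n # xs) y \<Longrightarrow> rec_eval g (n # y # xs) z \<Longrightarrow>
    rec_eval (Prec f g) (Suc n # xs) z"
| mu: "rec_eval f (n # xs) 0 \<Longrightarrow> (\<And>m. m < n \<Longrightarrow> \<exists>y. rec_eval f (m # xs) (Suc y)) \<Longrightarrow>
    rec_eval (Mu f) xs n"

inductive_cases rec_eval_ZeroE: "rec_eval Zero xs y"
inductive_cases rec_eval_SuccE: "rec_eval Succ xs y"
inductive_cases rec_eval_ProjE: "rec_eval (Proj i) xs y"
inductive_cases rec_eval_CompE: "rec_eval (Comp f gs) xs y"
inductive_cases rec_eval_Prec_0E: "rec_eval (Prec f g) (0 # xs) y"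
inductive_cases rec_eval_Prec_SucE: "rec_eval (Prec f g) (Suc n # xs) y"
inductive_cases rec_eval_MuE: "rec_eval (Mu f) xs y"

lemma rec_eval_deterministic: "rec_eval f xs y \<Longrightarrow> rec_eval f xs z \<Longrightarrow> y = z"
proof (induction f xs y arbitrary: z rule: rec_eval.induct)
  case (comp xs gs ys f w)
  from comp.prems obtain ys' where ys': "list_all2 (\<lambda>g y. rec_eval g xs y) gs ys'" "rec_eval f ys' z"
    by (elim rec_eval_CompE)
  have "ys = ys'"
    using comp.IH(1) ys'(1) by (auto simp: list_all2_conv_all_nth intro!: nth_equalityI)
  then show ?case using comp.IH(2) ys'(2) by simp
next
  case (mu f n xs)
  from mu.prems have z: "rec_eval f (z # xs) 0"
    "\<And>m. m < z \<Longrightarrow> \<exists>y. rec_eval f (m # xs) (Suc y)"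
    by (elim rec_eval_MuE; blast)+
  show ?case
  proof (rule linorder_cases[of n z])
    assume "n < z"
    then show ?thesis using z(2) mu.IH(1) by (metis nat.distinct(1))
  next
    assume "z < n"
    then show ?thesis using z(1) mu.IH(2) by (metis nat.distinct(1))
  qed
next
  case (prec_Suc f g n xs y w)
  from prec_Suc.prems obtain y' where "rec_eval (Prec f g) (n # xs) y'" "rec_eval g (n # y' # xs) z"
    by (elim rec_eval_Prec_SucE)
  then show ?case using prec_Suc.IH by metis
next
  case (zero xs)
  then show ?case by (elim rec_eval_ZeroE) simp
next
  case (succ x)
  then show ?case by (elim rec_eval_SuccE) simp
next
  case (proj i xs)
  then show ?case by (elim rec_eval_ProjE) simp
next
  case (prec_0 f xs y g)
  from prec_0.prems have "rec_eval f xs z" by (elim rec_eval_Prec_0E)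
  then show ?case by (rule prec_0.IH)
qed

definition computable :: "(nat \<Rightarrow> nat) \<Rightarrow> bool" where
  "computable f \<longleftrightarrow> (\<exists>r. \<forall>x. rec_eval r [x] (f x))"

definition computable_set :: "nat set \<Rightarrow> bool" where
  "computable_set A \<longleftrightarrow> computable (\<lambda>x. of_bool (x \<in> A))"

definition recursively_enumerable :: "nat set \<Rightarrow> bool" where
  "recursively_enumerable A \<longleftrightarrow> (\<exists>r. A = {x. \<exists>y. rec_eval r [x] y})"


section \<open>Group presentations\<close>

text \<open>Generators are natural numbers; the letter \<open>(x, True)\<close> stands for the generator \<open>x\<close> and
  \<open>(x, False)\<close> for its formal inverse.\<close>

type_synonym letter = "nat \<times> bool"

definition words :: "nat set \<Rightarrow> letter list set" where
  "words X = lists (X \<times> UNIV)"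

inductive_set presentation_rel :: "nat set \<Rightarrow> letter list set \<Rightarrow> (letter list \<times> letter list) set"
  for X R where
  refl: "w \<in> words X \<Longrightarrow> (w, w) \<in> presentation_rel X R"
| sym: "(u, v) \<in> presentation_rel X R \<Longrightarrow> (v, u) \<in> presentation_rel X R"
| trans: "(u, v) \<in> presentation_rel X R \<Longrightarrow> (v, w) \<in> presentation_rel X R \<Longrightarrow>
    (u, w) \<in> presentation_rel X R"
| cancel: "u \<in> words X \<Longrightarrow> v \<in> words X \<Longrightarrow> x \<in> X \<Longrightarrow>
    (u @ [(x, b), (x, \<not> b)] @ v, u @ v) \<in> presentation_rel X R"
| relator: "u \<in> words X \<Longrightarrow> v \<in> words X \<Longrightarrow> r \<in> R \<Longrightarrow> r \<in> words X \<Longrightarrow>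
    (u @ r @ v, u @ v) \<in> presentation_rel X R"

definition presented_group :: "nat set \<Rightarrow> letter list set \<Rightarrow> letter list set monoid" where
  "presented_group X R =
    \<lparr>carrier = words X // presentation_rel X R,
     mult = (\<lambda>A B. \<Union>u\<in>A. \<Union>v\<in>B. presentation_rel X R `` {u @ v}),
     one = presentation_rel X R `` {[]}\<rparr>"

definition word_encode :: "letter list \<Rightarrow> nat" where
  "word_encode w = list_encode (map (\<lambda>(x, b). 2 * x + of_bool b) w)"

text \<open>Every finite set of natural numbers is computable, so finite generating sets are included.\<close>

definition recursively_presented :: "('a, 'b) monoid_scheme \<Rightarrow> bool" where
  "recursively_presented G \<longleftrightarrow>
    (\<exists>X R. computable_set X \<and> R \<subseteq> words X \<and> recursively_enumerable (word_encode ` R) \<and>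
           G \<cong> presented_group X R)"

lemma words_append [simp]: "u @ v \<in> words X \<longleftrightarrow> u \<in> words X \<and> v \<in> words X"
  by (auto simp: words_def)

lemma words_Nil [simp]: "[] \<in> words X"
  by (simp add: words_def)

lemma presentation_rel_words:
  "(u, v) \<in> presentation_rel X R \<Longrightarrow> u \<in> words X \<and> v \<in> words X"
  by (induction rule: presentation_rel.induct) (auto simp: words_def)

lemma equiv_presentation_rel: "equiv (words X) (presentation_rel X R)"
proof (rule equivI)
  show "presentation_rel X R \<subseteq> words X \<times> words X"
    by (auto dest: presentation_rel_words)
  show "refl_on (words X) (presentation_rel X R)"
    by (simp add: refl_onI presentation_rel.refl)
  show "Relation.sym (presentation_rel X R)"
    by (rule symI) (rule presentation_rel.sym)
  show "Relation.trans (presentation_rel X R)"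
    by (rule transI) (rule presentation_rel.trans)
qed

lemma presentation_rel_context:
  assumes "(u, v) \<in> presentation_rel X R" "a \<in> words X" "b \<in> words X"
  shows "(a @ u @ b, a @ v @ b) \<in> presentation_rel X R"
  using assms
proof (induction rule: presentation_rel.induct)
  case (cancel u v x b')
  then show ?case
    using presentation_rel.cancel[of "a @ u" X "v @ b" x b' R] by simp
next
  case (relator u v r)
  then show ?case
    using presentation_rel.relator[of "a @ u" X "v @ b" r R] by simp
next
  case (refl w)
  then show ?case by (simp add: presentation_rel.refl)
next
  case (sym u v)
  then show ?case by (simp add: presentation_rel.sym)
next
  case (trans u v w)
  then show ?case by (metis presentation_rel.trans)
qed

lemma presentation_rel_append:
  assumes "(u, u') \<in> presentation_rel X R" "(v, v') \<in> presentation_rel X R"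
  shows "(u @ v, u' @ v') \<in> presentation_rel X R"
proof -
  have "u' \<in> words X" "v \<in> words X"
    using presentation_rel_words assms by blast+
  then have "(u @ v, u' @ v) \<in> presentation_rel X R" "(u' @ v, u' @ v') \<in> presentation_rel X R"
    using presentation_rel_context[OF assms(1), of "[]" v]
      presentation_rel_context[OF assms(2), of u' "[]"] by simp_all
  then show ?thesis by (rule presentation_rel.trans)
qed

lemma presented_group_mult:
  assumes "u \<in> words X" "v \<in> words X"
  shows "presentation_rel X R `` {u} \<otimes>\<^bsub>presented_group X R\<^esub> presentation_rel X R `` {v}
    = presentation_rel X R `` {u @ v}"
proof -
  let ?E = "presentation_rel X R"
  have eq: "?E `` {u' @ v'} = ?E `` {u @ v}" if "u' \<in> ?E `` {u}" "v' \<in> ?E `` {v}" for u' v'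
    using that equiv_class_eq[OF equiv_presentation_rel presentation_rel_append, of u u' X R v v']
    by simp
  have "u \<in> ?E `` {u}" "v \<in> ?E `` {v}"
    using assms by (simp_all add: presentation_rel.refl)
  then have "?E `` {u} \<noteq> {}" "?E `` {v} \<noteq> {}" by blast+
  have "(\<Union>u'\<in>?E `` {u}. \<Union>v'\<in>?E `` {v}. ?E `` {u' @ v'}) =
      (\<Union>u'\<in>?E `` {u}. \<Union>v'\<in>?E `` {v}. ?E `` {u @ v})"
    by (intro SUP_cong HOL.refl eq)
  also have "\<dots> = ?E `` {u @ v}"
    using \<open>?E `` {u} \<noteq> {}\<close> \<open>?E `` {v} \<noteq> {}\<close> by (simp only: UN_constant if_False)
  finally show ?thesis
    by (simp add: presented_group_def)
qed

lemma inverse_word: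
  assumes "w \<in> words X"
  shows "\<exists>v\<in>words X. (v @ w, []) \<in> presentation_rel X R"
  using assms
proof (induction w)
  case Nil
  then show ?case by (auto intro!: bexI[of _ "[]"] presentation_rel.refl)
next
  case (Cons l w)
  obtain x b where l: "l = (x, b)" by fastforce
  with Cons.prems have x: "x \<in> X" and w: "w \<in> words X" by (auto simp: words_def)
  from Cons.IH w obtain v where v: "v \<in> words X" "(v @ w, []) \<in> presentation_rel X R" by auto
  have "((v @ [(x, \<not> b)]) @ l # w, []) \<in> presentation_rel X R"
    using presentation_rel.trans[OF presentation_rel.cancel[of v X w x "\<not> b" R] v(2)] v(1) w x l
    by simp
  moreover have "v @ [(x, \<not> b)] \<in> words X"
    using v(1) x by (simp add: words_def)
  ultimately show ?case by blast
qed

lemma group_presented_group: "group (presented_group X R)"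
proof (rule groupI)
  let ?G = "presented_group X R"
  let ?c = "\<lambda>w. presentation_rel X R `` {w}"
  have carr: "A \<in> carrier ?G \<longleftrightarrow> (\<exists>w\<in>words X. A = ?c w)" for A
    by (auto simp: presented_group_def quotient_def)
  have one: "\<one>\<^bsub>?G\<^esub> = ?c []" by (simp add: presented_group_def)
  show "A \<otimes>\<^bsub>?G\<^esub> B \<in> carrier ?G" if "A \<in> carrier ?G" "B \<in> carrier ?G" for A B
    using that by (auto simp: carr presented_group_mult intro!: bexI[of _ "_ @ _"])
  show "\<one>\<^bsub>?G\<^esub> \<in> carrier ?G" by (auto simp: carr one)
  show "A \<otimes>\<^bsub>?G\<^esub> B \<otimes>\<^bsub>?G\<^esub> C = A \<otimes>\<^bsub>?G\<^esub> (B \<otimes>\<^bsub>?G\<^esub> C)"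
    if "A \<in> carrier ?G" "B \<in> carrier ?G" "C \<in> carrier ?G" for A B C
    using that by (auto simp: carr presented_group_mult)
  show "\<one>\<^bsub>?G\<^esub> \<otimes>\<^bsub>?G\<^esub> A = A" if "A \<in> carrier ?G" for A
    using that by (auto simp: carr one presented_group_mult)
  show "\<exists>B\<in>carrier ?G. B \<otimes>\<^bsub>?G\<^esub> A = \<one>\<^bsub>?G\<^esub>" if A: "A \<in> carrier ?G" for A
  proof -
    from A obtain w where w: "w \<in> words X" "A = ?c w" by (auto simp: carr)
    obtain v where v: "v \<in> words X" "(v @ w, []) \<in> presentation_rel X R"
      using inverse_word[OF w(1)] by blast
    have "?c v \<otimes>\<^bsub>?G\<^esub> A = \<one>\<^bsub>?G\<^esub>"
      using equiv_class_eq[OF equiv_presentation_rel v(2)] v(1) w by (simp add: presented_group_mult one)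
    moreover have "?c v \<in> carrier ?G" using v(1) by (auto simp: carr)
    ultimately show ?thesis by blast
  qed
qed

end

theory Submission
  imports Defs "HOL-Library.Product_Plus" "HOL-Library.Poly_Mapping"
    "HOL-Library.Countable_Set"
begin

text \<open>
The group is a central extension. Its quotient by the centre \<open>\<langle>c\<rangle>\<close> is the wreath product of
\<open>\<int>\<^sup>2\<close> by \<open>\<int>\<^sup>2\<close>: two elements \<open>a\<close>, \<open>b\<close> have translates \<open>a\<^sub>i\<close>, \<open>b\<^sub>i\<close> for \<open>i \<in> \<int>\<^sup>2\<close>, which
commute modulo the centre. In the group itself the \<open>a\<^sub>i\<close> commute with each other,
\<open>[a\<^sub>i, b\<^sub>j] = c\<close> to the power \<open>\<kappa> (j - i)\<close>, and \<open>[b\<^sub>i, b\<^sub>j] = c\<close> to the power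
\<open>\<xi> (j - i) - \<xi> (i - j)\<close>. For any \<open>\<kappa>\<close> and \<open>\<xi>\<close> this is torsion-free and solvable of length at most
three; the conjugator length function is encoded in \<open>\<kappa>\<close> and \<open>\<xi>\<close>.

The encoding is a mixed radix system. The scales \<open>\<nu> 0 < \<nu> 1 < \<dots>\<close> mark where \<open>\<Phi>\<close> has tripled,
\<open>\<rho> (k + 1) = 3 \<Phi> (\<nu> k)\<close>, and the digits are \<open>V 0 = 1\<close>, \<open>V (k + 1) = 2 \<rho> (k + 1) V k\<close>. The only
nonzero values of \<open>\<kappa>\<close> are \<open>V k\<close> at the point \<open>(k, \<rho> k)\<close>; those of \<open>\<xi>\<close> are half a digit,
\<open>V (k + 1) / 2\<close>, at the near point \<open>(\<nu> k, k)\<close>.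

Lower bound (\<open>long_conjugator\<close>). The elements \<open>a\<^sub>0\<close> and \<open>a\<^sub>0 c\<^sup>z\<close> with \<open>z = V (k + 1) / 2\<close> have length
\<open>O(\<nu> k)\<close>, because \<open>c\<^sup>z\<close> is one commutator of translates of \<open>b\<close>. A conjugator has to write \<open>z\<close> as an
integer combination of digits. Modulo \<open>V (k + 1)\<close> only the digits up to \<open>V k\<close> matter, and half of
\<open>V (k + 1)\<close> is \<open>\<rho> (k + 1)\<close> times \<open>V k\<close>, so at least \<open>\<rho> (k + 1)\<close> letters are needed.

Upper bound (\<open>short_conjugator\<close>). For elements whose \<open>\<int>\<^sup>2\<close>-component is not zero, conjugators of
cubic length exist whatever the kernel is (\<open>near_conjugator\<close>, \<open>conjugator_reduce\<close>). Otherwise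
everything comes down to one linear equation \<open>z = (\<Sum>j. h j * T j)\<close> over \<open>\<int>\<close>, where
\<open>T j = (\<Sum>i. \<phi> i * \<kappa> (j - i))\<close> for a finitely supported \<open>\<phi>\<close> of size \<open>n\<close>, to be solved by a small \<open>h\<close>
(\<open>cheap_multiples\<close>). Three features of the points \<open>(k, \<rho> k)\<close> make this possible. They are in convex
position, so some \<open>T j\<close> is exactly \<open>\<phi> i * V k\<close>, for every \<open>k\<close>. Those with \<open>\<rho> k > 3 n\<close> are so far
apart that this holds for every \<open>i\<close>; hence one coefficient serves all high levels, and reducing \<open>z\<close>
from level to level costs only the ratio \<open>2 \<rho> (k + 1)\<close> each time, \<open>O(\<rho> K)\<close> in all. Finally, the
lowest digit makes the system triangular, so the greatest common divisor of the \<open>T j\<close> is that of the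
\<open>\<phi> i\<close>. The low levels cost \<open>O(n\<^sup>3)\<close>. Each alternative in the hypothesis gives \<open>n\<^sup>3 \<le> C * \<Phi> (C * n)\<close>
(\<open>cubic_growth\<close>), which absorbs this term.

If \<open>\<Phi>\<close> is computable, then so are the digits, and the exponent of \<open>c\<close> in the value of a word is an
explicit double sum over its letters. So the word problem is decidable, and the set of all
relations is a recursively enumerable set of relators.
\<close>

section \<open>Integer combinations modulo a number\<close>

lemma Gcd_image_combination:
  fixes t :: "'a \<Rightarrow> int"
  assumes "finite A"
  shows "\<exists>c. (\<Sum>j\<in>A. c j * t j) = Gcd (t ` A)"
  using assms
proof (induction A)
  case empty
  then show ?case by simp
next
  case (insert x A)
  then obtain c where c: "(\<Sum>j\<in>A. c j * t j) = Gcd (t ` A)" by blast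
  obtain u v where uv: "u * t x + v * Gcd (t ` A) = gcd (t x) (Gcd (t ` A))"
    using bezout_int by blast
  have "(\<Sum>j\<in>insert x A. (if j = x then u else v * c j) * t j)
      = u * t x + (\<Sum>j\<in>A. (if j = x then u else v * c j) * t j)"
    using insert by simp
  also have "(\<Sum>j\<in>A. (if j = x then u else v * c j) * t j) = (\<Sum>j\<in>A. v * (c j * t j))"
    using insert by (intro sum.cong) auto
  also have "\<dots> = v * Gcd (t ` A)" by (simp add: sum_distrib_left[symmetric] c)
  finally have "(\<Sum>j\<in>insert x A. (if j = x then u else v * c j) * t j) = Gcd (t ` insert x A)"
    using uv by simp
  then show ?case by (rule exI[of _ "\<lambda>j. if j = x then u else v * c j"])
qed

text \<open>The coefficients may be reduced modulo \<open>m\<close>, which keeps them small. The ideal generated by \<open>m\<close> and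
the \<open>t j\<close> is described through its common divisors, since this is how membership gets verified later.\<close>

lemma residue_combination:
  fixes t :: "'a \<Rightarrow> int" and m r :: int
  assumes "finite A" "m \<noteq> 0"
    and dvd: "\<And>e. e dvd m \<Longrightarrow> (\<And>j. j \<in> A \<Longrightarrow> e dvd t j) \<Longrightarrow> e dvd r"
  shows "\<exists>c. (\<forall>j\<in>A. 0 \<le> c j \<and> c j < \<bar>m\<bar>) \<and> m dvd r - (\<Sum>j\<in>A. c j * t j)"
proof -
  obtain c where c: "(\<Sum>j\<in>A. c j * t j) = Gcd (t ` A)"
    using Gcd_image_combination[OF assms(1)] by blast
  obtain u v where uv: "u * m + v * Gcd (t ` A) = gcd m (Gcd (t ` A))"
    using bezout_int by blast
  have "gcd m (Gcd (t ` A)) dvd r"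
    by (rule dvd) (auto intro: dvd_trans[OF gcd_dvd2] Gcd_dvd)
  then obtain w where w: "r = gcd m (Gcd (t ` A)) * w" by (auto elim: dvdE)
  define c' where "c' j = (w * v * c j) mod \<bar>m\<bar>" for j
  have "m dvd w * v * c j * t j - c' j * t j" for j
  proof -
    have "\<bar>m\<bar> dvd w * v * c j - c' j" unfolding c'_def by (rule dvd_minus_mod)
    then have "m dvd (w * v * c j - c' j) * t j" by simp
    then show ?thesis by (simp add: algebra_simps)
  qed
  then have "m dvd (\<Sum>j\<in>A. w * v * c j * t j - c' j * t j)" by (intro dvd_sum) auto
  also have "(\<Sum>j\<in>A. w * v * c j * t j - c' j * t j) = w * v * Gcd (t ` A) - (\<Sum>j\<in>A. c' j * t j)"
    by (simp add: sum_subtractf c[symmetric] sum_distrib_left mult.assoc)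
  finally have "m dvd w * u * m + (w * v * Gcd (t ` A) - (\<Sum>j\<in>A. c' j * t j))" by simp
  moreover have "r = w * u * m + w * v * Gcd (t ` A)"
    unfolding w uv[symmetric] by (simp add: algebra_simps)
  ultimately have "m dvd r - (\<Sum>j\<in>A. c' j * t j)" by (simp add: algebra_simps)
  moreover have "\<forall>j\<in>A. 0 \<le> c' j \<and> c' j < \<bar>m\<bar>" using assms(2) by (simp add: c'_def)
  ultimately show ?thesis by blast
qed

lemma truncated_quotient:
  fixes z e :: int
  assumes "e \<noteq> 0"
  obtains m where "\<bar>z - m * e\<bar> < \<bar>e\<bar>" "\<bar>m\<bar> * \<bar>e\<bar> \<le> \<bar>z\<bar>"
proof -
  define q where "q = \<bar>z\<bar> div \<bar>e\<bar>"
  have q: "0 \<le> q" "q * \<bar>e\<bar> \<le> \<bar>z\<bar>" "\<bar>z\<bar> - q * \<bar>e\<bar> < \<bar>e\<bar>"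
  proof -
    have "0 < \<bar>e\<bar>" using assms by simp
    then have "0 \<le> \<bar>z\<bar> mod \<bar>e\<bar>" "\<bar>z\<bar> mod \<bar>e\<bar> < \<bar>e\<bar>" by simp_all
    moreover have "q * \<bar>e\<bar> + \<bar>z\<bar> mod \<bar>e\<bar> = \<bar>z\<bar>" unfolding q_def by (rule div_mult_mod_eq)
    ultimately show "q * \<bar>e\<bar> \<le> \<bar>z\<bar>" "\<bar>z\<bar> - q * \<bar>e\<bar> < \<bar>e\<bar>" by linarith+
    show "0 \<le> q" using \<open>0 < \<bar>e\<bar>\<close> by (simp add: q_def pos_imp_zdiv_nonneg_iff)
  qed
  have ze: "z = sgn z * \<bar>z\<bar>" "e = sgn e * \<bar>e\<bar>" "sgn e * sgn e = 1" "\<bar>sgn z\<bar> \<le> 1" "\<bar>sgn e\<bar> = 1"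
    using assms by (auto simp: sgn_if)
  define m where "m = sgn z * sgn e * q"
  have "z - m * e = sgn z * \<bar>z\<bar> - sgn z * (sgn e * sgn e) * (q * \<bar>e\<bar>)"
    unfolding m_def using ze(1,2) by (metis (no_types, opaque_lifting) mult.assoc mult.left_commute)
  also have "\<dots> = sgn z * (\<bar>z\<bar> - q * \<bar>e\<bar>)" unfolding ze(3) by (simp add: right_diff_distrib)
  finally have "\<bar>z - m * e\<bar> = \<bar>sgn z\<bar> * (\<bar>z\<bar> - q * \<bar>e\<bar>)" using q by (simp add: abs_mult)
  also have "\<dots> \<le> 1 * (\<bar>z\<bar> - q * \<bar>e\<bar>)" using ze q by (intro mult_right_mono) auto
  finally have "\<bar>z - m * e\<bar> \<le> \<bar>z\<bar> - q * \<bar>e\<bar>" unfolding mult_1 .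
  with q(3) have 1: "\<bar>z - m * e\<bar> < \<bar>e\<bar>" by (rule le_less_trans[rotated])
  have "\<bar>m\<bar> = \<bar>sgn z\<bar> * q" unfolding m_def abs_mult ze(5) using q by simp
  also have "\<dots> \<le> 1 * q" using ze q by (intro mult_right_mono) auto
  finally have "\<bar>m\<bar> * \<bar>e\<bar> \<le> q * \<bar>e\<bar>" by (simp add: mult_right_mono)
  then show ?thesis using 1 q that by fastforce
qed

section \<open>Digits in convex position\<close>

type_synonym pt = "int \<times> int"

definition pnorm :: "pt \<Rightarrow> int" where
  "pnorm v = \<bar>fst v\<bar> + \<bar>snd v\<bar>"

lemma pnorm_nonneg [simp]: "0 \<le> pnorm v"
  and pnorm_triangle: "pnorm (v + w) \<le> pnorm v + pnorm w"
  and pnorm_triangle_diff: "pnorm (v - w) \<le> pnorm v + pnorm w"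
  and pnorm_uminus [simp]: "pnorm (- v) = pnorm v"
  and pnorm_zero [simp]: "pnorm 0 = 0"
  by (auto simp: pnorm_def)

text \<open>The assumption \<open>nu_gt\<close> makes the second coordinate of the points \<open>(\<nu> k, k)\<close> harmless for lengths.\<close>

locale digits =
  fixes \<rho> \<nu> :: "nat \<Rightarrow> nat"
  assumes rho_0: "\<rho> 0 = 1"
    and rho_Suc: "\<rho> (Suc k) \<ge> 3 * \<rho> k"
    and nu_gt: "\<nu> k > k"
begin

text \<open>The factor 2 in the definition of \<open>V\<close> makes \<open>\<rho> (k + 1) * V k\<close>, the value of \<open>\<xi>\<close>, half a digit.\<close>

fun V :: "nat \<Rightarrow> int" where
  "V 0 = 1"
| "V (Suc k) = 2 * int (\<rho> (Suc k)) * V k"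

definition pos :: "nat \<Rightarrow> pt" where
  "pos k = (int k, int (\<rho> k))"

definition \<kappa> :: "pt \<Rightarrow> int" where
  "\<kappa> v = (if fst v \<ge> 0 \<and> snd v = int (\<rho> (nat (fst v))) then V (nat (fst v)) else 0)"

definition \<xi> :: "pt \<Rightarrow> int" where
  "\<xi> v = (if snd v \<ge> 0 \<and> fst v = int (\<nu> (nat (snd v)))
          then int (\<rho> (Suc (nat (snd v)))) * V (nat (snd v)) else 0)"

lemma kappa_pos [simp]: "\<kappa> (pos k) = V k"
  by (simp add: \<kappa>_def pos_def)

lemma kappa_nonzero: "\<kappa> v \<noteq> 0 \<Longrightarrow> \<exists>k. v = pos k"
  unfolding \<kappa>_def pos_def by (intro exI[of _ "nat (fst v)"]) (auto split: if_splits simp: prod_eq_iff)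

lemma rho_pow: "3 ^ m * \<rho> k \<le> \<rho> (k + m)"
proof (induction m)
  case (Suc m)
  then show ?case using rho_Suc[of "k + m"] by (simp add: algebra_simps)
qed simp

lemma rho_ge: "3 ^ k \<le> \<rho> k"
  using rho_pow[of k 0] rho_0 by simp

lemma rho_pos [simp]: "0 < \<rho> k"
proof -
  have "0 < (3::nat) ^ k" by simp
  then show ?thesis using rho_ge[of k] by linarith
qed

lemma less_rho: "k < \<rho> k"
proof -
  have "k < 2 ^ k" by (rule less_exp)
  also have "(2::nat) ^ k \<le> 3 ^ k" by (rule power_mono) auto
  finally show ?thesis using rho_ge[of k] by linarith
qed

lemma rho_mono: "k \<le> l \<Longrightarrow> \<rho> k \<le> \<rho> l"
proof (rule lift_Suc_mono_le[of \<rho>])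
  show "\<rho> i \<le> \<rho> (Suc i)" for i using rho_Suc[of i] by linarith
qed

lemma rho_triple: "k < l \<Longrightarrow> 3 * \<rho> k \<le> \<rho> l"
  using rho_mono[of "Suc k" l] rho_Suc[of k] by simp

lemma sum_rho: "(\<Sum>i\<in>{k..l}. int (\<rho> i)) \<le> 2 * int (\<rho> l)"
proof (induction l)
  case 0
  then show ?case by (cases "k = 0") auto
next
  case (Suc l)
  show ?case
  proof (cases "k \<le> Suc l")
    case True
    then have "(\<Sum>i\<in>{k..Suc l}. int (\<rho> i)) = (\<Sum>i\<in>{k..l}. int (\<rho> i)) + int (\<rho> (Suc l))"
      by simp
    then show ?thesis using Suc rho_Suc[of l] by linarith
  qed simp
qed

lemma V_pos [simp]: "0 < V k"
  by (induction k) auto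

lemma V_nonneg [simp]: "0 \<le> V k" and V_nonzero [simp]: "V k \<noteq> 0"
  using V_pos[of k] by linarith+

lemma V_mono: "k \<le> l \<Longrightarrow> V k \<le> V l"
proof (rule lift_Suc_mono_le[of V])
  fix k
  have "1 * V k \<le> (2 * int (\<rho> (Suc k))) * V k"
    using rho_pos[of "Suc k"] V_pos[of k] by (intro mult_right_mono) linarith+
  then show "V k \<le> V (Suc k)" by simp
qed

lemma V_dvd: "k \<le> l \<Longrightarrow> V k dvd V l"
proof (induction l)
  case (Suc l)
  then show ?case by (cases "k = Suc l") (auto simp: le_Suc_eq intro: dvd_mult)
qed auto

text \<open>
Each point \<open>pos k\<close> is a vertex of the convex hull of all of them, and the linear form \<open>height k\<close>
shows it: it is largest at \<open>pos k\<close>. For this \<open>\<rho>\<close> has to be strictly convex, which tripling ensures.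
\<close>

definition height :: "nat \<Rightarrow> pt \<Rightarrow> int" where
  "height k v = int (\<rho> k) * fst v - snd v"

lemma height_add: "height k (v + w) = height k v + height k w"
  by (simp add: height_def algebra_simps)

lemma pow3_gt: "0 < m \<Longrightarrow> 1 + int m < 3 ^ m"
proof (induction m)
  case (Suc m)
  then show ?case by (cases "m = 0") auto
qed simp

lemma height_pos_less:
  assumes "l \<noteq> k"
  shows "height k (pos l) < height k (pos k)"
proof (cases "l < k")
  case True
  have "int (\<rho> k) * 1 \<le> int (\<rho> k) * (int k - int l)"
    using True by (intro mult_left_mono) auto
  moreover have "0 < int (\<rho> l)" by simp
  ultimately show ?thesis unfolding height_def pos_def fst_conv snd_conv right_diff_distrib by linarith
next
  case False
  then obtain m where m: "l = k + m" "0 < m" using assms by (metis less_imp_add_positive linorder_neqE_nat)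
  have "int (\<rho> k) * (1 + int m) < int (\<rho> k) * 3 ^ m"
    using pow3_gt[OF m(2)] by (intro mult_strict_left_mono) auto
  also have "\<dots> \<le> int (\<rho> l)" 
  proof -
    have "int (3 ^ m * \<rho> k) \<le> int (\<rho> l)" using rho_pow[of m k] unfolding m by (simp only: of_nat_le_iff)
    then show ?thesis by (simp add: mult.commute)
  qed
  finally show ?thesis by (simp add: height_def pos_def m algebra_simps)
qed

end

section \<open>Solving one linear equation with a short vector\<close>

text \<open>\<open>T j\<close> is the exponent of the centre obtained from the \<open>j\<close>-th basis vector, and \<open>P z d\<close> means that
\<open>z\<close> is obtained from some vector of cost \<open>d\<close>. The cost of \<open>m\<close> times the basis vector at \<open>j\<close> accounts
for walking to \<open>j\<close>, writing \<open>m\<close> letters and walking back.\<close>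

locale test_system = digits +
  fixes \<phi> :: "pt \<Rightarrow> int" and A :: "pt set" and n :: int and P :: "int \<Rightarrow> int \<Rightarrow> bool"
    and T :: "pt \<Rightarrow> int"
  assumes finA: "finite A" and A_ne: "A \<noteq> {}"
    and supp: "\<And>i. i \<in> A \<Longrightarrow> \<phi> i \<noteq> 0"
    and radius: "\<And>i. i \<in> A \<Longrightarrow> pnorm i \<le> n"
    and l1: "(\<Sum>i\<in>A. \<bar>\<phi> i\<bar>) \<le> n"
    and T_def: "\<And>j. T j = (\<Sum>i\<in>A. \<phi> i * \<kappa> (j - i))"
    and P_0: "P 0 0"
    and P_add: "\<And>x y c d. P x c \<Longrightarrow> P y d \<Longrightarrow> P (x + y) (c + d)"
    and P_mono: "\<And>x c d. P x c \<Longrightarrow> c \<le> d \<Longrightarrow> P x d"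
    and P_test: "\<And>m j. P (m * T j) (\<bar>m\<bar> + 2 * pnorm j)"
begin

lemma phi_ge: "i \<in> A \<Longrightarrow> 1 \<le> \<bar>\<phi> i\<bar>"
  using supp[of i] by linarith

lemma phi_le: "i \<in> A \<Longrightarrow> \<bar>\<phi> i\<bar> \<le> n"
  using member_le_sum[of i A "\<lambda>i. \<bar>\<phi> i\<bar>"] finA l1 by simp

lemma card_le: "int (card A) \<le> n"
proof -
  have "int (card A) = (\<Sum>i\<in>A. 1)" by simp
  also have "\<dots> \<le> (\<Sum>i\<in>A. \<bar>\<phi> i\<bar>)" by (intro sum_mono phi_ge)
  finally show ?thesis using l1 by simp
qed

lemma n_ge: "1 \<le> n"
proof -
  obtain i where "i \<in> A" using A_ne by blast
  then show ?thesis using phi_ge[of i] phi_le[of i] by linarith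
qed

lemma P_sum:
  assumes "finite B" "\<And>j. j \<in> B \<Longrightarrow> P (f j) (c j)"
  shows "P (sum f B) (sum c B)"
  using assms
proof (induction B)
  case (insert x B)
  then show ?case using P_add[of "f x" "c x" "sum f B" "sum c B"] by simp
qed (simp add: P_0)

lemma T_single:
  assumes "i \<in> A" "\<And>i' l. i' \<in> A \<Longrightarrow> j = i' + pos l \<Longrightarrow> i' = i"
  shows "T j = \<phi> i * \<kappa> (j - i)"
proof -
  have "\<kappa> (j - i') = 0" if "i' \<in> A - {i}" for i'
  proof (rule ccontr)
    assume "\<kappa> (j - i') \<noteq> 0"
    then obtain l where "j - i' = pos l" using kappa_nonzero by blast
    then have "j = i' + pos l" by (simp add: algebra_simps)
    then show False using assms(2)[of i' l] that by auto
  qed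
  then show ?thesis unfolding T_def using assms(1) finA
    by (subst sum.remove[of _ i]) (auto intro!: sum.neutral)
qed

text \<open>Take \<open>i\<close> where \<open>height k\<close> is largest on the support. If \<open>i + pos k\<close> were also \<open>i' + pos l\<close> with \<open>l \<noteq> k\<close>,
then \<open>i'\<close> would be higher than \<open>i\<close>.\<close>

lemma exact_extreme:
  obtains i where "i \<in> A" "T (i + pos k) = \<phi> i * V k"
proof -
  obtain i where i: "i \<in> A" "\<And>i'. i' \<in> A \<Longrightarrow> height k i' \<le> height k i"
  proof -
    have "Max (height k ` A) \<in> height k ` A" using finA A_ne by simp
    then obtain i where "i \<in> A" "height k i = Max (height k ` A)" by force
    then show ?thesis using finA that[of i] by simp
  qed
  have "T (i + pos k) = \<phi> i * \<kappa> (i + pos k - i)"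
  proof (rule T_single[OF i(1)])
    fix i' l assume h: "i' \<in> A" "i + pos k = i' + pos l"
    then have "height k i + height k (pos k) = height k i' + height k (pos l)"
      by (simp only: height_add[symmetric] h(2))
    then have "l = k" using i(2)[OF h(1)] height_pos_less[of l k] by linarith
    then show "i' = i" using h(2) by simp
  qed
  then show ?thesis using i(1) that by simp
qed

text \<open>The second coordinates of \<open>pos k\<close> and \<open>pos l\<close> then differ by more than the diameter \<open>2 * n\<close> of the
support, so translates of the support by them are disjoint.\<close>

lemma exact_far:
  assumes "i \<in> A" "3 * n < int (\<rho> k)"
  shows "T (i + pos k) = \<phi> i * V k"
proof -
  have "T (i + pos k) = \<phi> i * \<kappa> (i + pos k - i)"
  proof (rule T_single[OF assms(1)])
    fix i' l assume h: "i' \<in> A" "i + pos k = i' + pos l"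
    have "snd i + int (\<rho> k) = snd i' + int (\<rho> l)"
      using arg_cong[OF h(2), of snd] by (simp add: pos_def)
    moreover have "\<bar>snd i\<bar> \<le> n" "\<bar>snd i'\<bar> \<le> n"
      using radius[OF h(1)] radius[OF assms(1)] by (auto simp: pnorm_def)
    ultimately have "\<bar>int (\<rho> k) - int (\<rho> l)\<bar> \<le> 2 * n" by linarith
    then have "l = k" using rho_triple[of k l] rho_triple[of l k] assms(2)
      by (cases l k rule: linorder_cases) linarith+
    then show "i' = i" using h(2) by simp
  qed
  then show ?thesis by simp
qed

text \<open>
\<open>T (i + pos 0)\<close> is \<open>\<phi> i\<close> plus multiples of values of \<open>\<phi>\<close> at points with smaller second coordinate,
because \<open>pos 0\<close> is the lowest of the points \<open>pos l\<close>. Hence the induction on the second coordinate.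
\<close>

lemma triangular_dvd:
  assumes "\<And>j. j \<in> A \<Longrightarrow> e dvd T (j + pos 0)"
  shows "i \<in> A \<Longrightarrow> e dvd \<phi> i"
proof (induction "nat (snd i + n)" arbitrary: i rule: less_induct)
  case less
  have "T (i + pos 0) = \<phi> i * \<kappa> (i + pos 0 - i) + (\<Sum>i'\<in>A - {i}. \<phi> i' * \<kappa> (i + pos 0 - i'))"
    unfolding T_def using finA less.prems by (simp add: sum.remove)
  moreover have "e dvd (\<Sum>i'\<in>A - {i}. \<phi> i' * \<kappa> (i + pos 0 - i'))"
  proof (rule dvd_sum)
    fix i' assume i': "i' \<in> A - {i}"
    show "e dvd \<phi> i' * \<kappa> (i + pos 0 - i')"
    proof (cases "\<kappa> (i + pos 0 - i') = 0")
      case False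
      then obtain l where "i + pos 0 - i' = pos l" using kappa_nonzero by blast
      then have l: "i + pos 0 = i' + pos l" by (simp add: algebra_simps)
      then have "l \<noteq> 0" using i' by (metis DiffE add_right_imp_eq singletonI)
      then have "3 * \<rho> 0 \<le> \<rho> l" by (intro rho_triple) auto
      moreover have "snd i + 1 = snd i' + int (\<rho> l)"
        using arg_cong[OF l, of snd] rho_0 by (simp add: pos_def)
      moreover have "- n \<le> snd i'" using radius[of i'] i' by (auto simp: pnorm_def)
      ultimately have "nat (snd i' + n) < nat (snd i + n)" using rho_0 by linarith
      then show ?thesis using less.hyps[of i'] i' by auto
    qed auto
  qed
  ultimately show ?case using assms[OF less.prems] by (simp add: dvd_add_left_iff)
qed

lemma T_near_le:
  assumes "j \<in> A" "\<And>k. int (\<rho> k) \<le> 3 * n \<Longrightarrow> k \<le> k1"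
  shows "\<bar>T (j + pos 0)\<bar> \<le> n * V k1"
proof -
  have "\<bar>T (j + pos 0)\<bar> \<le> (\<Sum>i\<in>A. \<bar>\<phi> i * \<kappa> (j + pos 0 - i)\<bar>)"
    unfolding T_def by (rule sum_abs)
  also have "\<dots> \<le> (\<Sum>i\<in>A. \<bar>\<phi> i\<bar> * V k1)"
  proof (rule sum_mono)
    fix i assume i: "i \<in> A"
    have "\<bar>\<kappa> (j + pos 0 - i)\<bar> \<le> V k1"
    proof (cases "\<kappa> (j + pos 0 - i) = 0")
      case True
      then show ?thesis using V_pos[of k1] by (simp add: less_imp_le)
    next
      case False
      then obtain l where l: "j + pos 0 - i = pos l" using kappa_nonzero by blast
      have "int (\<rho> l) = snd j + 1 - snd i"
        using arg_cong[OF l, of snd] rho_0 by (simp add: pos_def)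
      moreover have "\<bar>snd i\<bar> \<le> n" "\<bar>snd j\<bar> \<le> n"
        using radius[OF i] radius[OF assms(1)] by (auto simp: pnorm_def)
      ultimately have "l \<le> k1" using n_ge by (intro assms(2)) linarith
      then show ?thesis using V_mono[of l k1] V_pos[of l] by (simp add: l abs_of_pos)
    qed
    then show "\<bar>\<phi> i * \<kappa> (j + pos 0 - i)\<bar> \<le> \<bar>\<phi> i\<bar> * V k1"
      by (simp add: abs_mult mult_left_mono)
  qed
  also have "\<dots> = (\<Sum>i\<in>A. \<bar>\<phi> i\<bar>) * V k1" by (simp add: sum_distrib_right)
  also have "\<dots> \<le> n * V k1" using l1 V_pos[of k1] by (intro mult_right_mono) auto
  finally show ?thesis .
qed

text \<open>Division with remainder by \<open>E K\<close>, then by \<open>E (K - 1)\<close>, down to \<open>E l\<close>. Each remainder is below the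
modulus just used, so the next quotient is bounded by the ratio of two consecutive moduli; the weight
\<open>a\<close> is the number of letters per unit of the quotient. The middle conclusion says that the part that
was subtracted is a combination of the moduli.\<close>

lemma descent:
  fixes E :: "nat \<Rightarrow> int"
  assumes "l \<le> K"
    and E: "\<And>k m. l \<le> k \<Longrightarrow> k \<le> K \<Longrightarrow> P (m * E k) (a * \<bar>m\<bar> + (2 * n + 4 * int (\<rho> k)))"
    and E0: "\<And>k. l \<le> k \<Longrightarrow> k \<le> K \<Longrightarrow> E k \<noteq> 0"
    and ratio: "\<And>k. l \<le> k \<Longrightarrow> k < K \<Longrightarrow> a * \<bar>E (Suc k)\<bar> \<le> b * (2 * int (\<rho> (Suc k))) * \<bar>E k\<bar>"
    and ab: "0 \<le> a" "0 \<le> b"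
    and z: "a * \<bar>z\<bar> \<le> b0 * \<bar>E K\<bar>"
  shows "\<exists>z'. \<bar>z'\<bar> < \<bar>E l\<bar> \<and> (\<forall>e. (\<forall>k\<in>{l..K}. e dvd E k) \<longrightarrow> e dvd z - z') \<and>
    P (z - z') (b0 + (2 * b + 4) * (\<Sum>k\<in>{l..K}. int (\<rho> k)) + int (K + 1 - l) * (2 * n))"
  using assms
proof (induction K arbitrary: z b0 rule: dec_induct)
  case base
  obtain m where m: "\<bar>z - m * E l\<bar> < \<bar>E l\<bar>" "\<bar>m\<bar> * \<bar>E l\<bar> \<le> \<bar>z\<bar>"
    using truncated_quotient[of "E l" z] base.prems(2)[of l] by (metis le_refl)
  have "a * \<bar>m\<bar> * \<bar>E l\<bar> \<le> a * \<bar>z\<bar>" using m(2) base.prems(4) by (simp add: mult.assoc mult_left_mono)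
  then have "a * \<bar>m\<bar> * \<bar>E l\<bar> \<le> b0 * \<bar>E l\<bar>" using base.prems(6) by linarith
  then have "a * \<bar>m\<bar> \<le> b0" using base.prems(2)[of l] by simp
  moreover have "0 \<le> 2 * b * int (\<rho> l)" using base.prems(5) by simp
  ultimately have "P (m * E l) (b0 + (2 * b + 4) * int (\<rho> l) + 2 * n)"
    using base.prems(1)[OF order_refl order_refl, of m] by - (erule P_mono, simp add: algebra_simps)
  then show ?case using m(1) by (intro exI[of _ "z - m * E l"]) auto
next
  case (step K)
  have EK: "E (Suc K) \<noteq> 0" "E K \<noteq> 0" using step.prems(2) step.hyps by auto
  obtain m where m: "\<bar>z - m * E (Suc K)\<bar> < \<bar>E (Suc K)\<bar>" "\<bar>m\<bar> * \<bar>E (Suc K)\<bar> \<le> \<bar>z\<bar>"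
    using truncated_quotient[OF EK(1), of z] by metis
  have "a * \<bar>m\<bar> * \<bar>E (Suc K)\<bar> \<le> a * \<bar>z\<bar>" using m(2) step.prems(4) by (simp add: mult.assoc mult_left_mono)
  then have "a * \<bar>m\<bar> * \<bar>E (Suc K)\<bar> \<le> b0 * \<bar>E (Suc K)\<bar>" using step.prems(6) by linarith
  then have am: "a * \<bar>m\<bar> \<le> b0" using EK(1) by simp
  define z1 where "z1 = z - m * E (Suc K)"
  define b1 where "b1 = b * (2 * int (\<rho> (Suc K)))"
  have "a * \<bar>z1\<bar> \<le> a * \<bar>E (Suc K)\<bar>" using m(1) step.prems(4) by (auto simp: z1_def mult_left_mono)
  also have "\<dots> \<le> b1 * \<bar>E K\<bar>" using step.prems(3)[of K] step.hyps unfolding b1_def by auto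
  finally have z1: "a * \<bar>z1\<bar> \<le> b1 * \<bar>E K\<bar>" .
  obtain z' where z': "\<bar>z'\<bar> < \<bar>E l\<bar>" "\<forall>e. (\<forall>k\<in>{l..K}. e dvd E k) \<longrightarrow> e dvd z1 - z'"
    "P (z1 - z') (b1 + (2 * b + 4) * (\<Sum>k\<in>{l..K}. int (\<rho> k)) + int (K + 1 - l) * (2 * n))"
    using step.IH[OF step.prems(1) step.prems(2) step.prems(3) step.prems(4,5) z1] by (auto simp: less_Suc_eq_le)
  have eq: "z - z' = m * E (Suc K) + (z1 - z')" by (simp add: z1_def)
  have "P (m * E (Suc K)) (a * \<bar>m\<bar> + (2 * n + 4 * int (\<rho> (Suc K))))"
    using step.prems(1)[of "Suc K" m] step.hyps by simp
  from P_add[OF this z'(3)] have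
    "P (z - z') (a * \<bar>m\<bar> + (2 * n + 4 * int (\<rho> (Suc K))) +
       (b1 + (2 * b + 4) * (\<Sum>k\<in>{l..K}. int (\<rho> k)) + int (K + 1 - l) * (2 * n)))"
    by (simp add: eq)
  moreover have "{l..Suc K} = insert (Suc K) {l..K}" using step.hyps by auto
  moreover have "int (Suc K + 1 - l) = int (K + 1 - l) + 1" using step.hyps by auto
  ultimately have "P (z - z') (b0 + (2 * b + 4) * (\<Sum>k\<in>{l..Suc K}. int (\<rho> k)) + int (Suc K + 1 - l) * (2 * n))"
    using am by - (erule P_mono, simp add: b1_def algebra_simps)
  moreover have "e dvd z - z'" if "\<forall>k\<in>{l..Suc K}. e dvd E k" for e
    using z'(2) that step.hyps unfolding eq by (auto intro!: dvd_add)
  ultimately show ?case using z'(1) by blast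
qed

lemma P_digit:
  assumes "i \<in> A" "T (i + pos k) = \<phi> i * V k"
  shows "P (m * (\<phi> i * V k)) (\<bar>m\<bar> + (2 * n + 4 * int (\<rho> k)))"
proof -
  have "pnorm (i + pos k) \<le> pnorm i + pnorm (pos k)" by (rule pnorm_triangle)
  also have "pnorm (pos k) \<le> 2 * int (\<rho> k)" using less_rho[of k] by (simp add: pnorm_def pos_def)
  finally have "2 * pnorm (i + pos k) \<le> 2 * n + 4 * int (\<rho> k)" using radius[OF assms(1)] by linarith
  then show ?thesis using P_test[of m "i + pos k"] assms(2) by - (rule P_mono, auto)
qed

text \<open>The descent visits \<open>K + 1\<close> levels and walks a distance \<open>n\<close> for each of them; this bounds that cost.\<close>

lemma square_le_rho: "(int K + 1)^2 \<le> 4 * int (\<rho> K)"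
proof -
  have "(int K + 1)^2 \<le> 4 * 3 ^ K"
  proof (induction K)
    case (Suc K)
    have "(int (Suc K) + 1)^2 \<le> 3 * (int K + 1)^2" if "K \<noteq> 0"
    proof -
      have "1 * 1 \<le> int K * int K" using that by (intro mult_mono) auto
      then show ?thesis by (simp add: power2_eq_square algebra_simps)
    qed
    then show ?case using Suc by (cases "K = 0") auto
  qed simp
  also have "\<dots> \<le> 4 * int (\<rho> K)" 
  proof -
    have "int (3 ^ K) \<le> int (\<rho> K)" using rho_ge[of K] by (simp only: of_nat_le_iff)
    then show ?thesis by simp
  qed
  finally show ?thesis .
qed

text \<open>A first descent with the moduli \<open>q * V k\<close> leaves a remainder of the size of the last level \<open>k1\<close> with
\<open>\<rho> k1 \<le> 3 * n\<close>. Here \<open>q\<close> is the coefficient that is extreme at level \<open>k1\<close>; at the higher levels any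
coefficient works, so \<open>q\<close> works for all of them, and the ratios of the moduli do not involve the
coefficients of \<open>\<phi>\<close>. Then \<open>z\<close> is corrected to a multiple of the coefficient \<open>p\<close> that is extreme at
level 0; this uses only tests near the support, whose values are of the size of level \<open>k1\<close>. A second
descent from \<open>k1\<close> to 0 uses the extreme coefficient of each level, multiplied by \<open>p\<close> to keep
divisibility by \<open>p\<close>. Its ratios carry a factor \<open>n\<^sup>2\<close>, which is affordable since \<open>\<rho> k1 \<le> 3 * n\<close>.\<close>

theorem cheap_multiples:
  assumes K: "\<And>k. int (\<rho> k) \<le> 3 * n \<Longrightarrow> k \<le> K"
    and z: "\<bar>z\<bar> \<le> 8 * n ^ 3 * V K" "\<And>e. (\<And>i. i \<in> A \<Longrightarrow> e dvd \<phi> i) \<Longrightarrow> e dvd z"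
  shows "P z (100 * (n ^ 3 + int (\<rho> K)))"
proof -
  define k1 where "k1 = Max {k. int (\<rho> k) \<le> 3 * n}"
  have fin: "finite {k. int (\<rho> k) \<le> 3 * n}" 
    by (rule finite_subset[of _ "{..K}"]) (use K in auto)
  have "0 \<in> {k. int (\<rho> k) \<le> 3 * n}" using n_ge rho_0 by auto
  then have k1: "int (\<rho> k1) \<le> 3 * n" "\<And>k. int (\<rho> k) \<le> 3 * n \<Longrightarrow> k \<le> k1" 
    using Max_in[OF fin] Max_ge[OF fin] unfolding k1_def by blast+
  have "k1 \<le> K" using K k1 by simp
  have "\<forall>k. \<exists>i. i \<in> A \<and> T (i + pos k) = \<phi> i * V k"
    using exact_extreme by blast
  then have "\<exists>i. \<forall>k. i k \<in> A \<and> T (i k + pos k) = \<phi> (i k) * V k" by (rule choice)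
  then obtain i where i: "\<And>k. i k \<in> A" "\<And>k. T (i k + pos k) = \<phi> (i k) * V k" by blast
  define q where "q = \<phi> (i k1)"
  define p where "p = \<phi> (i 0)"
  have n1: "1 \<le> n" by (rule n_ge)
  have p: "1 \<le> \<bar>p\<bar>" "\<bar>p\<bar> \<le> n" and q: "1 \<le> \<bar>q\<bar>" "\<bar>q\<bar> \<le> n"
    unfolding p_def q_def using phi_ge phi_le i by auto
  \<comment> \<open>high levels, down to \<open>k1\<close>\<close>
  have "\<exists>z1. \<bar>z1\<bar> < \<bar>q * V k1\<bar> \<and> (\<forall>e. (\<forall>k\<in>{k1..K}. e dvd q * V k) \<longrightarrow> e dvd z - z1) \<and>
    P (z - z1) (8 * n ^ 3 + (2 * 1 + 4) * (\<Sum>k\<in>{k1..K}. int (\<rho> k)) + int (K + 1 - k1) * (2 * n))"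
  proof (rule descent[OF \<open>k1 \<le> K\<close>, of "\<lambda>k. q * V k" 1 1])
    fix k m assume k: "k1 \<le> k" "k \<le> K"
    have "T (i k1 + pos k) = q * V k"
    proof (cases "k = k1")
      case False
      then have "3 * n < int (\<rho> k)" using k1(2)[of k] k by force
      then show ?thesis unfolding q_def by (rule exact_far[OF i(1)])
    qed (use i q_def in auto)
    then show "P (m * (q * V k)) (1 * \<bar>m\<bar> + (2 * n + 4 * int (\<rho> k)))"
      using P_digit[OF i(1), of k1 k m] by (simp add: q_def)
  next
    fix k show "q * V k \<noteq> 0" using q V_pos[of k] by (auto simp del: V_pos)
  next
    fix k show "1 * \<bar>q * V (Suc k)\<bar> \<le> 1 * (2 * int (\<rho> (Suc k))) * \<bar>q * V k\<bar>"
      by (simp add: abs_mult)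
  next
    have "1 * (8 * n ^ 3 * V K) \<le> \<bar>q\<bar> * (8 * n ^ 3 * V K)"
      using q n1 V_pos[of K] by (intro mult_right_mono) auto
    then have "1 * \<bar>z\<bar> \<le> \<bar>q\<bar> * (8 * n ^ 3 * V K)" using z(1) by linarith
    then show "1 * \<bar>z\<bar> \<le> 8 * n ^ 3 * \<bar>q * V K\<bar>"
      by (simp add: abs_mult algebra_simps)
  qed auto
  then obtain z1 where z1: "\<bar>z1\<bar> < \<bar>q * V k1\<bar>" "\<forall>e. (\<forall>k\<in>{k1..K}. e dvd q * V k) \<longrightarrow> e dvd z - z1"
    "P (z - z1) (8 * n ^ 3 + (2 * 1 + 4) * (\<Sum>k\<in>{k1..K}. int (\<rho> k)) + int (K + 1 - k1) * (2 * n))"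
    by blast
  \<comment> \<open>the correction modulo \<open>p\<close>\<close>
  have "\<exists>c. (\<forall>j\<in>A. 0 \<le> c j \<and> c j < \<bar>p\<bar>) \<and> p dvd z1 - (\<Sum>j\<in>A. c j * T (j + pos 0))"
  proof (rule residue_combination[OF finA])
    fix e assume "e dvd p" and e: "\<And>j. j \<in> A \<Longrightarrow> e dvd T (j + pos 0)"
    have dv: "e dvd \<phi> i" if "i \<in> A" for i using triangular_dvd[OF e] that by blast
    have "e dvd z - z1" using z1(2) dv i(1) by (auto simp: q_def)
    moreover have "e dvd z" using z(2) dv by blast
    ultimately have "e dvd z - (z - z1)" using dvd_diff[of e z "z - z1"] by blast
    then show "e dvd z1" unfolding diff_diff_eq2 add_diff_cancel_left' .
  qed (use p in auto)
  then obtain c where c': "(\<forall>j\<in>A. 0 \<le> c j \<and> c j < \<bar>p\<bar>) \<and> p dvd z1 - (\<Sum>j\<in>A. c j * T (j + pos 0))"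
    by (rule exE)
  then have c: "\<And>j. j \<in> A \<Longrightarrow> 0 \<le> c j \<and> c j < \<bar>p\<bar>" "p dvd z1 - (\<Sum>j\<in>A. c j * T (j + pos 0))"
    by simp_all
  define y where "y = (\<Sum>j\<in>A. c j * T (j + pos 0))"
  define z2 where "z2 = z1 - y"
  have nn: "n ^ 2 \<le> n ^ 3" "n \<le> n ^ 3" "1 \<le> n ^ 3" using n1 power_increasing[of 2 3 n] power_increasing[of 1 3 n] by auto
  have Py: "P y (5 * n ^ 3)"
  proof -
    have "P y (\<Sum>j\<in>A. \<bar>c j\<bar> + 2 * pnorm (j + pos 0))"
      unfolding y_def by (rule P_sum[OF finA P_test])
    moreover have "(\<Sum>j\<in>A. \<bar>c j\<bar> + 2 * pnorm (j + pos 0)) \<le> (\<Sum>j\<in>A. 5 * n)"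
    proof (rule sum_mono)
      fix j assume j: "j \<in> A"
      have "pnorm (j + pos 0) \<le> pnorm j + pnorm (pos 0)" by (rule pnorm_triangle)
      also have "pnorm (pos 0) = 1" by (simp add: pnorm_def pos_def rho_0)
      finally show "\<bar>c j\<bar> + 2 * pnorm (j + pos 0) \<le> 5 * n"
        using radius[OF j] c(1)[OF j] p n1 by linarith
    qed
    moreover have "(\<Sum>j\<in>A. 5 * n) \<le> 5 * n ^ 2"
      using card_le n1 by (simp add: power2_eq_square mult_right_mono)
    ultimately show ?thesis using nn by - (erule P_mono, linarith)
  qed
  have z2: "\<bar>z2\<bar> \<le> 2 * n ^ 3 * V k1"
  proof -
    have "\<bar>y\<bar> \<le> (\<Sum>j\<in>A. \<bar>c j * T (j + pos 0)\<bar>)" unfolding y_def by (rule sum_abs)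
    also have "\<dots> \<le> (\<Sum>j\<in>A. n * (n * V k1))"
    proof (rule sum_mono)
      fix j assume j: "j \<in> A"
      have "\<bar>c j\<bar> \<le> n" using c(1)[OF j] p by simp
      then show "\<bar>c j * T (j + pos 0)\<bar> \<le> n * (n * V k1)"
        unfolding abs_mult using T_near_le[OF j k1(2)] n1 by (intro mult_mono) auto
    qed
    also have "\<dots> = int (card A) * (n * (n * V k1))" by simp
    also have "\<dots> \<le> n * (n * (n * V k1))" using card_le n1 V_pos[of k1] by (intro mult_right_mono) auto
    finally have "\<bar>y\<bar> \<le> n ^ 3 * V k1" by (simp add: power3_eq_cube mult.assoc)
    moreover have "\<bar>z1\<bar> \<le> n ^ 3 * V k1"
    proof -
      have "\<bar>q * V k1\<bar> \<le> n ^ 3 * V k1" unfolding abs_mult using q nn V_pos[of k1]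
        by (intro mult_mono) auto
      then show ?thesis using z1(1) by linarith
    qed
    ultimately show ?thesis unfolding z2_def by (simp add: algebra_simps)
  qed
  \<comment> \<open>low levels, with all moduli divisible by \<open>p\<close>\<close>
  have "\<exists>z3. \<bar>z3\<bar> < \<bar>p * (\<phi> (i 0) * V 0)\<bar> \<and>
    (\<forall>e. (\<forall>k\<in>{0..k1}. e dvd p * (\<phi> (i k) * V k)) \<longrightarrow> e dvd z2 - z3) \<and>
    P (z2 - z3) (2 * n ^ 3 + (2 * n ^ 2 + 4) * (\<Sum>k\<in>{0..k1}. int (\<rho> k)) + int (k1 + 1 - 0) * (2 * n))"
  proof (rule descent[of 0 k1 "\<lambda>k. p * (\<phi> (i k) * V k)" "\<bar>p\<bar>" "n ^ 2"])
    fix k m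
    show "P (m * (p * (\<phi> (i k) * V k))) (\<bar>p\<bar> * \<bar>m\<bar> + (2 * n + 4 * int (\<rho> k)))"
      using P_digit[OF i(1) i(2), of "m * p" k] by (simp add: abs_mult mult.assoc mult.commute mult.left_commute)
    show "p * (\<phi> (i k) * V k) \<noteq> 0" using p supp[OF i(1), of k] V_pos[of k] by (auto simp del: V_pos)
    have "\<bar>p\<bar> * \<bar>\<phi> (i (Suc k))\<bar> \<le> n * n"
      using p phi_le[OF i(1), of "Suc k"] n1 by (intro mult_mono) auto
    also have "n * n * 1 \<le> n * n * \<bar>\<phi> (i k)\<bar>"
      using phi_ge[OF i(1), of k] n1 by (intro mult_left_mono) auto
    finally have "\<bar>p\<bar> * \<bar>\<phi> (i (Suc k))\<bar> \<le> n * n * \<bar>\<phi> (i k)\<bar>" by simp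
    then have "(\<bar>p\<bar> * \<bar>\<phi> (i (Suc k))\<bar>) * (\<bar>p\<bar> * (2 * int (\<rho> (Suc k)) * \<bar>V k\<bar>))
        \<le> (n * n * \<bar>\<phi> (i k)\<bar>) * (\<bar>p\<bar> * (2 * int (\<rho> (Suc k)) * \<bar>V k\<bar>))"
      by (rule mult_right_mono) simp
    moreover have W: "\<bar>V (Suc k)\<bar> = 2 * int (\<rho> (Suc k)) * \<bar>V k\<bar>" by (simp add: abs_mult)
    ultimately show "\<bar>p\<bar> * \<bar>p * (\<phi> (i (Suc k)) * V (Suc k))\<bar> \<le> n ^ 2 * (2 * int (\<rho> (Suc k))) * \<bar>p * (\<phi> (i k) * V k)\<bar>"
      unfolding abs_mult[of p] abs_mult[of "\<phi> j" for j] W power2_eq_square by (simp only: ac_simps)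
  next
    have "\<bar>p\<bar> * \<bar>z2\<bar> \<le> \<bar>p\<bar> * (2 * n ^ 3 * V k1) * 1" using z2 by (simp add: mult_left_mono)
    also have "\<dots> \<le> \<bar>p\<bar> * (2 * n ^ 3 * V k1) * \<bar>\<phi> (i k1)\<bar>"
      using phi_ge[OF i(1), of k1] n1 V_pos[of k1] by (intro mult_left_mono) auto
    finally show "\<bar>p\<bar> * \<bar>z2\<bar> \<le> 2 * n ^ 3 * \<bar>p * (\<phi> (i k1) * V k1)\<bar>"
      unfolding abs_mult V_pos[THEN abs_of_pos] by (simp only: ac_simps)
  qed simp_all
  then obtain z3 where z3': "\<bar>z3\<bar> < \<bar>p * (\<phi> (i 0) * V 0)\<bar>"
    "\<forall>e. (\<forall>k\<in>{0..k1}. e dvd p * (\<phi> (i k) * V k)) \<longrightarrow> e dvd z2 - z3"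
    and Pz23: "P (z2 - z3) (2 * n ^ 3 + (2 * n ^ 2 + 4) * (\<Sum>k\<in>{0..k1}. int (\<rho> k)) + int (k1 + 1 - 0) * (2 * n))"
    by blast
  have z3: "\<bar>z3\<bar> < \<bar>p * p\<bar>" "p dvd z2 - z3"
    using z3' by (simp_all add: p_def)
  have "p dvd z2 - (z2 - z3)" 
    using dvd_diff[OF c(2) z3(2)[unfolded z2_def y_def]] unfolding z2_def y_def .
  then have "p dvd z3" unfolding diff_diff_eq2 add_diff_cancel_left' .
  then obtain m where m: "z3 = m * p" by (metis dvdE mult.commute)
  have "\<bar>m\<bar> * \<bar>p\<bar> < \<bar>p\<bar> * \<bar>p\<bar>" using z3(1) unfolding m by (simp only: abs_mult)
  then have mp: "\<bar>m\<bar> < \<bar>p\<bar>" by (rule mult_right_less_imp_less) simp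
  have "P z3 (\<bar>m\<bar> + (2 * n + 4 * int (\<rho> 0)))"
    using P_digit[OF i(1) i(2), of m 0] by (simp add: m p_def)
  then have Pz3: "P z3 (3 * n + 4)"
    by (rule P_mono) (use mp p rho_0 in linarith)
  have s1: "(\<Sum>k\<in>{k1..K}. int (\<rho> k)) \<le> 2 * int (\<rho> K)" and s2: "(\<Sum>k\<in>{0..k1}. int (\<rho> k)) \<le> 6 * n"
    using sum_rho[of k1 K] sum_rho[of 0 k1] k1(1) by linarith+
  have KN: "(int K + 1) * (2 * n) \<le> n ^ 3 + 4 * int (\<rho> K)"
  proof -
    have "0 \<le> (int K + 1 - n)^2" by simp
    then have "(int K + 1) * (2 * n) \<le> (int K + 1)^2 + n^2" by (simp add: power2_eq_square algebra_simps)
    then show ?thesis using square_le_rho[of K] nn by linarith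
  qed
  have b: "(2 * n ^ 2 + 4) * (\<Sum>k\<in>{0..k1}. int (\<rho> k)) \<le> 36 * n ^ 3"
  proof -
    have "(2 * n ^ 2 + 4) * (\<Sum>k\<in>{0..k1}. int (\<rho> k)) \<le> (2 * n ^ 2 + 4) * (6 * n)"
      using s2 by (intro mult_left_mono) auto
    also have "\<dots> = 12 * n ^ 3 + 24 * n" by (simp add: power2_eq_square power3_eq_cube algebra_simps)
    finally show ?thesis using nn by linarith
  qed
  have k2: "int (K + 1 - k1) * (2 * n) \<le> (int K + 1) * (2 * n)" "int (k1 + 1 - 0) * (2 * n) \<le> (int K + 1) * (2 * n)"
    using \<open>k1 \<le> K\<close> n1 by (intro mult_right_mono; simp)+
  have "z = (z - z1) + (y + ((z2 - z3) + z3))" by (simp add: z2_def)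
  then have Pz: "P z ((8 * n ^ 3 + (2 * 1 + 4) * (\<Sum>k\<in>{k1..K}. int (\<rho> k)) + int (K + 1 - k1) * (2 * n)) +
     (5 * n ^ 3 + ((2 * n ^ 3 + (2 * n ^ 2 + 4) * (\<Sum>k\<in>{0..k1}. int (\<rho> k)) + int (k1 + 1 - 0) * (2 * n)) + (3 * n + 4))))"
    using P_add[OF z1(3) P_add[OF Py P_add[OF Pz23 Pz3]]] by simp
  have gen: "8 * N + (2 * 1 + 4) * s + k + (5 * N + ((2 * N + s' + k') + (3 * n + 4))) \<le> 100 * (N + R)"
    if "s \<le> 2 * R" "k \<le> N + 4 * R" "s' \<le> 36 * N" "k' \<le> N + 4 * R" "n \<le> N" "1 \<le> N" "0 \<le> R"
    for N R s k s' k' :: int using that by simp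
  show ?thesis
    by (rule P_mono[OF Pz gen[OF s1 order_trans[OF k2(1) KN] b order_trans[OF k2(2) KN] nn(2,3) of_nat_0_le_iff]])
qed

end

section \<open>Finitely supported vectors and translation-invariant pairings\<close>

abbreviation (input) "lookup \<equiv> Poly_Mapping.lookup"
abbreviation (input) "keys \<equiv> Poly_Mapping.keys"
abbreviation (input) "single \<equiv> Poly_Mapping.single"

text \<open>The element of the base of the wreath product with coefficient \<open>lookup f (\<tau>, i)\<close> at the translate by
\<open>i\<close> of the generator \<open>a\<close> (\<open>\<tau> = False\<close>) or \<open>b\<close> (\<open>\<tau> = True\<close>).\<close>

type_synonym vec = "(bool \<times> pt) \<Rightarrow>\<^sub>0 int"

definition shift :: "pt \<Rightarrow> vec \<Rightarrow> vec" where
  "shift u f = Poly_Mapping.map_key (\<lambda>(\<tau>, i). (\<tau>, i - u)) f"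

lemma inj_translate: "inj (\<lambda>(\<tau>::bool, i::pt). (\<tau>, i - u))"
  by (auto simp: inj_def)

lemma lookup_shift [simp]: "lookup (shift u f) (\<tau>, i) = lookup f (\<tau>, i - u)"
  unfolding shift_def using inj_translate[of u] by (simp add: map_key.rep_eq)

lemma vec_eqI: "(\<And>\<tau> i. lookup f (\<tau>, i) = lookup g (\<tau>, i)) \<Longrightarrow> f = (g :: vec)"
  by (rule poly_mapping_eqI) auto

lemma shift_shift [simp]: "shift u (shift v f) = shift (u + v) f"
  by (rule vec_eqI) (simp add: algebra_simps)

lemma shift_0 [simp]: "shift 0 f = f"
  by (rule vec_eqI) simp

lemma shift_zero [simp]: "shift u 0 = 0"
  by (rule vec_eqI) simp

lemma shift_add: "shift u (f + g) = shift u f + shift u g"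
  and shift_diff: "shift u (f - g) = shift u f - shift u g"
  and shift_uminus: "shift u (- f) = - shift u f"
  by (rule vec_eqI; simp add: lookup_add lookup_minus)+

lemma shift_single [simp]: "shift u (single (\<tau>, i) m) = single (\<tau>, i + u) m"
  by (rule vec_eqI) (simp add: lookup_single when_def eq_diff_eq)

lemma keys_shift: "keys (shift u f) = (\<lambda>(\<tau>, i). (\<tau>, i + u)) ` keys f"
proof (intro equalityI subsetI)
  fix p assume "p \<in> keys (shift u f)"
  then have "(fst p, snd p - u) \<in> keys f" by (cases p) (simp add: in_keys_iff)
  then show "p \<in> (\<lambda>(\<tau>, i). (\<tau>, i + u)) ` keys f" by (rule rev_image_eqI) simp
qed (auto simp: in_keys_iff)

definition lin :: "('k \<Rightarrow> int) \<Rightarrow> ('k \<Rightarrow>\<^sub>0 int) \<Rightarrow> int" where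
  "lin \<phi> f = (\<Sum>p\<in>keys f. lookup f p * \<phi> p)"

lemma lin_superset: "finite B \<Longrightarrow> keys f \<subseteq> B \<Longrightarrow> lin \<phi> f = (\<Sum>p\<in>B. lookup f p * \<phi> p)"
  unfolding lin_def by (rule sum.mono_neutral_left) (auto simp: in_keys_iff)

lemma lin_zero [simp]: "lin \<phi> 0 = 0"
  by (simp add: lin_def)

lemma lin_add: "lin \<phi> (f + g) = lin \<phi> f + lin \<phi> g"
proof -
  have B: "finite (keys f \<union> keys g)" by simp
  show ?thesis
    using lin_superset[OF B, of "f + g" \<phi>] lin_superset[OF B, of f \<phi>] lin_superset[OF B, of g \<phi>]
      keys_add[of f g] by (simp add: lookup_add distrib_right sum.distrib)
qed

lemma lin_uminus: "lin \<phi> (- f) = - lin \<phi> f"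
  using lin_add[of \<phi> f "- f"] by simp

lemma lin_diff: "lin \<phi> (f - g) = lin \<phi> f - lin \<phi> g"
  using lin_add[of \<phi> "f - g" g] by simp

lemma lin_single [simp]: "lin \<phi> (single p m) = m * \<phi> p"
  by (cases "m = 0") (simp_all add: lin_def)

lemma lin_zero_fun [simp]: "lin (\<lambda>_. 0) f = 0"
  by (simp add: lin_def)

lemma lin_add_fun: "lin (\<lambda>p. \<phi> p + \<psi> p) f = lin \<phi> f + lin \<psi> f"
  by (simp add: lin_def distrib_left sum.distrib)

lemma lin_mult_fun: "lin (\<lambda>p. m * \<phi> p) f = m * lin \<phi> f"
  by (simp add: lin_def sum_distrib_left mult.left_commute)

lemma lin_uminus_fun: "lin (\<lambda>p. - \<phi> p) f = - lin \<phi> f"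
  using lin_mult_fun[of "- 1" \<phi> f] by simp

lemma lin_shift: "lin \<phi> (shift u f) = lin (\<lambda>(\<tau>, i). \<phi> (\<tau>, i + u)) f"
  unfolding lin_def keys_shift
  by (subst sum.reindex) (auto simp: inj_on_def intro!: sum.cong)

lemma lin_cong: "(\<And>p. p \<in> keys f \<Longrightarrow> \<phi> p = \<psi> p) \<Longrightarrow> lin \<phi> f = lin \<psi> f"
  by (simp add: lin_def)

definition l1 :: "vec \<Rightarrow> int" where
  "l1 f = (\<Sum>p\<in>keys f. \<bar>lookup f p\<bar>)"

lemma l1_superset: "finite B \<Longrightarrow> keys f \<subseteq> B \<Longrightarrow> l1 f = (\<Sum>p\<in>B. \<bar>lookup f p\<bar>)"
  unfolding l1_def by (rule sum.mono_neutral_left) (auto simp: in_keys_iff)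

lemma l1_nonneg [simp]: "0 \<le> l1 f"
  by (simp add: l1_def sum_nonneg)

lemma l1_zero [simp]: "l1 0 = 0"
  by (simp add: l1_def)

lemma l1_single [simp]: "l1 (single p m) = \<bar>m\<bar>"
  by (cases "m = 0") (simp_all add: l1_def)

lemma l1_add: "l1 (f + g) \<le> l1 f + l1 g"
proof -
  have B: "finite (keys f \<union> keys g)" by simp
  show ?thesis
    using l1_superset[OF B, of "f + g"] l1_superset[OF B, of f] l1_superset[OF B, of g]
      keys_add[of f g] by (simp add: lookup_add sum.distrib[symmetric] sum_mono)
qed

lemma l1_uminus [simp]: "l1 (- f) = l1 f"
proof -
  have "keys (- f) = keys f" by (auto simp: in_keys_iff)
  then show ?thesis by (simp add: l1_def)
qed

lemma l1_shift [simp]: "l1 (shift u f) = l1 f"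
  unfolding l1_def keys_shift
  by (subst sum.reindex) (auto simp: inj_on_def intro!: sum.cong)

lemma abs_lookup_le_l1: "\<bar>lookup f p\<bar> \<le> l1 f"
proof (cases "p \<in> keys f")
  case True
  then show ?thesis unfolding l1_def by (intro member_le_sum) auto
qed (simp add: in_keys_iff)

lemma abs_lin_le:
  assumes "\<And>p. p \<in> keys f \<Longrightarrow> \<bar>\<phi> p\<bar> \<le> W"
  shows "\<bar>lin \<phi> f\<bar> \<le> l1 f * W"
proof -
  have "\<bar>lin \<phi> f\<bar> \<le> (\<Sum>p\<in>keys f. \<bar>lookup f p * \<phi> p\<bar>)" unfolding lin_def by (rule sum_abs)
  also have "\<dots> \<le> (\<Sum>p\<in>keys f. \<bar>lookup f p\<bar> * W)"
    by (intro sum_mono) (simp add: abs_mult assms mult_left_mono)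
  finally show ?thesis by (simp add: l1_def sum_distrib_right)
qed

text \<open>The bilinear form with value \<open>c \<tau> \<sigma> (j - i)\<close> on the basis vectors at \<open>(\<tau>, i)\<close> and \<open>(\<sigma>, j)\<close>. It is
invariant under translations, hence a cocycle that also extends to the translations.\<close>

definition pairing :: "(bool \<Rightarrow> bool \<Rightarrow> pt \<Rightarrow> int) \<Rightarrow> vec \<Rightarrow> vec \<Rightarrow> int" where
  "pairing c f g = lin (\<lambda>(\<tau>, i). lin (\<lambda>(\<sigma>, j). c \<tau> \<sigma> (j - i)) g) f"

lemma pairing_zero [simp]: "pairing c 0 g = 0" "pairing c f 0 = 0"
  by (simp_all add: pairing_def case_prod_unfold)

lemma pairing_add_left: "pairing c (f + f') g = pairing c f g + pairing c f' g"
  and pairing_add_right: "pairing c f (g + g') = pairing c f g + pairing c f g'"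
  by (simp_all add: pairing_def lin_add case_prod_unfold lin_add_fun)

lemma pairing_uminus_left: "pairing c (- f) g = - pairing c f g"
  and pairing_uminus_right: "pairing c f (- g) = - pairing c f g"
  by (simp_all add: pairing_def lin_uminus case_prod_unfold lin_uminus_fun)

lemma pairing_diff_left: "pairing c (f - f') g = pairing c f g - pairing c f' g"
  and pairing_diff_right: "pairing c f (g - g') = pairing c f g - pairing c f g'"
  using pairing_add_left[of c "f - f'" f' g] pairing_add_right[of c f "g - g'" g'] by simp_all

lemma pairing_shift [simp]: "pairing c (shift u f) (shift u g) = pairing c f g"
  by (simp add: pairing_def lin_shift case_prod_unfold)

lemma pairing_shift_left: "pairing c (shift u f) g = pairing c f (shift (- u) g)"
  using pairing_shift[of c u f "shift (- u) g"] by simp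

lemma pairing_single_left:
  "pairing c (single (\<tau>, i) m) g = m * lin (\<lambda>(\<sigma>, j). c \<tau> \<sigma> (j - i)) g"
  by (simp add: pairing_def)

lemma pairing_single_right:
  "pairing c f (single (\<sigma>, j) m) = m * lin (\<lambda>(\<tau>, i). c \<tau> \<sigma> (j - i)) f"
  by (simp add: pairing_def case_prod_unfold lin_mult_fun)

text \<open>The exponent of the centre in a commutator of two elements without translation part.\<close>

definition commutator_form :: "(bool \<Rightarrow> bool \<Rightarrow> pt \<Rightarrow> int) \<Rightarrow> vec \<Rightarrow> vec \<Rightarrow> int" where
  "commutator_form c f g = pairing c f g - pairing c g f"

lemma commutator_form_add_left:
  "commutator_form c (f + f') g = commutator_form c f g + commutator_form c f' g"
  by (simp add: commutator_form_def pairing_add_left pairing_add_right)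

section \<open>The central extension\<close>

type_synonym elt = "pt \<times> vec \<times> int"

text \<open>A triple consists of a translation, a vector and an exponent of the centre.\<close>

definition ext :: "(bool \<Rightarrow> bool \<Rightarrow> pt \<Rightarrow> int) \<Rightarrow> elt monoid" where
  "ext c = \<lparr>carrier = UNIV,
     mult = (\<lambda>(s, f, z) (s', f', z'). (s + s', f + shift s f', z + z' + pairing c f (shift s f'))),
     one = (0, 0, 0)\<rparr>"

lemma carrier_ext [simp]: "carrier (ext c) = UNIV"
  and one_ext [simp]: "\<one>\<^bsub>ext c\<^esub> = (0, 0, 0)"
  and mult_ext [simp]: "(s, f, z) \<otimes>\<^bsub>ext c\<^esub> (s', f', z') =
    (s + s', f + shift s f', z + z' + pairing c f (shift s f'))"
  by (simp_all add: ext_def)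

lemma group_ext: "group (ext c)"
proof (rule groupI)
  fix x y z :: elt
  show "x \<otimes>\<^bsub>ext c\<^esub> y \<otimes>\<^bsub>ext c\<^esub> z = x \<otimes>\<^bsub>ext c\<^esub> (y \<otimes>\<^bsub>ext c\<^esub> z)"
    by (cases x; cases y; cases z)
      (simp add: shift_add pairing_add_left pairing_add_right pairing_shift_left algebra_simps)
  show "\<exists>y\<in>carrier (ext c). y \<otimes>\<^bsub>ext c\<^esub> x = \<one>\<^bsub>ext c\<^esub>"
  proof (cases x)
    case (fields s f w)
    show ?thesis unfolding fields
      by (rule bexI[of _ "(- s, - shift (- s) f, - w + pairing c f f)"])
        (simp_all add: pairing_uminus_left)
  qed
qed (auto simp: ext_def)

interpretation ext: group "ext c" for c by (rule group_ext)

lemma inv_ext [simp]: "inv\<^bsub>ext c\<^esub> (s, f, z) = (- s, - shift (- s) f, - z + pairing c f f)"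
  by (rule ext.inv_equality) (simp_all add: pairing_uminus_left)

lemma (in group) conjugates_iff:
  "g\<^sub>1 \<in> carrier G \<Longrightarrow> g\<^sub>2 \<in> carrier G \<Longrightarrow>
    conjugates G h g\<^sub>1 g\<^sub>2 \<longleftrightarrow> h \<in> carrier G \<and> h \<otimes> g\<^sub>1 = g\<^sub>2 \<otimes> h"
  unfolding conjugates_def by (metis inv_solve_right m_closed)

lemma conjugates_ext:
  "conjugates (ext c) (u, h, w) (s, f, z) (s', f', z') \<longleftrightarrow>
    s' = s \<and> h + shift u f = f' + shift s h \<and>
    z + pairing c h (shift u f) = z' + pairing c f' (shift s h)"
  by (auto simp: ext.conjugates_iff add.commute)

lemma torsion_free_ext: "torsion_free (ext c)"
  unfolding torsion_free_def
proof (intro ballI allI impI)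
  fix x :: elt and n :: nat
  assume n: "0 < n" and x: "x [^]\<^bsub>ext c\<^esub> n = \<one>\<^bsub>ext c\<^esub>"
  obtain s f z where sfz: "x = (s, f, z)" by (cases x)
  have "fst (fst ((s, f, z) [^]\<^bsub>ext c\<^esub> k)) = int k * fst s \<and> snd (fst ((s, f, z) [^]\<^bsub>ext c\<^esub> k)) = int k * snd s" for k :: nat
  proof (induction k)
    case (Suc k)
    then show ?case by (cases "(s, f, z) [^]\<^bsub>ext c\<^esub> k") (simp add: algebra_simps)
  qed simp
  from this[of n] have s: "s = 0" using x n by (simp add: sfz prod_eq_iff)
  have "fst ((0, f, z) [^]\<^bsub>ext c\<^esub> k) = 0 \<and> lookup (fst (snd ((0, f, z) [^]\<^bsub>ext c\<^esub> k))) p = int k * lookup f p" for k :: nat and p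
  proof (induction k)
    case (Suc k)
    then show ?case by (cases "(0, f, z) [^]\<^bsub>ext c\<^esub> k") (simp add: algebra_simps lookup_add)
  qed simp
  from this[of n] have f: "f = 0" using x n by (intro poly_mapping_eqI) (simp add: sfz s)
  have "(0, 0, z) [^]\<^bsub>ext c\<^esub> k = (0, 0, int k * z)" for k :: nat
    by (induction k) (simp_all add: algebra_simps)
  then show "x = \<one>\<^bsub>ext c\<^esub>" using x n by (simp add: sfz s f)
qed

lemma subgroup_ext_shift0: "subgroup {(0, f, z) | f z. True} (ext c)"
  and subgroup_ext_center: "subgroup {(0, 0, z) | z. True} (ext c)"
  by (rule ext.subgroupI; auto)+

lemma (in group) derived_commutator:
  "x \<in> H \<Longrightarrow> y \<in> H \<Longrightarrow> x \<otimes> y \<otimes> inv x \<otimes> inv y \<in> derived G H"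
  unfolding derived_def by (rule generate.incl) blast

text \<open>Commutators lose the translation part, commutators of those lose the vector, and what remains is
central.\<close>

lemma derived_ext_3: "(derived (ext c) ^^ 3) (carrier (ext c)) = {\<one>\<^bsub>ext c\<^esub>}"
proof -
  let ?d = "derived (ext c)"
  have 1: "?d UNIV \<subseteq> {(0, f, z) | f z. True}"
    unfolding derived_def by (rule ext.generate_subgroup_incl[OF _ subgroup_ext_shift0]) (auto simp: zero_prod_def)
  have 2: "?d {(0, f, z) | f z. True} \<subseteq> {(0, 0, z) | z. True}"
    unfolding derived_def by (rule ext.generate_subgroup_incl[OF _ subgroup_ext_center]) auto
  have 3: "?d {(0, 0, z) | z. True} \<subseteq> {(0, 0, 0)}"
    unfolding derived_def
    by (rule ext.generate_subgroup_incl[OF _ ext.triv_subgroup[unfolded one_ext]]) auto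
  have "?d (?d (?d UNIV)) \<subseteq> {(0, 0, 0)}"
    using 3 ext.mono_derived[OF order_trans[OF ext.mono_derived[OF 1] 2]] by blast
  moreover have "\<one>\<^bsub>ext c\<^esub> \<in> (?d ^^ 3) (carrier (ext c))"
    by (rule subgroup.one_closed[OF ext.exp_of_derived_is_subgroup[OF ext.subgroup_self]])
  ultimately show ?thesis by (auto simp: numeral_3_eq_3)
qed

text \<open>The first derived group contains the differences \<open>e \<tau> u\<close> of two translates of a generator. The
hypotheses on the kernel single out two of them whose commutator is the value at \<open>(0, 1)\<close>, the three
other terms of the bilinear expansion being zero.\<close>

lemma derived_length_ext:
  assumes "\<And>v. c True False v = 0" "c False True (0, 1) \<noteq> 0" "c False True (0, 2) = 0"
    "c False True (0, - 1) = 0" "c False True (0, 0) = 0"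
  shows "derived_length (ext c) = 3"
  unfolding derived_length_def
proof (rule Least_equality, rule derived_ext_3)
  let ?d = "derived (ext c)"
  fix m assume m: "(?d ^^ m) (carrier (ext c)) = {\<one>\<^bsub>ext c\<^esub>}"
  define e where "e \<tau> u = single (\<tau>, u) (1::int) - single (\<tau>, 0) 1" for \<tau> :: bool and u :: pt
  have e: "\<exists>w. (0, e \<tau> u, w) \<in> ?d UNIV" for \<tau> u
    using ext.derived_commutator[of "(u, 0, 0)" UNIV "(0, single (\<tau>, 0) 1, 0)" c]
    by (auto simp: e_def)
  obtain w w' where w: "(0, e False (0, - 2), w) \<in> ?d UNIV" "(0, e True (0, - 1), w') \<in> ?d UNIV"
    using e by blast
  have z: "(0, 0) = (0::pt)" by (simp add: zero_prod_def)
  have recursive: "commutator_form c (e False (0, - 2)) (e True (0, - 1)) = c False True (0, 1)"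
    using assms by (simp add: commutator_form_def e_def pairing_diff_left pairing_diff_right
        pairing_single_left lin_diff z)
  have "(0, 0, commutator_form c (e False (0, - 2)) (e True (0, - 1))) \<in> ?d (?d UNIV)"
    using ext.derived_commutator[OF w] 
    by (simp add: commutator_form_def pairing_add_left pairing_add_right pairing_uminus_left pairing_uminus_right)
  then have ne2: "(0, 0, c False True (0, 1)) \<in> (?d ^^ 2) UNIV" by (simp add: recursive numeral_2_eq_2)
  show "3 \<le> m"
  proof (rule ccontr)
    assume "\<not> 3 \<le> m"
    then have "m = 0 \<or> m = 1 \<or> m = 2" by auto
    moreover have "(?d ^^ 0) UNIV \<noteq> {\<one>\<^bsub>ext c\<^esub>}"
    proof
      assume "(?d ^^ 0) UNIV = {\<one>\<^bsub>ext c\<^esub>}"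
      moreover have "((0, 0, 1) :: elt) \<in> (?d ^^ 0) UNIV" by simp
      ultimately have "((0, 0, 1) :: elt) \<in> {\<one>\<^bsub>ext c\<^esub>}" by (rule subst)
      then show False by simp
    qed
    moreover have "(?d ^^ 2) UNIV \<noteq> {\<one>\<^bsub>ext c\<^esub>}" using ne2 assms(2) by auto
    moreover have "(?d ^^ 1) UNIV \<noteq> {\<one>\<^bsub>ext c\<^esub>}"
    proof
      assume "(?d ^^ 1) UNIV = {\<one>\<^bsub>ext c\<^esub>}"
      then have "(?d ^^ 2) UNIV = ?d {\<one>\<^bsub>ext c\<^esub>}" by (simp add: numeral_2_eq_2)
      also have "\<dots> \<subseteq> {\<one>\<^bsub>ext c\<^esub>}"
        unfolding derived_def by (rule ext.generate_subgroup_incl[OF _ ext.triv_subgroup]) auto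
      finally show False using ne2 assms(2) by auto
    qed
    ultimately show False using m unfolding carrier_ext by metis
  qed
qed

section \<open>Word norms and conjugator length\<close>

text \<open>This is the set of letters that occurs in \<^const>\<open>word_norm\<close>.\<close>

definition letters :: "('a, 'b) monoid_scheme \<Rightarrow> 'a set \<Rightarrow> 'a set" where
  "letters G S = S \<union> m_inv G ` S"

context group
begin

lemma letters_subset: "S \<subseteq> carrier G \<Longrightarrow> letters G S \<subseteq> carrier G"
  by (auto simp: letters_def)

lemma letters_inv: "S \<subseteq> carrier G \<Longrightarrow> x \<in> letters G S \<Longrightarrow> inv x \<in> letters G S"
  by (auto simp: letters_def)

lemma foldr_mult_closed [simp]: "set ws \<subseteq> carrier G \<Longrightarrow> foldr (mult G) ws \<one> \<in> carrier G"
  by (induction ws) auto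

lemma foldr_mult_append:
  "set us \<subseteq> carrier G \<Longrightarrow> set vs \<subseteq> carrier G \<Longrightarrow>
    foldr (mult G) (us @ vs) \<one> = foldr (mult G) us \<one> \<otimes> foldr (mult G) vs \<one>"
  by (induction us) (auto simp: m_assoc)

lemma foldr_mult_inverse:
  "set ws \<subseteq> carrier G \<Longrightarrow> foldr (mult G) (rev (map (m_inv G) ws)) \<one> = inv (foldr (mult G) ws \<one>)"
proof (induction ws)
  case (Cons w ws)
  moreover have "set (rev (map (m_inv G) ws)) \<subseteq> carrier G" using Cons.prems by auto
  ultimately show ?case by (simp add: foldr_mult_append inv_mult_group del: foldr_append)
qed simp

text \<open>An upper bound for the word norm that is meaningful before \<open>S\<close> is known to generate the group. It is an
integer because all estimates below are integer inequalities.\<close>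

definition in_ball :: "'a set \<Rightarrow> 'a \<Rightarrow> int \<Rightarrow> bool" where
  "in_ball S g n \<longleftrightarrow> (\<exists>ws. int (length ws) \<le> n \<and> set ws \<subseteq> letters G S \<and> foldr (mult G) ws \<one> = g)"

lemma in_ball_one [intro]: "0 \<le> n \<Longrightarrow> in_ball S \<one> n"
  unfolding in_ball_def by (rule exI[of _ "[]"]) auto

lemma in_ball_mono: "in_ball S g n \<Longrightarrow> n \<le> m \<Longrightarrow> in_ball S g m"
proof -
  assume "in_ball S g n" "n \<le> m"
  then obtain ws where "int (length ws) \<le> n" "set ws \<subseteq> letters G S" "foldr (mult G) ws \<one> = g"
    unfolding in_ball_def by blast
  with \<open>n \<le> m\<close> show ?thesis unfolding in_ball_def by (intro exI[of _ ws]) simp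
qed

lemma in_ball_mult:
  assumes "S \<subseteq> carrier G" "in_ball S g n" "in_ball S h m"
  shows "in_ball S (g \<otimes> h) (n + m)"
proof -
  obtain us vs where "int (length us) \<le> n" "set us \<subseteq> letters G S" "foldr (mult G) us \<one> = g"
    "int (length vs) \<le> m" "set vs \<subseteq> letters G S" "foldr (mult G) vs \<one> = h"
    using assms(2,3) unfolding in_ball_def by blast
  then show ?thesis unfolding in_ball_def using letters_subset[OF assms(1)]
    by (intro exI[of _ "us @ vs"]) (auto simp: foldr_mult_append simp del: foldr_append)
qed

lemma in_ball_inv:
  assumes "S \<subseteq> carrier G" "in_ball S g n"
  shows "in_ball S (inv g) n"
proof -
  obtain us where "int (length us) \<le> n" "set us \<subseteq> letters G S" "foldr (mult G) us \<one> = g"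
    using assms(2) unfolding in_ball_def by blast
  then show ?thesis unfolding in_ball_def using letters_subset[OF assms(1)] letters_inv[OF assms(1)]
    by (intro exI[of _ "rev (map (m_inv G) us)"]) (auto simp: foldr_mult_inverse)
qed

lemma in_ball_letter:
  assumes "S \<subseteq> carrier G" "x \<in> letters G S" "1 \<le> n"
  shows "in_ball S x n"
proof -
  have "x \<in> carrier G" using letters_subset[OF assms(1)] assms(2) by blast
  then show ?thesis unfolding in_ball_def using assms(2,3) by (intro exI[of _ "[x]"]) simp
qed

lemma generate_in_ball:
  assumes "S \<subseteq> carrier G" "g \<in> generate G S"
  shows "\<exists>n. in_ball S g n"
  using assms(2)
proof (induction rule: generate.induct)
  case (eng h1 h2)
  then show ?case using in_ball_mult[OF assms(1)] by blast
next
  case one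
  show ?case using in_ball_one[of 0 S] by auto
next
  case (incl h)
  then show ?case using in_ball_letter[OF assms(1), of h 1] by (auto simp: letters_def)
next
  case (inv h)
  then show ?case using in_ball_letter[OF assms(1), of "inv h" 1] by (auto simp: letters_def)
qed

lemma word_norm_le: "in_ball S g n \<Longrightarrow> int (word_norm G S g) \<le> n"
proof -
  assume "in_ball S g n"
  then obtain us where us: "int (length us) \<le> n" "set us \<subseteq> letters G S" "foldr (mult G) us \<one> = g"
    unfolding in_ball_def by blast
  have "word_norm G S g \<le> length us"
    unfolding word_norm_def by (rule Least_le) (use us in \<open>auto simp: letters_def\<close>)
  then show ?thesis using us(1) by simp
qed

lemma in_ball_word_norm:
  assumes "finite_generating_set G S" "g \<in> carrier G"
  shows "in_ball S g (int (word_norm G S g))"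
proof -
  have "S \<subseteq> carrier G" "g \<in> generate G S" using assms by (auto simp: finite_generating_set_def)
  then obtain us where us: "set us \<subseteq> letters G S" "foldr (mult G) us \<one> = g"
    using generate_in_ball unfolding in_ball_def by blast
  have "\<exists>ws. length ws = word_norm G S g \<and> set ws \<subseteq> S \<union> m_inv G ` S \<and> foldr (mult G) ws \<one> = g"
    unfolding word_norm_def by (rule LeastI_ex) (use us in \<open>auto simp: letters_def\<close>)
  then obtain ws where "length ws = word_norm G S g" "set ws \<subseteq> letters G S" "foldr (mult G) ws \<one> = g"
    unfolding letters_def by blast
  then show ?thesis unfolding in_ball_def by (intro exI[of _ ws]) simp
qed

lemma in_ball_iff_word_norm:
  assumes "finite_generating_set G S" "g \<in> carrier G"
  shows "in_ball S g n \<longleftrightarrow> int (word_norm G S g) \<le> n"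
proof
  assume "int (word_norm G S g) \<le> n"
  then show "in_ball S g n" by (rule in_ball_mono[OF in_ball_word_norm[OF assms]])
qed (rule word_norm_le)

lemma finite_ball:
  assumes "finite_generating_set G S"
  shows "finite {g \<in> carrier G. word_norm G S g \<le> n}"
proof (rule finite_subset)
  have "finite (letters G S)" using assms by (simp add: finite_generating_set_def letters_def)
  then show "finite ((\<lambda>ws. foldr (mult G) ws \<one>) ` {ws. set ws \<subseteq> letters G S \<and> length ws \<le> n})"
    by (intro finite_imageI finite_lists_length_le)
  show "{g \<in> carrier G. word_norm G S g \<le> n} \<subseteq>
      (\<lambda>ws. foldr (mult G) ws \<one>) ` {ws. set ws \<subseteq> letters G S \<and> length ws \<le> n}"
  proof
    fix g assume g: "g \<in> {g \<in> carrier G. word_norm G S g \<le> n}"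
    then have "in_ball S g (int n)" using assms by (simp add: in_ball_iff_word_norm)
    then show "g \<in> (\<lambda>ws. foldr (mult G) ws \<one>) ` {ws. set ws \<subseteq> letters G S \<and> length ws \<le> n}"
      unfolding in_ball_def by auto
  qed
qed

lemma in_ball_change:
  assumes "finite_generating_set G S" "finite_generating_set G S'"
  shows "\<exists>C\<ge>1. \<forall>g n. in_ball S' g n \<longrightarrow> in_ball S g (int C * n)"
proof -
  have S: "S \<subseteq> carrier G" "S' \<subseteq> carrier G" "finite (letters G S')"
    using assms by (auto simp: finite_generating_set_def letters_def)
  define C where "C = Suc (\<Sum>x\<in>letters G S'. word_norm G S x)"
  have letter: "in_ball S x (int C)" if "x \<in> letters G S'" for x
  proof -
    have "word_norm G S x \<le> C" unfolding C_def
      using member_le_sum[of x "letters G S'" "word_norm G S"] that S(3) by simp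
    then show ?thesis using in_ball_iff_word_norm[OF assms(1)] letters_subset[OF S(2)] that by auto
  qed
  have word: "in_ball S (foldr (mult G) ws \<one>) (int C * int (length ws))" if "set ws \<subseteq> letters G S'" for ws
    using that
  proof (induction ws)
    case (Cons w ws)
    then have "in_ball S (w \<otimes> foldr (mult G) ws \<one>) (int C + int C * int (length ws))"
      by (intro in_ball_mult[OF S(1)] letter) auto
    then show ?case by (simp add: algebra_simps)
  qed auto
  then have "in_ball S g (int C * n)" if h: "in_ball S' g n" for g n
  proof -
    obtain ws where ws: "int (length ws) \<le> n" "set ws \<subseteq> letters G S'" "foldr (mult G) ws \<one> = g"
      using h unfolding in_ball_def by blast
    have "int C * int (length ws) \<le> int C * n" using ws(1) by (intro mult_left_mono) auto
    then show ?thesis using word[OF ws(2)] unfolding ws(3) by (rule in_ball_mono[rotated])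
  qed
  then show ?thesis unfolding C_def by (intro exI[of _ C]) (auto simp: C_def)
qed

lemma word_norm_change:
  assumes "finite_generating_set G S" "finite_generating_set G S'"
  shows "\<exists>C\<ge>1. \<forall>g\<in>carrier G. word_norm G S g \<le> C * word_norm G S' g"
proof -
  obtain C where C: "C \<ge> 1" "\<And>g n. in_ball S' g n \<Longrightarrow> in_ball S g (int C * n)"
    using in_ball_change[OF assms] by blast
  have "int (word_norm G S g) \<le> int (C * word_norm G S' g)" if "g \<in> carrier G" for g
    using word_norm_le[OF C(2)[OF in_ball_word_norm[OF assms(2) that]]] by simp
  then have "\<forall>g\<in>carrier G. word_norm G S g \<le> C * word_norm G S' g" unfolding of_nat_le_iff by blast
  then show ?thesis using C(1) by blast
qed

text \<open>The function \<open>N\<close> will be the word norm with respect to one convenient generating set. Comparing it with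
an arbitrary \<open>S\<close> costs linear factors inside and outside, which is what the equivalence forgives.\<close>

theorem conjugator_length_asymp_equiv:
  fixes N :: "'a \<Rightarrow> nat" and \<Phi> :: "nat \<Rightarrow> nat"
  assumes S: "finite_generating_set G S" and mono: "mono_on {1..} \<Phi>"
    and C1: "C1 \<ge> 1" "\<And>g. g \<in> carrier G \<Longrightarrow> word_norm G S g \<le> C1 * N g"
    and C2: "C2 \<ge> 1" "\<And>g. g \<in> carrier G \<Longrightarrow> N g \<le> C2 * word_norm G S g"
    and upper: "C3 \<ge> 1" "\<And>n g\<^sub>1 g\<^sub>2. n \<ge> 1 \<Longrightarrow> g\<^sub>1 \<in> carrier G \<Longrightarrow> g\<^sub>2 \<in> carrier G \<Longrightarrow> N g\<^sub>1 \<le> n \<Longrightarrow> N g\<^sub>2 \<le> n \<Longrightarrow>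
      conjugate G g\<^sub>1 g\<^sub>2 \<Longrightarrow> \<exists>h. conjugates G h g\<^sub>1 g\<^sub>2 \<and> N h \<le> C3 * \<Phi> (C3 * n)"
    and lower: "C4 \<ge> 1" "\<And>n. n \<ge> 1 \<Longrightarrow> \<exists>g\<^sub>1 g\<^sub>2. g\<^sub>1 \<in> carrier G \<and> g\<^sub>2 \<in> carrier G \<and> N g\<^sub>1 \<le> C4 * n \<and> N g\<^sub>2 \<le> C4 * n \<and>
      conjugate G g\<^sub>1 g\<^sub>2 \<and> (\<forall>h. conjugates G h g\<^sub>1 g\<^sub>2 \<longrightarrow> \<Phi> n \<le> N h)"
  shows "asymp_equiv (\<lambda>n. real (conjugator_length G S n)) (\<lambda>n. real (\<Phi> n))"
proof -
  define L where "L g\<^sub>1 g\<^sub>2 = (LEAST k. \<exists>h. conjugates G h g\<^sub>1 g\<^sub>2 \<and> word_norm G S h = k)" for g\<^sub>1 g\<^sub>2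
  define A where "A n = {(g\<^sub>1, g\<^sub>2). g\<^sub>1 \<in> carrier G \<and> g\<^sub>2 \<in> carrier G \<and>
    word_norm G S g\<^sub>1 \<le> n \<and> word_norm G S g\<^sub>2 \<le> n \<and> conjugate G g\<^sub>1 g\<^sub>2}" for n
  have cl: "conjugator_length G S n = Max ((\<lambda>(g\<^sub>1, g\<^sub>2). L g\<^sub>1 g\<^sub>2) ` A n)" for n
    unfolding conjugator_length_def L_def A_def by (rule arg_cong[of _ _ Max]) auto
  have fin: "finite (A n)" for n
    by (rule finite_subset[OF _ finite_cartesian_product[OF finite_ball[OF S, of n] finite_ball[OF S, of n]]])
      (auto simp: A_def)
  have "conjugate G \<one> \<one>" unfolding conjugate_def conjugates_def by (intro exI[of _ \<one>]) simp
  moreover have "word_norm G S \<one> = 0" using word_norm_le[OF in_ball_one[of 0]] by simp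
  ultimately have "(\<one>, \<one>) \<in> A n" for n by (simp add: A_def)
  then have ne: "A n \<noteq> {}" for n by blast
  have Lle: "L g\<^sub>1 g\<^sub>2 \<le> word_norm G S h" if "conjugates G h g\<^sub>1 g\<^sub>2" for g\<^sub>1 g\<^sub>2 h
    unfolding L_def by (rule Least_le) (use that in blast)
  have Lex: "\<exists>h. conjugates G h g\<^sub>1 g\<^sub>2 \<and> word_norm G S h = L g\<^sub>1 g\<^sub>2" if "conjugate G g\<^sub>1 g\<^sub>2" for g\<^sub>1 g\<^sub>2
    unfolding L_def by (rule LeastI_ex) (use that in \<open>auto simp: conjugate_def\<close>)
  have carr: "h \<in> carrier G" if "conjugates G h g\<^sub>1 g\<^sub>2" for h g\<^sub>1 g\<^sub>2
    using that by (simp add: conjugates_def)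
  define C where "C = C1 * C2 * C3"
  have upper_bound: "conjugator_length G S n \<le> C * \<Phi> (C * n)" if n: "n \<ge> 1" for n
    unfolding cl
  proof (rule Max.boundedI)
    fix k assume "k \<in> (\<lambda>(g\<^sub>1, g\<^sub>2). L g\<^sub>1 g\<^sub>2) ` A n"
    then obtain g\<^sub>1 g\<^sub>2 where g: "k = L g\<^sub>1 g\<^sub>2" "g\<^sub>1 \<in> carrier G" "g\<^sub>2 \<in> carrier G"
      "word_norm G S g\<^sub>1 \<le> n" "word_norm G S g\<^sub>2 \<le> n" "conjugate G g\<^sub>1 g\<^sub>2" by (auto simp: A_def)
    have "N g\<^sub>1 \<le> C2 * n" "N g\<^sub>2 \<le> C2 * n"
      using C2(2)[OF g(2)] C2(2)[OF g(3)] g(4,5) by (meson le_trans mult_le_mono2)+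
    moreover have "1 \<le> C2 * n" using C2(1) n by simp
    ultimately obtain h where h: "conjugates G h g\<^sub>1 g\<^sub>2" "N h \<le> C3 * \<Phi> (C3 * (C2 * n))"
      using upper(2)[of "C2 * n" g\<^sub>1 g\<^sub>2] g by blast
    have "k \<le> C1 * N h" unfolding g(1) using Lle[OF h(1)] C1(2)[OF carr[OF h(1)]] by linarith
    also have "\<dots> \<le> C1 * (C3 * \<Phi> (C3 * (C2 * n)))" using h(2) by simp
    also have "\<dots> \<le> C1 * (C3 * \<Phi> (C * n))"
    proof -
      have "C3 * (C2 * n) \<le> C * n" unfolding C_def using C1(1) by simp
      moreover have "1 \<le> C3 * (C2 * n)" using upper(1) C2(1) n by simp
      ultimately have "\<Phi> (C3 * (C2 * n)) \<le> \<Phi> (C * n)" 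
        by (intro mono_onD[OF mono]; (unfold atLeast_iff)?; linarith)
      then show ?thesis by simp
    qed
    also have "\<dots> \<le> C * \<Phi> (C * n)" unfolding C_def using C2(1) by simp
    finally show "k \<le> C * \<Phi> (C * n)" .
  qed (use fin ne in auto)
  define D where "D = C1 * C2 * C4"
  have low: "\<Phi> n \<le> D * conjugator_length G S (D * n)" if n: "n \<ge> 1" for n
  proof -
    obtain g\<^sub>1 g\<^sub>2 where g: "g\<^sub>1 \<in> carrier G" "g\<^sub>2 \<in> carrier G" "N g\<^sub>1 \<le> C4 * n" "N g\<^sub>2 \<le> C4 * n"
      "conjugate G g\<^sub>1 g\<^sub>2" "\<And>h. conjugates G h g\<^sub>1 g\<^sub>2 \<Longrightarrow> \<Phi> n \<le> N h" using lower(2)[OF n] by blast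
    have "C1 * (C4 * n) \<le> D * n" unfolding D_def using C2(1) by simp
    then have "word_norm G S g\<^sub>1 \<le> D * n" "word_norm G S g\<^sub>2 \<le> D * n"
      using C1(2)[OF g(1)] C1(2)[OF g(2)] g(3,4) by (meson le_trans mult_le_mono2)+
    then have "(g\<^sub>1, g\<^sub>2) \<in> A (D * n)" using g by (simp add: A_def)
    then have "L g\<^sub>1 g\<^sub>2 \<le> conjugator_length G S (D * n)" unfolding cl
      by (intro Max_ge) (use fin in \<open>auto intro!: image_eqI[of _ _ "(g\<^sub>1, g\<^sub>2)"]\<close>)
    moreover obtain h where h: "conjugates G h g\<^sub>1 g\<^sub>2" "word_norm G S h = L g\<^sub>1 g\<^sub>2" using Lex[OF g(5)] by blast
    have "\<Phi> n \<le> C2 * L g\<^sub>1 g\<^sub>2" using g(6)[OF h(1)] C2(2)[OF carr[OF h(1)]] h(2) by simp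
    ultimately have "\<Phi> n \<le> C2 * conjugator_length G S (D * n)" by (meson le_trans mult_le_mono2)
    also have "\<dots> \<le> D * conjugator_length G S (D * n)" unfolding D_def using C1(1) lower(1) by simp
    finally show ?thesis .
  qed
  have "C \<ge> 1" "D \<ge> 1" unfolding C_def D_def using C1 C2 upper(1) lower(1) by simp_all
  moreover have "real (conjugator_length G S n) \<le> real C * real (\<Phi> (C * n))" if "n \<ge> 1" for n
    using upper_bound[OF that] by (simp only: of_nat_mult[symmetric] of_nat_le_iff)
  moreover have "real (\<Phi> n) \<le> real D * real (conjugator_length G S (D * n))" if "n \<ge> 1" for n
    using low[OF that] by (simp only: of_nat_mult[symmetric] of_nat_le_iff)
  ultimately show ?thesis unfolding asymp_equiv_def asymp_le_def
    by (intro conjI exI[of _ C] exI[of _ D] allI impI) simp_all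
qed

end

section \<open>Word norms in the extension\<close>

definition gens :: "elt set" where
  "gens = {((1, 0), 0, 0), ((0, 1), 0, 0), (0, single (False, 0) 1, 0),
     (0, single (True, 0) 1, 0)}"

text \<open>The first assumption gives the inverses of the generators \<open>a\<close>, \<open>b\<close> no central part. The last one makes
\<open>c\<close> itself a commutator of two translates, so that four generators suffice.\<close>

locale kernel =
  fixes c :: "bool \<Rightarrow> bool \<Rightarrow> pt \<Rightarrow> int"
  assumes c_diag: "c \<tau> \<tau> 0 = 0"
    and c_01: "c True False v = 0" "c False True (0, 1) = 1"
begin

lemma letters_gens:
  "letters (ext c) gens = {(e, 0, 0) | e. e \<in> {(1, 0), (0, 1), (- 1, 0), (0, - 1)}} \<union>
     {(0, single (\<tau>, 0) m, 0) | \<tau> m. m = 1 \<or> m = - 1}" (is "_ = _ \<union> ?B")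
proof -
  have "inv\<^bsub>ext c\<^esub> (0, single (\<tau>, 0) 1, 0) = (0, single (\<tau>, 0) (- 1), 0)" for \<tau>
    by (simp add: pairing_single_left c_diag single_uminus)
  then have "m_inv (ext c) ` gens = {((- 1, 0), 0, 0), ((0, - 1), 0, 0),
      (0, single (False, 0) (- 1), 0), (0, single (True, 0) (- 1), 0)}"
    by (simp add: gens_def)
  moreover have "?B = {(0, single (False, 0) 1, 0), (0, single (True, 0) 1, 0),
      (0, single (False, 0) (- 1), 0), (0, single (True, 0) (- 1), 0)}" (is "_ = ?D")
  proof (intro equalityI subsetI)
    fix x assume "x \<in> ?B"
    then obtain \<tau> m where x: "x = (0, single (\<tau>, 0) m, 0)" "m = 1 \<or> m = - 1" by blast
    then show "x \<in> ?D" by (cases \<tau>) auto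
  qed blast
  ultimately show ?thesis unfolding letters_def gens_def by blast
qed

abbreviation near :: "elt \<Rightarrow> int \<Rightarrow> bool" where
  "near g n \<equiv> ext.in_ball c gens g n"

lemma near_mult: "near g n \<Longrightarrow> near h m \<Longrightarrow> near (g \<otimes>\<^bsub>ext c\<^esub> h) (n + m)"
  by (rule ext.in_ball_mult) auto

lemma near_pow: 
  assumes "near g n" "0 \<le> n"
  shows "near (g [^]\<^bsub>ext c\<^esub> (m::nat)) (int m * n)"
proof (induction m)
  case 0
  then show ?case using ext.in_ball_one[of 0 c gens] by simp
next
  case (Suc m)
  then show ?case using near_mult[OF Suc assms(1)] by (simp add: algebra_simps)
qed

lemma near_translation: "near (u, 0, 0) (pnorm u)"
proof -
  have x: "near ((x, 0), 0, 0) \<bar>x\<bar>" for x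
  proof -
    have "near ((sgn x, 0), 0, 0) 1" if "x \<noteq> 0"
      using that by (intro ext.in_ball_letter) (auto simp: letters_gens sgn_if)
    moreover have "((sgn x, 0), 0, 0) [^]\<^bsub>ext c\<^esub> m = ((int m * sgn x, 0), 0, 0)" for m :: nat
      by (induction m) (auto simp: algebra_simps zero_prod_def)
    ultimately show ?thesis using near_pow[of "((sgn x, 0), 0, 0)" 1 "nat \<bar>x\<bar>"]
      ext.in_ball_one[of 0 c gens] by (cases "x = 0") (auto simp: zero_prod_def mult.commute mult_sgn_abs abs_mult_sgn)
  qed
  have y: "near ((0, y), 0, 0) \<bar>y\<bar>" for y
  proof -
    have "near ((0, sgn y), 0, 0) 1" if "y \<noteq> 0"
      using that by (intro ext.in_ball_letter) (auto simp: letters_gens sgn_if)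
    moreover have "((0, sgn y), 0, 0) [^]\<^bsub>ext c\<^esub> m = ((0, int m * sgn y), 0, 0)" for m :: nat
      by (induction m) (auto simp: algebra_simps zero_prod_def)
    ultimately show ?thesis using near_pow[of "((0, sgn y), 0, 0)" 1 "nat \<bar>y\<bar>"]
      ext.in_ball_one[of 0 c gens] by (cases "y = 0") (auto simp: zero_prod_def mult.commute mult_sgn_abs abs_mult_sgn)
  qed
  show ?thesis using near_mult[OF x[of "fst u"] y[of "snd u"]] by (simp add: pnorm_def)
qed

text \<open>Conjugators matter only modulo the centre, so only the cost of the vector is recorded.\<close>

definition reach :: "vec \<Rightarrow> int \<Rightarrow> bool" where
  "reach f n \<longleftrightarrow> (\<exists>w. near (0, f, w) n)"

lemma reach_zero: "reach 0 0"
  unfolding reach_def using ext.in_ball_one[of 0 c gens] by (intro exI[of _ 0]) simp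

lemma reach_mono: "reach f n \<Longrightarrow> n \<le> m \<Longrightarrow> reach f m"
  unfolding reach_def using ext.in_ball_mono[of c gens "(0, f, w)" n m for w] by blast

lemma reach_add: "reach f n \<Longrightarrow> reach g m \<Longrightarrow> reach (f + g) (n + m)"
proof -
  assume "reach f n" "reach g m"
  then obtain w w' where "near (0, f, w) n" "near (0, g, w') m" unfolding reach_def by blast
  from near_mult[OF this] show ?thesis unfolding reach_def by (simp only: mult_ext shift_0 add_0) blast
qed

lemma reach_single: "reach (single (\<tau>, i) m) (\<bar>m\<bar> + 2 * pnorm i)"
proof -
  have "reach (single (\<tau>, 0) (int k * sgn m)) (int k)" for k
  proof (induction k)
    case 0
    then show ?case by (simp add: reach_zero)
  next
    case (Suc k)
    have "reach (single (\<tau>, 0) (sgn m)) 1"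
    proof (cases "m = 0")
      case True
      then show ?thesis using reach_mono[OF reach_zero, of 1] by simp
    next
      case False
      then have "near (0, single (\<tau>, 0) (sgn m), 0) 1"
        by (intro ext.in_ball_letter) (auto simp: letters_gens sgn_if)
      then show ?thesis by (auto simp: reach_def)
    qed
    from reach_add[OF Suc this] show ?case by (simp add: single_add[symmetric] algebra_simps)
  qed
  from this[of "nat \<bar>m\<bar>"] have "reach (single (\<tau>, 0) m) \<bar>m\<bar>"
    by (simp add: abs_mult_sgn)
  then obtain w where w: "near (0, single (\<tau>, 0) m, w) \<bar>m\<bar>" by (auto simp: reach_def)
  have "near ((i, 0, 0) \<otimes>\<^bsub>ext c\<^esub> (0, single (\<tau>, 0) m, w) \<otimes>\<^bsub>ext c\<^esub> (- i, 0, 0))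
      (pnorm i + \<bar>m\<bar> + pnorm (- i))"
    by (intro near_mult near_translation w)
  then show ?thesis unfolding reach_def by (intro exI[of _ w]) (simp add: add.commute algebra_simps)
qed

lemma reach_bound:
  assumes "finite B" "keys f \<subseteq> B"
  shows "reach f (\<Sum>p\<in>B. \<bar>lookup f p\<bar> + 2 * pnorm (snd p))"
  using assms
proof (induction B arbitrary: f)
  case empty
  then show ?case by (simp add: reach_zero)
next
  case (insert p B)
  define g where "g = f - single p (lookup f p)"
  have g: "lookup g q = (if q = p then 0 else lookup f q)" for q
    by (auto simp: g_def lookup_minus lookup_single when_def)
  then have "keys g \<subseteq> B" using insert.prems by (auto simp: in_keys_iff split: if_splits)
  then have "reach g (\<Sum>q\<in>B. \<bar>lookup g q\<bar> + 2 * pnorm (snd q))" by (rule insert.IH)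
  also have "(\<Sum>q\<in>B. \<bar>lookup g q\<bar> + 2 * pnorm (snd q)) = (\<Sum>q\<in>B. \<bar>lookup f q\<bar> + 2 * pnorm (snd q))"
    using insert.hyps by (intro sum.cong) (auto simp: g)
  finally have "reach g (\<Sum>q\<in>B. \<bar>lookup f q\<bar> + 2 * pnorm (snd q))" .
  moreover have "reach (single p (lookup f p)) (\<bar>lookup f p\<bar> + 2 * pnorm (snd p))"
    using reach_single[of "fst p" "snd p"] by simp
  ultimately have "reach (single p (lookup f p) + g)
     ((\<bar>lookup f p\<bar> + 2 * pnorm (snd p)) + (\<Sum>q\<in>B. \<bar>lookup f q\<bar> + 2 * pnorm (snd q)))"
    by (intro reach_add)
  then show ?case using insert.hyps by (simp add: g_def)
qed

lemma gens_generate: "finite_generating_set (ext c) gens"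
proof -
  interpret H: subgroup "generate (ext c) gens" "ext c" by (rule ext.generate_is_subgroup) simp
  have near_H: "x \<in> generate (ext c) gens" if "near x n" for x n
  proof -
    have "set ws \<subseteq> letters (ext c) gens \<Longrightarrow> foldr (mult (ext c)) ws \<one>\<^bsub>ext c\<^esub> \<in> generate (ext c) gens" for ws
    proof (induction ws)
      case (Cons w ws)
      then have "w \<in> generate (ext c) gens"
        by (auto simp: letters_def intro: generate.incl generate.inv)
      then show ?case using Cons by simp
    qed (use H.one_closed in simp)
    then show ?thesis using that by (auto simp: ext.in_ball_def)
  qed
  define a b :: elt where "a = (0, single (False, 0) (1::int), 0::int)"
    and "b = ((0,1), 0, 0::int) \<otimes>\<^bsub>ext c\<^esub> (0, single (True, 0) (1::int), 0) \<otimes>\<^bsub>ext c\<^esub> ((0, - 1), 0, 0)"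
  have single: "near (0, single (\<tau>, 0) 1, 0) 1" for \<tau>
    by (rule ext.in_ball_letter) (auto simp: letters_gens)
  have ab: "near a 1" "near b (pnorm (0, 1) + 1 + pnorm (0, - 1))"
    unfolding a_def b_def by (intro near_mult near_translation single)+
  have z0: "(0, 0) = (0::pt)" by (simp add: zero_prod_def)
  have "a \<otimes>\<^bsub>ext c\<^esub> b \<otimes>\<^bsub>ext c\<^esub> inv\<^bsub>ext c\<^esub> a \<otimes>\<^bsub>ext c\<^esub> inv\<^bsub>ext c\<^esub> b = (0, 0, 1)"
    using c_01 c_diag by (simp add: a_def b_def z0 pairing_add_left pairing_add_right pairing_uminus_left pairing_uminus_right
      pairing_single_left lin_add lin_uminus)
  moreover have "a \<in> generate (ext c) gens" "b \<in> generate (ext c) gens" using near_H ab by blast+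
  ultimately have one: "(0, 0, 1) \<in> generate (ext c) gens" by (metis H.m_closed H.m_inv_closed)
  have nat: "(0, 0, int m) \<in> generate (ext c) gens" for m
  proof (induction m)
    case (Suc m)
    then show ?case using H.m_closed[OF Suc one] by (simp add: algebra_simps)
  qed (use H.one_closed in simp)
  have central: "(0, 0, z) \<in> generate (ext c) gens" for z
  proof (cases "0 \<le> z")
    case True
    then show ?thesis using nat[of "nat z"] by simp
  next
    case False
    then show ?thesis using H.m_inv_closed[OF nat[of "nat (- z)"]] by simp
  qed
  have "(u, f, z) \<in> generate (ext c) gens" for u f z
  proof -
    obtain w n where "near (0, f, w) n" using reach_bound[of "keys f" f] by (auto simp: reach_def)
    then have "(0, f, w) \<otimes>\<^bsub>ext c\<^esub> (0, 0, z - w) \<otimes>\<^bsub>ext c\<^esub> (u, 0, 0) \<in> generate (ext c) gens"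
      by (intro H.m_closed central near_H[OF near_translation] near_H)
    then show ?thesis by simp
  qed
  then show ?thesis by (auto simp: finite_generating_set_def gens_def)
qed

text \<open>Only finitely many points lie in a ball.\<close>

lemma bounded_on_balls: "\<exists>W. \<forall>\<tau> \<sigma> v. pnorm v \<le> n \<longrightarrow> \<bar>c \<tau> \<sigma> v\<bar> \<le> W"
proof -
  let ?B = "UNIV \<times> UNIV \<times> {-n..n} \<times> {-n..n}"
  let ?f = "\<lambda>(\<tau>, \<sigma>, x, y). \<bar>c \<tau> \<sigma> (x, y)\<bar>"
  have "\<bar>c \<tau> \<sigma> v\<bar> \<le> Max (?f ` ?B)" if "pnorm v \<le> n" for \<tau> \<sigma> v
  proof -
    obtain x y where v: "v = (x, y)" by (cases v)
    have "- n \<le> x" "x \<le> n" "- n \<le> y" "y \<le> n" using that by (auto simp: pnorm_def v)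
    then have "(\<tau>, \<sigma>, x, y) \<in> ?B" by simp
    then have "?f (\<tau>, \<sigma>, x, y) \<in> ?f ` ?B" by (rule imageI)
    then have "?f (\<tau>, \<sigma>, x, y) \<le> Max (?f ` ?B)" by (intro Max_ge) auto
    then show ?thesis by (simp add: v)
  qed
  then show ?thesis by blast
qed

text \<open>Induction on the word. Multiplying by a letter \<open>a\<close> or \<open>b\<close> on the left changes the central exponent by
a pairing with a vector of mass at most \<open>n\<close>, hence the bound \<open>n * n * W\<close>.\<close>

lemma near_bounds_kernel:
  assumes "near (s, f, z) n" and W: "\<And>\<tau> \<sigma> v. pnorm v \<le> n \<Longrightarrow> \<bar>c \<tau> \<sigma> v\<bar> \<le> W"
  shows "pnorm s \<le> n \<and> (\<forall>p\<in>keys f. pnorm (snd p) \<le> n) \<and> l1 f \<le> n \<and> \<bar>z\<bar> \<le> n * n * W"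
proof -
  obtain ws where ws: "int (length ws) \<le> n" "set ws \<subseteq> letters (ext c) gens"
    "foldr (mult (ext c)) ws \<one>\<^bsub>ext c\<^esub> = (s, f, z)" using assms by (auto simp: ext.in_ball_def)
  have n0: "0 \<le> n" using ws(1) by linarith
  have W0: "0 \<le> W" using W[of 0 True True] n0 abs_ge_zero[of "c True True 0"] by simp
  have "pnorm s \<le> int (length ws) \<and> (\<forall>p\<in>keys f. pnorm (snd p) \<le> int (length ws)) \<and> l1 f \<le> int (length ws)
     \<and> \<bar>z\<bar> \<le> int (length ws) * int (length ws) * W"
    using ws
  proof (induction ws arbitrary: s f z)
    case Nil
    then show ?case by simp
  next
    case (Cons l ws)
    obtain s' f' z' where g': "foldr (mult (ext c)) ws \<one>\<^bsub>ext c\<^esub> = (s', f', z')"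
      by (cases "foldr (mult (ext c)) ws \<one>\<^bsub>ext c\<^esub>")
    have IH: "pnorm s' \<le> int (length ws)" "\<And>p. p \<in> keys f' \<Longrightarrow> pnorm (snd p) \<le> int (length ws)"
      "l1 f' \<le> int (length ws)" "\<bar>z'\<bar> \<le> int (length ws) * int (length ws) * W"
      using Cons.IH[of s' f' z'] Cons.prems g' by auto
    have eq: "(s, f, z) = l \<otimes>\<^bsub>ext c\<^esub> (s', f', z')" using Cons.prems(3) g' by simp
    have sq: "int (length ws) * int (length ws) * W + int (length ws) * W
        \<le> int (length (l # ws)) * int (length (l # ws)) * W"
      using W0 by (simp add: algebra_simps)
    consider e where "l = (e, 0, 0)" "e \<in> {(1, 0), (0, 1), (- 1, 0), (0, - 1)}"
      | \<tau> m where "l = (0, single (\<tau>, 0) m, 0)" "m = 1 \<or> m = - 1"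
      using Cons.prems(2) by (auto simp: letters_gens)
    then show ?case
    proof cases
      case 1
      then have e1: "pnorm e = 1" by (auto simp: pnorm_def)
      have s: "s = e + s'" "f = shift e f'" "z = z'" using eq 1 by auto
      have "pnorm s \<le> int (length (l # ws))" using pnorm_triangle[of e s'] IH(1) e1 s by simp
      moreover have "pnorm (snd p) \<le> int (length (l # ws))" if p: "p \<in> keys f" for p
      proof -
        obtain q where q: "q \<in> keys f'" "snd p = snd q + e" using p by (auto simp: s keys_shift)
        then show ?thesis using pnorm_triangle[of "snd q" e] IH(2)[OF q(1)] e1 by simp
      qed
      moreover have "0 \<le> int (length ws) * W" using W0 by simp
      moreover have "l1 f \<le> int (length (l # ws))" using IH(3) s by simp
      moreover have "\<bar>z\<bar> \<le> int (length (l # ws)) * int (length (l # ws)) * W"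
        using IH(4) sq \<open>0 \<le> int (length ws) * W\<close> unfolding s by linarith
      ultimately show ?thesis by blast
    next
      case 2
      have s: "s = s'" "f = single (\<tau>, 0) m + f'" "z = z' + m * lin (\<lambda>(\<sigma>, j). c \<tau> \<sigma> j) f'"
        using eq 2 by (auto simp: pairing_single_left)
      have "pnorm (snd p) \<le> int (length (l # ws))" if p: "p \<in> keys f" for p
      proof -
        have "p \<in> keys (single (\<tau>, 0 :: pt) m) \<union> keys f'"
          using p keys_add[of "single (\<tau>, 0) m" f'] unfolding s by blast
        then have "p = (\<tau>, 0) \<or> p \<in> keys f'" by (auto split: if_splits)
        then show ?thesis using IH(2)[of p] by auto
      qed
      moreover have "l1 f \<le> int (length (l # ws))"
        using l1_add[of "single (\<tau>, 0) m" f'] IH(3) 2 unfolding s by auto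
      moreover have "\<bar>z\<bar> \<le> int (length (l # ws)) * int (length (l # ws)) * W"
      proof -
        have "\<bar>lin (\<lambda>(\<sigma>, j). c \<tau> \<sigma> j) f'\<bar> \<le> l1 f' * W"
        proof (rule abs_lin_le)
          fix p assume "p \<in> keys f'"
          then have "pnorm (snd p) \<le> n" using IH(2)[of p] Cons.prems(1) by simp
          then show "\<bar>case p of (\<sigma>, j) \<Rightarrow> c \<tau> \<sigma> j\<bar> \<le> W" using W by (cases p) simp
        qed
        moreover have "l1 f' * W \<le> int (length ws) * W" using IH(3) W0 by (intro mult_right_mono)
        moreover have "\<bar>z\<bar> \<le> \<bar>z'\<bar> + \<bar>lin (\<lambda>(\<sigma>, j). c \<tau> \<sigma> j) f'\<bar>" unfolding s using 2 by auto
        ultimately show ?thesis using IH(4) sq by linarith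
      qed
      moreover have "pnorm s \<le> int (length (l # ws))" using IH(1) unfolding s by simp
      ultimately show ?thesis by blast
    qed
  qed
  moreover have "int (length ws) * int (length ws) * W \<le> n * n * W"
    using ws(1) W0 by (intro mult_right_mono mult_mono) auto
  ultimately show ?thesis using ws(1) by force
qed

lemma near_bounds:
  assumes "near (s, f, z) n"
  shows "pnorm s \<le> n" "p \<in> keys f \<Longrightarrow> pnorm (snd p) \<le> n" "l1 f \<le> n"
proof -
  obtain W where W: "\<And>\<tau> \<sigma> v. pnorm v \<le> n \<Longrightarrow> \<bar>c \<tau> \<sigma> v\<bar> \<le> W" using bounded_on_balls[of n] by blast
  note b = near_bounds_kernel[OF assms W]
  show "pnorm s \<le> n" "l1 f \<le> n" using b by simp_all
  show "pnorm (snd p) \<le> n" if "p \<in> keys f" using b that by simp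
qed

end

section \<open>Conjugacy of elements that translate\<close>

lemma (in group) conjugates_trans:
  "conjugates G h a b \<Longrightarrow> conjugates G k b c \<Longrightarrow> a \<in> carrier G \<Longrightarrow> conjugates G (k \<otimes> h) a c"
  unfolding conjugates_def by (auto simp: m_assoc inv_mult_group)

lemma (in group) conjugates_inv:
  assumes "conjugates G h a b" "a \<in> carrier G"
  shows "conjugates G (inv h) b a"
proof -
  have h: "h \<in> carrier G" "b = h \<otimes> a \<otimes> inv h" using assms by (auto simp: conjugates_def)
  then have "inv h \<otimes> b \<otimes> h = (inv h \<otimes> h) \<otimes> a \<otimes> (inv h \<otimes> h)" using assms(2) by (simp only: m_assoc inv_closed m_closed)
  then show ?thesis using h assms(2) by (simp add: conjugates_def)
qed

definition scale :: "int \<Rightarrow> pt \<Rightarrow> pt" where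
  "scale m s = (m * fst s, m * snd s)"

lemma scale_simps [simp]: "scale 0 s = 0" "scale 1 s = s"
  and scale_add: "scale (m + m') s = scale m s + scale m' s"
  and scale_uminus: "scale (- m) s = - scale m s"
  by (auto simp: scale_def algebra_simps zero_prod_def)

lemma scale_eq_iff: "s \<noteq> 0 \<Longrightarrow> scale m s = scale m' s \<longleftrightarrow> m = m'"
  by (auto simp: scale_def zero_prod_def prod_eq_iff)

context kernel
begin

text \<open>Comparing vectors in a conjugacy equation gives \<open>h - shift s h = g - shift u f\<close>. On each line in
direction \<open>s\<close> the vector \<open>h\<close> is therefore a sum of values of the right-hand side.\<close>

lemma line_sum:
  assumes "h + shift u f = g + shift s h"
  shows "lookup h (\<tau>, v) = lookup h (\<tau>, v - scale (int N) s) +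
    (\<Sum>k<N. lookup (g - shift u f) (\<tau>, v - scale (int k) s))"
proof (induction N)
  case (Suc N)
  have "lookup h (\<tau>, w) - lookup h (\<tau>, w - s) = lookup (g - shift u f) (\<tau>, w)" for w
    using arg_cong[OF assms, of "\<lambda>h. lookup h (\<tau>, w)"] by (simp add: lookup_add lookup_minus)
  from this[of "v - scale (int N) s"] show ?case using Suc
    by (simp add: scale_add algebra_simps)
qed simp

lemma line_eventually_zero:
  fixes h :: vec
  assumes "s \<noteq> 0" "e \<noteq> 0"
  shows "\<exists>N::nat. lookup h (\<tau>, v - scale (e * int N) s) = 0"
proof (rule ccontr)
  assume "\<nexists>N::nat. lookup h (\<tau>, v - scale (e * int N) s) = 0"
  then have "range (\<lambda>N::nat. (\<tau>, v - scale (e * int N) s)) \<subseteq> keys h" by (auto simp: in_keys_iff)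
  then have "finite (range (\<lambda>N::nat. (\<tau>, v - scale (e * int N) s)))" by (rule finite_subset) simp
  moreover have "inj (\<lambda>N::nat. (\<tau>, v - scale (e * int N) s))"
    using assms(2) by (simp add: inj_def scale_eq_iff[OF assms(1)])
  ultimately have "finite (UNIV :: nat set)" by (rule finite_imageD)
  then show False by simp
qed

lemma sum_lookup_le_l1:
  assumes "finite B"
  shows "(\<Sum>p\<in>B. \<bar>lookup f p\<bar>) \<le> l1 f"
proof -
  have "l1 f = (\<Sum>p\<in>B \<union> keys f. \<bar>lookup f p\<bar>)" using assms by (intro l1_superset) auto
  then show ?thesis using assms by (auto intro: sum_mono2)
qed

lemma line_bound:
  assumes "h + shift u f = g + shift s h" "s \<noteq> 0"
  shows "\<bar>lookup h (\<tau>, v)\<bar> \<le> l1 (g - shift u f)"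
proof -
  define r where "r = g - shift u f"
  obtain N :: nat where N: "lookup h (\<tau>, v - scale (int N) s) = 0"
    using line_eventually_zero[OF assms(2), of 1 h \<tau> v] by auto
  have "\<bar>lookup h (\<tau>, v)\<bar> \<le> (\<Sum>k<N. \<bar>lookup r (\<tau>, v - scale (int k) s)\<bar>)"
    using line_sum[OF assms(1), of \<tau> v N] N by (simp add: r_def sum_abs)
  also have "\<dots> = (\<Sum>p\<in>(\<lambda>k. (\<tau>, v - scale (int k) s)) ` {..<N}. \<bar>lookup r p\<bar>)"
    by (subst sum.reindex) (auto simp: inj_on_def scale_eq_iff[OF assms(2)])
  also have "\<dots> \<le> l1 r" by (rule sum_lookup_le_l1) simp
  finally show ?thesis by (simp add: r_def)
qed

text \<open>Follow the line in the direction in which the linear form \<open>l\<close> does not decrease: the right-hand side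
vanishes there, and \<open>h\<close> is eventually zero.\<close>

lemma line_support:
  assumes eq: "h + shift u f = g + shift s h" and s: "s \<noteq> 0"
    and l: "\<And>m v. l (v + scale m s) = l v + m * l s"
    and r: "\<And>p. p \<in> keys (g - shift u f) \<Longrightarrow> l (snd p) \<le> R" and v: "R < (l v :: int)"
  shows "lookup h (\<tau>, v) = 0"
proof (cases "l s \<le> 0")
  case True
  obtain N :: nat where N: "lookup h (\<tau>, v - scale (int N) s) = 0"
    using line_eventually_zero[OF s, of 1 h \<tau> v] by auto
  have "lookup (g - shift u f) (\<tau>, v - scale (int k) s) = 0" for k
  proof (rule ccontr)
    assume "lookup (g - shift u f) (\<tau>, v - scale (int k) s) \<noteq> 0"
    then have "l (v - scale (int k) s) \<le> R" using r[of "(\<tau>, v - scale (int k) s)"] by (simp add: in_keys_iff)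
    moreover have "l (v - scale (int k) s) = l v - int k * l s"
      using l[of v "- int k"] by (simp add: scale_uminus)
    moreover have "int k * l s \<le> 0" using True by (simp add: mult_nonneg_nonpos)
    ultimately show False using v by linarith
  qed
  then show ?thesis using line_sum[OF eq, of \<tau> v N] N by simp
next
  case False
  obtain N :: nat where N: "lookup h (\<tau>, v + scale (int N) s) = 0"
    using line_eventually_zero[OF s, of "- 1" h \<tau> v] by (auto simp: scale_uminus)
  have "lookup (g - shift u f) (\<tau>, v + scale (int N) s - scale (int k) s) = 0" if "k < N" for k
  proof (rule ccontr)
    assume "lookup (g - shift u f) (\<tau>, v + scale (int N) s - scale (int k) s) \<noteq> 0"
    then have "l (v + scale (int N) s - scale (int k) s) \<le> R"
      using r[of "(\<tau>, v + scale (int N) s - scale (int k) s)"] by (simp add: in_keys_iff)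
    moreover have "l (v + scale (int N) s - scale (int k) s) = l v + (int N - int k) * l s"
      using l[of v "int N - int k"] scale_add[of "int N - int k" "int k" s] by (simp add: algebra_simps)
    moreover have "0 \<le> (int N - int k) * l s" using False that by simp
    ultimately show False using v by linarith
  qed
  then show ?thesis using line_sum[OF eq, of \<tau> "v + scale (int N) s" N] N by simp
qed

text \<open>The vector of the conjugator lives in a box of side \<open>6 * n + 1\<close>, and its coefficients are at most
\<open>2 * n\<close>. There are \<open>O(n\<^sup>2)\<close> points in the box, each at distance \<open>O(n)\<close>.\<close>

lemma near_conjugator:
  assumes "conjugates (ext c) (u, h, w) (s, f\<^sub>1, z\<^sub>1) (s, f\<^sub>2, z\<^sub>2)" "s \<noteq> 0" "1 \<le> n"
    and g1: "near (s, f\<^sub>1, z\<^sub>1) n" and g2: "near (s, f\<^sub>2, z\<^sub>2) n" and u: "pnorm u \<le> 2 * n"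
  shows "\<exists>x. conjugates (ext c) x (s, f\<^sub>1, z\<^sub>1) (s, f\<^sub>2, z\<^sub>2) \<and> near x (1400 * n ^ 3)"
proof -
  have eq: "h + shift u f\<^sub>1 = f\<^sub>2 + shift s h"
    and z: "z\<^sub>1 + pairing c h (shift u f\<^sub>1) = z\<^sub>2 + pairing c f\<^sub>2 (shift s h)"
    using assms(1) by (auto simp: conjugates_ext)
  define r where "r = f\<^sub>2 - shift u f\<^sub>1"
  have l1r: "l1 r \<le> 2 * n"
    using l1_add[of f\<^sub>2 "- shift u f\<^sub>1"] near_bounds(3)[OF g1] near_bounds(3)[OF g2] by (simp add: r_def)
  have r: "pnorm (snd p) \<le> 3 * n" if "p \<in> keys r" for p
  proof -
    have "p \<in> keys f\<^sub>2 \<or> p \<in> keys (shift u f\<^sub>1)"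
      using that by (auto simp: r_def in_keys_iff lookup_minus)
    then show ?thesis
    proof
      assume "p \<in> keys f\<^sub>2"
      then show ?thesis using near_bounds(2)[OF g2, of p] assms(3) by simp
    next
      assume "p \<in> keys (shift u f\<^sub>1)"
      then obtain q where "q \<in> keys f\<^sub>1" "snd p = snd q + u" by (auto simp: keys_shift)
      then show ?thesis using near_bounds(2)[OF g1, of q] u pnorm_triangle[of "snd q" u] by simp
    qed
  qed
  then have r': "\<bar>fst (snd p)\<bar> \<le> 3 * n" "\<bar>snd (snd p)\<bar> \<le> 3 * n" if "p \<in> keys (f\<^sub>2 - shift u f\<^sub>1)" for p
    using that unfolding r_def pnorm_def by fastforce+
  define B :: "(bool \<times> pt) set" where "B = UNIV \<times> {- (3 * n)..3 * n} \<times> {- (3 * n)..3 * n}"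
  have support: "keys h \<subseteq> B"
  proof
    fix p assume p: "p \<in> keys h"
    obtain \<tau> v where v: "p = (\<tau>, v)" by (cases p)
    have nz: "lookup h (\<tau>, v) \<noteq> 0" using p by (simp add: v in_keys_iff)
    have "fst v \<le> 3 * n" using line_support[OF eq assms(2), of fst "3 * n" v \<tau>] r' nz
      by (force simp: scale_def)
    moreover have "- fst v \<le> 3 * n" using line_support[OF eq assms(2), of "\<lambda>v. - fst v" "3 * n" v \<tau>] r' nz
      by (force simp: scale_def)
    moreover have "snd v \<le> 3 * n" using line_support[OF eq assms(2), of snd "3 * n" v \<tau>] r' nz
      by (force simp: scale_def)
    moreover have "- snd v \<le> 3 * n" using line_support[OF eq assms(2), of "\<lambda>v. - snd v" "3 * n" v \<tau>] r' nz
      by (force simp: scale_def)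
    ultimately show "p \<in> B" by (cases v) (simp add: v B_def)
  qed
  have fin: "finite B" by (simp add: B_def)
  have "(\<Sum>p\<in>B. \<bar>lookup h p\<bar> + 2 * pnorm (snd p)) \<le> (\<Sum>p\<in>B. 14 * n)"
  proof (rule sum_mono)
    fix p assume p: "p \<in> B"
    have "\<bar>lookup h p\<bar> \<le> 2 * n" using line_bound[OF eq assms(2), of "fst p" "snd p"] l1r by (simp add: r_def)
    moreover have "pnorm (snd p) \<le> 6 * n" using p by (auto simp: B_def pnorm_def)
    ultimately show "\<bar>lookup h p\<bar> + 2 * pnorm (snd p) \<le> 14 * n" by linarith
  qed
  also have "\<dots> = 2 * ((6 * n + 1) * (6 * n + 1)) * (14 * n)"
    using assms(3) by (simp add: B_def card_cartesian_product algebra_simps)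
  also have "\<dots> \<le> 2 * ((7 * n) * (7 * n)) * (14 * n)"
    using assms(3) by (intro mult_mono) auto
  finally have "reach h (1372 * n ^ 3)"
    using reach_bound[OF fin support] reach_mono by (fastforce simp: power3_eq_cube)
  then obtain w' where w': "near (0, h, w') (1372 * n ^ 3)" by (auto simp: reach_def)
  have "near (u, h, w') (1372 * n ^ 3 + pnorm u)"
    using near_mult[OF w' near_translation[of u]] by simp
  moreover have "n \<le> n ^ 3" using assms(3) power_increasing[of 1 3 n] by simp
  ultimately have "near (u, h, w') (1400 * n ^ 3)" using u assms(3) by (elim ext.in_ball_mono) linarith
  moreover have "conjugates (ext c) (u, h, w') (s, f\<^sub>1, z\<^sub>1) (s, f\<^sub>2, z\<^sub>2)"
    using eq z by (simp add: conjugates_ext)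
  ultimately show ?thesis by blast
qed

text \<open>Multiply the conjugator by powers of the conjugated element, which commute with it.\<close>

lemma conjugator_translate:
  assumes "conjugates (ext c) (u, h, w) (s, f\<^sub>1, z\<^sub>1) g\<^sub>2"
  shows "\<exists>h w. conjugates (ext c) (u + scale m s, h, w) (s, f\<^sub>1, z\<^sub>1) g\<^sub>2"
proof (induction m rule: int_induct[of _ 0])
  case base
  then show ?case using assms by auto
next
  case (step1 m)
  then obtain h w where "conjugates (ext c) (u + scale m s, h, w) (s, f\<^sub>1, z\<^sub>1) g\<^sub>2" by blast
  moreover have "conjugates (ext c) (s, f\<^sub>1, z\<^sub>1) (s, f\<^sub>1, z\<^sub>1) (s, f\<^sub>1, z\<^sub>1)" by (simp add: conjugates_ext)
  ultimately have "conjugates (ext c) ((u + scale m s, h, w) \<otimes>\<^bsub>ext c\<^esub> (s, f\<^sub>1, z\<^sub>1)) (s, f\<^sub>1, z\<^sub>1) g\<^sub>2"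
    by (intro ext.conjugates_trans) auto
  then show ?case by (auto simp: scale_add add.assoc)
next
  case (step2 m)
  then obtain h w where "conjugates (ext c) (u + scale m s, h, w) (s, f\<^sub>1, z\<^sub>1) g\<^sub>2" by blast
  moreover have "conjugates (ext c) (inv\<^bsub>ext c\<^esub> (s, f\<^sub>1, z\<^sub>1)) (s, f\<^sub>1, z\<^sub>1) (s, f\<^sub>1, z\<^sub>1)"
    by (rule ext.conjugates_inv) (simp_all add: conjugates_ext)
  ultimately have "conjugates (ext c) ((u + scale m s, h, w) \<otimes>\<^bsub>ext c\<^esub> inv\<^bsub>ext c\<^esub> (s, f\<^sub>1, z\<^sub>1)) (s, f\<^sub>1, z\<^sub>1) g\<^sub>2"
    by (intro ext.conjugates_trans) auto
  moreover have sc: "u + scale (m - 1) s = u + scale m s + - s"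
    using scale_add[of m "- 1" s] by (simp add: scale_uminus)
  ultimately show ?case unfolding sc by auto
qed

text \<open>If the translate of the support of \<open>f\<^sub>1\<close> meets the support of \<open>f\<^sub>2\<close> modulo multiples of \<open>s\<close>, a power of
the first element moves the conjugator to the difference of two points of the supports. Otherwise
the restriction \<open>k\<close> of \<open>h\<close> to the lines through the translated support shows that \<open>f\<^sub>1\<close> has the form
\<open>y - shift s y\<close>. Then the first element is conjugate to one with zero vector, which commutes with all
translations, so the translation part of the conjugator can be removed altogether.\<close>

lemma conjugator_reduce:
  assumes "conjugates (ext c) (u, h, w) (s, f\<^sub>1, z\<^sub>1) (s, f\<^sub>2, z\<^sub>2)"
    and "near (s, f\<^sub>1, z\<^sub>1) n" "near (s, f\<^sub>2, z\<^sub>2) n" "0 \<le> n"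
  shows "\<exists>u h w. conjugates (ext c) (u, h, w) (s, f\<^sub>1, z\<^sub>1) (s, f\<^sub>2, z\<^sub>2) \<and> pnorm u \<le> 2 * n"
proof (cases "\<exists>p\<in>keys f\<^sub>1. \<exists>q\<in>keys f\<^sub>2. \<exists>m. snd q = snd p + u + scale m s")
  case True
  then obtain p q m where pq: "p \<in> keys f\<^sub>1" "q \<in> keys f\<^sub>2" "snd q = snd p + u + scale m s" by blast
  obtain h w where "conjugates (ext c) (u + scale m s, h, w) (s, f\<^sub>1, z\<^sub>1) (s, f\<^sub>2, z\<^sub>2)"
    using conjugator_translate[OF assms(1)] by blast
  moreover have "u + scale m s = snd q - snd p" using pq(3) by simp
  moreover have "pnorm (snd q - snd p) \<le> 2 * n"
    using pnorm_triangle_diff[of "snd q" "snd p"] near_bounds(2)[OF assms(2) pq(1)] near_bounds(2)[OF assms(3) pq(2)]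
    by linarith
  ultimately show ?thesis by metis
next
  case False
  define E where "E = {v. \<exists>p\<in>keys f\<^sub>1. \<exists>m. v = snd p + u + scale m s}"
  define k where "k = Abs_poly_mapping (\<lambda>p. if snd p \<in> E then lookup h p else 0)"
  have "finite {p. (if snd p \<in> E then lookup h p else 0) \<noteq> 0}"
    by (rule finite_subset[OF _ finite_keys[of h]]) (auto simp: in_keys_iff split: if_splits)
  then have k: "lookup k p = (if snd p \<in> E then lookup h p else 0)" for p
    by (simp add: k_def)
  have Es: "v - s \<in> E \<longleftrightarrow> v \<in> E" for v
  proof
    assume "v - s \<in> E"
    then obtain p m where p: "p \<in> keys f\<^sub>1" "v - s = snd p + u + scale m s" by (auto simp: E_def)
    then have "v = snd p + u + scale (m + 1) s" by (simp add: scale_add algebra_simps)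
    then show "v \<in> E" using p(1) unfolding E_def by blast
  next
    assume "v \<in> E"
    then obtain p m where p: "p \<in> keys f\<^sub>1" "v = snd p + u + scale m s" by (auto simp: E_def)
    then have "v - s = snd p + u + scale (m - 1) s"
      using scale_add[of m "- 1" s] by (simp add: scale_uminus)
    then show "v - s \<in> E" using p(1) unfolding E_def by blast
  qed
  have eq: "h + shift u f\<^sub>1 = f\<^sub>2 + shift s h" using assms(1) by (simp add: conjugates_ext)
  have keq: "k + shift u f\<^sub>1 = shift s k"
  proof (rule vec_eqI)
    fix \<tau> v
    have e: "lookup h (\<tau>, v) + lookup f\<^sub>1 (\<tau>, v - u) = lookup f\<^sub>2 (\<tau>, v) + lookup h (\<tau>, v - s)"
      using arg_cong[OF eq, of "\<lambda>h. lookup h (\<tau>, v)"] by (simp add: lookup_add)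
    show "lookup (k + shift u f\<^sub>1) (\<tau>, v) = lookup (shift s k) (\<tau>, v)"
    proof (cases "v \<in> E")
      case True
      then have "lookup f\<^sub>2 (\<tau>, v) = 0" using False unfolding E_def by (force simp: in_keys_iff)
      then show ?thesis using e True by (simp add: lookup_add k Es)
    next
      case out: False
      have "lookup f\<^sub>1 (\<tau>, v - u) = 0"
      proof (rule ccontr)
        assume "lookup f\<^sub>1 (\<tau>, v - u) \<noteq> 0"
        then have "(\<tau>, v - u) \<in> keys f\<^sub>1" by (simp add: in_keys_iff)
        then have "v \<in> E" unfolding E_def by (auto intro!: bexI[of _ "(\<tau>, v - u)"] exI[of _ 0])
        then show False using out by simp
      qed
      then show ?thesis using out by (simp add: lookup_add k Es)
    qed
  qed
  define y where "y = - shift (- u) k"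
  have fy: "f\<^sub>1 = y - shift s y"
  proof -
    have "shift u f\<^sub>1 = shift s k - k" using keq by (simp add: algebra_simps)
    then have "shift (- u) (shift u f\<^sub>1) = shift (- u) (shift s k - k)" by simp
    then show ?thesis by (simp add: y_def shift_diff shift_uminus add.commute)
  qed
  define z0 where "z0 = z\<^sub>1 + pairing c f\<^sub>1 (shift s y)"
  have cy: "conjugates (ext c) (0, y, 0) (s, 0, z0) (s, f\<^sub>1, z\<^sub>1)"
    by (simp add: conjugates_ext z0_def fy)
  have cu: "conjugates (ext c) (u, 0, 0) (s, 0, z0) (s, 0, z0)" by (simp add: conjugates_ext)
  define x where "x = (u, h, w) \<otimes>\<^bsub>ext c\<^esub> ((0, y, 0) \<otimes>\<^bsub>ext c\<^esub> (inv\<^bsub>ext c\<^esub> (u, 0, 0) \<otimes>\<^bsub>ext c\<^esub> inv\<^bsub>ext c\<^esub> (0, y, 0)))"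
  have "conjugates (ext c) x (s, f\<^sub>1, z\<^sub>1) (s, f\<^sub>2, z\<^sub>2)"
    unfolding x_def
    by (rule ext.conjugates_trans[OF ext.conjugates_trans[OF ext.conjugates_trans[OF ext.conjugates_inv[OF cy] ext.conjugates_inv[OF cu]] cy] assms(1)])
      simp_all
  moreover have "fst x = 0" by (simp add: x_def)
  then obtain h' w' where "x = (0, h', w')" by (metis prod.collapse)
  ultimately have "conjugates (ext c) (0, h', w') (s, f\<^sub>1, z\<^sub>1) (s, f\<^sub>2, z\<^sub>2) \<and> pnorm 0 \<le> 2 * n"
    using assms(4) by simp
  then show ?thesis by blast
qed

end

section \<open>Conjugacy of elements that do not translate\<close>

context digits
begin

definition c :: "bool \<Rightarrow> bool \<Rightarrow> pt \<Rightarrow> int" where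
  "c \<tau> \<sigma> v = (if \<sigma> then if \<tau> then \<xi> v else \<kappa> v else 0)"

lemma c_simps [simp]: "c \<tau> False v = 0" "c True True v = \<xi> v" "c False True v = \<kappa> v"
  by (simp_all add: c_def)

sublocale kernel c
proof
  show "c \<tau> \<tau> 0 = 0" for \<tau> using nu_gt[of 0] by (simp add: c_def \<xi>_def)
  show "c True False v = 0" for v by simp
  show "c False True (0, 1) = 1" by (simp add: \<kappa>_def rho_0)
qed

text \<open>A value \<open>\<rho> (k + 1) * V k\<close> of \<open>\<xi>\<close> is below the digit \<open>V (k + 1)\<close>, which explains the index \<open>Suc k\<close>.\<close>

lemma kernel_bound:
  assumes "\<And>k. int (\<rho> k) \<le> N \<Longrightarrow> k \<le> K" "\<And>k. int (\<nu> k) \<le> N \<Longrightarrow> Suc k \<le> K" "pnorm v \<le> N"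
  shows "\<bar>c \<tau> \<sigma> v\<bar> \<le> V K"
proof -
  have "\<bar>\<kappa> v\<bar> \<le> V K"
  proof (cases "\<kappa> v = 0")
    case False
    then obtain k where v: "v = pos k" using kappa_nonzero by blast
    then have "k \<le> K" using assms(1,3) by (simp add: pnorm_def pos_def)
    then show ?thesis using V_mono by (simp add: v)
  qed simp
  moreover have "\<bar>\<xi> v\<bar> \<le> V K"
  proof (cases "\<xi> v = 0")
    case False
    then obtain k where k: "fst v = int (\<nu> k)" "\<xi> v = int (\<rho> (Suc k)) * V k"
      by (auto simp: \<xi>_def split: if_splits)
    then have "Suc k \<le> K" using assms(2,3) by (simp add: pnorm_def)
    then have "V (Suc k) \<le> V K" by (rule V_mono)
    moreover have "V (Suc k) = 2 * (int (\<rho> (Suc k)) * V k)" by simp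
    moreover have "0 \<le> int (\<rho> (Suc k)) * V k" by simp
    ultimately show ?thesis unfolding k(2) by linarith
  qed simp
  ultimately show ?thesis by (auto simp: c_def)
qed

lemma commutator_form_single_False:
  "commutator_form c (single (False, j) m) f = m * lin (\<lambda>(\<sigma>, i). if \<sigma> then \<kappa> (i - j) else 0) f"
proof -
  have "lin (\<lambda>(\<sigma>, i). c False \<sigma> (i - j)) f = lin (\<lambda>(\<sigma>, i). if \<sigma> then \<kappa> (i - j) else 0) f"
    by (rule lin_cong) (auto simp: c_def)
  then show ?thesis by (simp add: commutator_form_def pairing_single_left pairing_single_right case_prod_unfold)
qed

lemma commutator_form_single_True:
  "commutator_form c (single (True, j) m) f =
     m * (lin (\<lambda>(\<sigma>, i). if \<sigma> then \<xi> (i - j) - \<xi> (j - i) else 0) f - lin (\<lambda>(\<sigma>, i). if \<sigma> then 0 else \<kappa> (j - i)) f)"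
proof -
  have "lin (\<lambda>(\<sigma>, i). c True \<sigma> (i - j)) f + lin (\<lambda>p. - (case p of (\<sigma>, i) \<Rightarrow> c \<sigma> True (j - i))) f =
    lin (\<lambda>(\<sigma>, i). if \<sigma> then \<xi> (i - j) - \<xi> (j - i) else 0) f + lin (\<lambda>p. - (case p of (\<sigma>, i) \<Rightarrow> if \<sigma> then 0 else \<kappa> (j - i))) f"
    unfolding lin_add_fun[symmetric] by (rule lin_cong) (auto simp: c_def)
  then show ?thesis
    by (simp add: commutator_form_def pairing_single_left pairing_single_right lin_uminus_fun right_diff_distrib[symmetric])
qed

lemma lin_part: "lin (\<lambda>(\<sigma>, i). if \<sigma> = \<tau> then \<psi> i else 0) f = (\<Sum>i\<in>{i. (\<tau>, i) \<in> keys f}. lookup f (\<tau>, i) * \<psi> i)"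
proof -
  have "lin (\<lambda>(\<sigma>, i). if \<sigma> = \<tau> then \<psi> i else 0) f = (\<Sum>p\<in>(\<lambda>i. (\<tau>, i)) ` {i. (\<tau>, i) \<in> keys f}. lookup f p * (case p of (\<sigma>, i) \<Rightarrow> if \<sigma> = \<tau> then \<psi> i else 0))"
    unfolding lin_def by (rule sum.mono_neutral_right) (auto simp: image_iff split: if_splits)
  also have "\<dots> = (\<Sum>i\<in>{i. (\<tau>, i) \<in> keys f}. lookup f (\<tau>, i) * \<psi> i)"
    by (subst sum.reindex) (auto simp: inj_on_def)
  finally show ?thesis .
qed

lemma lin_dvd: "(\<And>p. p \<in> keys f \<Longrightarrow> e dvd lookup f p * \<phi> p) \<Longrightarrow> e dvd lin \<phi> f"
  unfolding lin_def by (rule dvd_sum)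

lemma pairing_dvd: 
  assumes "\<And>p. p \<in> keys f \<Longrightarrow> e dvd lookup f p"
  shows "e dvd pairing c' f g" "e dvd pairing c' g f"
proof -
  show "e dvd pairing c' f g"
    unfolding pairing_def by (rule lin_dvd, rule dvd_mult2, rule assms)
  show "e dvd pairing c' g f"
    unfolding pairing_def case_prod_unfold
    by (rule lin_dvd, rule dvd_mult, rule lin_dvd, rule dvd_mult2, rule assms)
qed

lemma commutator_form_le:
  assumes "\<And>\<tau> \<sigma> v. pnorm v \<le> N \<Longrightarrow> \<bar>c \<tau> \<sigma> v\<bar> \<le> W" "\<And>p. p \<in> keys f \<Longrightarrow> pnorm (snd p) + pnorm j \<le> N"
  shows "\<bar>commutator_form c (single (\<tau>, j) 1) f\<bar> \<le> 2 * (l1 f * W)"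
proof -
  have "pnorm (snd p - j) \<le> N" "pnorm (j - snd p) \<le> N" if "p \<in> keys f" for p
    using assms(2)[OF that] pnorm_triangle_diff[of "snd p" j] pnorm_triangle_diff[of j "snd p"] by linarith+
  then have "\<bar>lin (\<lambda>(\<sigma>, i). c \<tau> \<sigma> (i - j)) f\<bar> \<le> l1 f * W" "\<bar>lin (\<lambda>(\<sigma>, i). c \<sigma> \<tau> (j - i)) f\<bar> \<le> l1 f * W"
    by (auto intro!: abs_lin_le assms(1))
  then show ?thesis by (simp add: commutator_form_def pairing_single_left pairing_single_right)
qed

text \<open>If \<open>f\<close> has a part in the \<open>b\<close>-direction, the translates of \<open>a\<close> test it by \<open>\<kappa>\<close> alone, up to a reflection
of the plane. This provides all multiples of the greatest common divisor \<open>d\<close> of that part, and the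
\<open>a\<close>-part only has to correct \<open>z\<close> modulo \<open>d\<close>, by tests near its support. If there is no \<open>b\<close>-part, then
\<open>\<xi>\<close> does not interfere, and the translates of \<open>b\<close> test the \<open>a\<close>-part by \<open>\<kappa>\<close>.\<close>

lemma cheap_commutator:
  assumes f: "f \<noteq> 0" "\<And>p. p \<in> keys f \<Longrightarrow> pnorm (snd p) \<le> n" "l1 f \<le> n"
    and K: "\<And>k. int (\<rho> k) \<le> 3 * n \<Longrightarrow> k \<le> K" "\<And>k. int (\<nu> k) \<le> 3 * n \<Longrightarrow> Suc k \<le> K"
    and z: "z = commutator_form c h0 f" "\<bar>z\<bar> \<le> 2 * n ^ 2 * V K"
  shows "\<exists>h. commutator_form c h f = z \<and> reach h (105 * (n ^ 3 + int (\<rho> K)))"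
proof -
  define P where "P z d \<longleftrightarrow> (\<exists>h. commutator_form c h f = z \<and> reach h d)" for z d
  have P0: "P 0 0" unfolding P_def
    by (rule exI[of _ 0]) (simp add: commutator_form_def reach_zero)
  have Padd: "P (x + y) (d + d')" if "P x d" "P y d'" for x y d d'
    using that unfolding P_def by (metis commutator_form_add_left reach_add)
  have Pmono: "P x d'" if "P x d" "d \<le> d'" for x d d'
    using that unfolding P_def by (metis reach_mono)
  have Psingle: "P (m * commutator_form c (single (\<tau>, j) 1) f) (\<bar>m\<bar> + 2 * pnorm j)" for m \<tau> j
    unfolding P_def using reach_single[of \<tau> j m]
    by (intro exI[of _ "single (\<tau>, j) m"])
      (simp add: commutator_form_def pairing_single_left pairing_single_right right_diff_distrib)
  define A where "A \<tau> = {i. (\<tau>, i) \<in> keys f}" for \<tau>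
  define \<phi> where "\<phi> \<tau> i = lookup f (\<tau>, i)" for \<tau> i
  have finA: "finite (A \<tau>)" for \<tau>
  proof -
    have "finite (Pair \<tau> ` A \<tau>)" by (rule finite_subset[OF _ finite_keys[of f]]) (auto simp: A_def)
    then show ?thesis by (rule finite_imageD) (simp add: inj_on_def)
  qed
  have phiA: "\<phi> \<tau> i \<noteq> 0" "pnorm i \<le> n" if "i \<in> A \<tau>" for \<tau> i
    using that f(2)[of "(\<tau>, i)"] by (auto simp: A_def \<phi>_def in_keys_iff)
  have l1A: "(\<Sum>i\<in>A \<tau>. \<bar>\<phi> \<tau> i\<bar>) \<le> n" for \<tau>
  proof -
    have "(\<Sum>i\<in>A \<tau>. \<bar>\<phi> \<tau> i\<bar>) = (\<Sum>p\<in>Pair \<tau> ` A \<tau>. \<bar>lookup f p\<bar>)"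
      by (subst sum.reindex) (auto simp: inj_on_def \<phi>_def)
    then show ?thesis using sum_lookup_le_l1[of "Pair \<tau> ` A \<tau>" f] finA f(3) by simp
  qed
  have keysA: "p \<in> keys f \<Longrightarrow> snd p \<in> A (fst p)" for p by (simp add: A_def)
  have n1: "1 \<le> n"
  proof -
    have "keys f \<noteq> {}" using f(1) by simp
    then obtain p where "p \<in> keys f" by blast
    then have "lookup f p \<noteq> 0" by (simp add: in_keys_iff)
    then show ?thesis using abs_lookup_le_l1[of f p] f(3) by linarith
  qed
  have nn: "n ^ 2 \<le> n ^ 3" "n \<le> n ^ 2" "1 \<le> n ^ 3"
    using n1 power_increasing[of 2 3 n] power_increasing[of 1 2 n] by auto
  have z_dvd: "e dvd z" if "\<And>p. p \<in> keys f \<Longrightarrow> e dvd lookup f p" for e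
    unfolding z(1) commutator_form_def using pairing_dvd[OF that] by (metis dvd_diff)
  define T where "T j = (\<Sum>i\<in>A False. \<phi> False i * \<kappa> (j - i))" for j
  have T: "lin (\<lambda>(\<sigma>, i). if \<sigma> then 0 else \<kappa> (j - i)) f = T j" for j

  proof -
    have "lin (\<lambda>(\<sigma>, i). if \<sigma> then 0 else \<kappa> (j - i)) f = lin (\<lambda>(\<sigma>, i). if \<sigma> = False then \<kappa> (j - i) else 0) f"
      by (rule lin_cong) auto
    then show ?thesis using lin_part[of False "\<lambda>i. \<kappa> (j - i)" f] unfolding T_def A_def \<phi>_def by (simp only:)
  qed
  show ?thesis
  proof (cases "A True = {}")
    case True
    have "keys f \<noteq> {}" using f(1) by simp
    then obtain p where p: "p \<in> keys f" by blast
    then have "\<not> fst p" using keysA[OF p] True by (cases "fst p") auto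
    then have ne: "A False \<noteq> {}" using keysA[OF p] by auto
    have test: "commutator_form c (single (True, j) 1) f = - T j" for j
    proof -
      have "lin (\<lambda>(\<sigma>, i). if \<sigma> then \<xi> (i - j) - \<xi> (j - i) else 0) f = lin (\<lambda>_. 0) f"
        using True by (intro lin_cong) (auto simp: A_def)
      then show ?thesis by (simp add: commutator_form_single_True T)
    qed
    interpret test_system \<rho> \<nu> "\<phi> False" "A False" n P T
    proof unfold_locales
      show "P (m * T j) (\<bar>m\<bar> + 2 * pnorm j)" for m j
        using Psingle[of "- m" True j] by (simp add: test)
    qed (use finA ne phiA l1A P0 Padd Pmono T_def in auto)
    have "e dvd z" if "\<And>i. i \<in> A False \<Longrightarrow> e dvd \<phi> False i" for e
    proof (rule z_dvd)
      fix p assume p: "p \<in> keys f"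
      then have "\<not> fst p" using keysA[OF p] True by (cases "fst p") auto
      then show "e dvd lookup f p" using that[of "snd p"] keysA[OF p] by (cases p) (simp add: \<phi>_def)
    qed
    moreover have "2 * n ^ 2 * V K \<le> 8 * n ^ 3 * V K" using nn by (intro mult_right_mono) auto
    then have "\<bar>z\<bar> \<le> 8 * n ^ 3 * V K" using z(2) by linarith
    ultimately have "P z (100 * (n ^ 3 + int (\<rho> K)))" using K(1) by (intro cheap_multiples) blast+
    then have "P z (105 * (n ^ 3 + int (\<rho> K)))" by (rule Pmono) (use nn in simp)
    then show ?thesis by (simp add: P_def)
  next
    case ne: False
    define d where "d = Gcd (\<phi> True ` A True)"
    have d_dvd: "d dvd \<phi> True i" if "i \<in> A True" for i unfolding d_def using that by (intro Gcd_dvd) auto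
    obtain i0 where i0: "i0 \<in> A True" using ne by blast
    have di0: "d dvd \<phi> True i0" "\<phi> True i0 \<noteq> 0" using d_dvd phiA i0 by auto
    have d: "d \<noteq> 0" "\<bar>d\<bar> \<le> n"
    proof -
      show "d \<noteq> 0" using di0 by auto
      have "\<bar>d\<bar> \<le> \<bar>\<phi> True i0\<bar>" using di0 by (intro dvd_imp_le_int) auto
      also have "\<dots> \<le> n" using abs_lookup_le_l1[of f "(True, i0)"] f(3) by (simp add: \<phi>_def)
      finally show "\<bar>d\<bar> \<le> n" .
    qed
    define t where "t j = commutator_form c (single (True, j + pos 0) 1) f" for j
    have "\<exists>a. (\<forall>j\<in>A False. 0 \<le> a j \<and> a j < \<bar>d\<bar>) \<and> d dvd z - (\<Sum>j\<in>A False. a j * t j)"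
    proof (rule residue_combination[OF finA d(1)])
      fix e assume e: "e dvd d" "\<And>j. j \<in> A False \<Longrightarrow> e dvd t j"
      have eT: "e dvd \<phi> True i" if "i \<in> A True" for i using e(1) d_dvd[OF that] by (rule dvd_trans)
      have eF: "e dvd \<phi> False i" if i: "i \<in> A False" for i
      proof -
        interpret test_system \<rho> \<nu> "\<phi> False" "A False" n "\<lambda>_ _. True" T
          by unfold_locales (use finA i phiA l1A T_def in auto)
        have "e dvd T (j + pos 0)" if "j \<in> A False" for j
        proof -
          let ?x = "lin (\<lambda>(\<sigma>, i). if \<sigma> then \<xi> (i - (j + pos 0)) - \<xi> (j + pos 0 - i) else 0) f"
          have "e dvd ?x" using eT by (intro lin_dvd) (auto simp: A_def \<phi>_def)
          moreover have "e dvd ?x - T (j + pos 0)" using e(2)[OF that] by (simp add: t_def commutator_form_single_True T)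
          ultimately have "e dvd ?x - (?x - T (j + pos 0))" by (rule dvd_diff)
          then show ?thesis by simp
        qed
        then show ?thesis using triangular_dvd i by blast
      qed
      show "e dvd z"
      proof (rule z_dvd)
        fix p assume "p \<in> keys f"
        then show "e dvd lookup f p" using eT[of "snd p"] eF[of "snd p"] keysA[of p]
          by (cases p; cases "fst p") (auto simp: \<phi>_def)
      qed
    qed
    then obtain a where a': "(\<forall>j\<in>A False. 0 \<le> a j \<and> a j < \<bar>d\<bar>) \<and> d dvd z - (\<Sum>j\<in>A False. a j * t j)" by (rule exE)
    then have a: "0 \<le> a j" "a j < n" if "j \<in> A False" for j using d(2) that by fastforce+
    define y where "y = (\<Sum>j\<in>A False. a j * t j)"
    have Psum: "finite B \<Longrightarrow> P (\<Sum>j\<in>B. a j * t j) (\<Sum>j\<in>B. \<bar>a j\<bar> + 2 * pnorm (j + pos 0))" for B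
    proof (induction B rule: finite_induct)
      case (insert j B)
      then show ?case using Padd[OF Psingle[of "a j" True "j + pos 0"] insert.IH] by (simp add: t_def)
    qed (simp add: P0)
    have pj: "pnorm (j + pos 0) \<le> n + 1" if "j \<in> A False" for j

    proof -
      have "pnorm (pos 0) = 1" by (simp add: pnorm_def pos_def rho_0)
      then show ?thesis using pnorm_triangle[of j "pos 0"] phiA(2)[OF that] by linarith
    qed
    have cardF: "int (card (A False)) \<le> n"
    proof -
      have "int (card (A False)) = (\<Sum>i\<in>A False. 1)" by simp
      also have "\<dots> \<le> (\<Sum>i\<in>A False. \<bar>\<phi> False i\<bar>)"
      proof (rule sum_mono)
        fix i assume "i \<in> A False"
        then have "\<phi> False i \<noteq> 0" by (rule phiA)
        then show "1 \<le> \<bar>\<phi> False i\<bar>" by linarith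
      qed
      finally show ?thesis using l1A[of False] by linarith
    qed
    have Py: "P y (5 * n ^ 3)"
    proof -
      have "(\<Sum>j\<in>A False. \<bar>a j\<bar> + 2 * pnorm (j + pos 0)) \<le> (\<Sum>j\<in>A False. 5 * n)"
      proof (rule sum_mono)
        fix j assume "j \<in> A False"
        then show "\<bar>a j\<bar> + 2 * pnorm (j + pos 0) \<le> 5 * n" using a[of j] pj[of j] n1 by linarith
      qed
      also have "\<dots> = int (card (A False)) * (5 * n)" by simp
      also have "\<dots> \<le> n * (5 * n)" using cardF n1 by (intro mult_right_mono) auto
      also have "\<dots> \<le> 5 * n ^ 3" using nn by (simp add: power2_eq_square)
      finally show ?thesis using Psum[OF finA[of False]] unfolding y_def by (blast intro: Pmono)
    qed
    have tj: "\<bar>t j\<bar> \<le> 2 * (n * V K)" if "j \<in> A False" for j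
    proof -
      have "\<bar>t j\<bar> \<le> 2 * (l1 f * V K)" unfolding t_def
      proof (rule commutator_form_le[of "3 * n"])
        show "\<bar>c \<tau> \<sigma> v\<bar> \<le> V K" if "pnorm v \<le> 3 * n" for \<tau> \<sigma> v
          using that K by (intro kernel_bound[of "3 * n"])
        show "pnorm (snd p) + pnorm (j + pos 0) \<le> 3 * n" if "p \<in> keys f" for p
          using f(2)[OF that] pj[OF \<open>j \<in> A False\<close>] n1 by linarith
      qed
      also have "\<dots> \<le> 2 * (n * V K)" using f(3) by (simp add: mult_right_mono)
      finally show ?thesis .
    qed
    have "\<bar>y\<bar> \<le> (\<Sum>j\<in>A False. \<bar>a j * t j\<bar>)" unfolding y_def by (rule sum_abs)
    also have "\<dots> \<le> (\<Sum>j\<in>A False. n * (2 * (n * V K)))"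
    proof (rule sum_mono)
      fix j assume j: "j \<in> A False"
      show "\<bar>a j * t j\<bar> \<le> n * (2 * (n * V K))"
        unfolding abs_mult using tj[OF j] a[OF j] n1 by (intro mult_mono) auto
    qed
    also have "\<dots> = int (card (A False)) * (n * (2 * (n * V K)))" by simp
    also have "\<dots> \<le> n * (n * (2 * (n * V K)))" using cardF n1 by (intro mult_right_mono) auto
    also have "\<dots> = 2 * n ^ 3 * V K" by (simp add: power3_eq_cube)
    finally have y: "\<bar>y\<bar> \<le> 2 * n ^ 3 * V K" .
    have z2: "2 * n ^ 2 * V K \<le> 2 * n ^ 3 * V K" using nn by (intro mult_right_mono) auto
    have "0 \<le> n ^ 3 * V K" using n1 by simp
    then have zy: "\<bar>z - y\<bar> \<le> 8 * n ^ 3 * V K" using z(2) y z2 by linarith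
    define T' where "T' j = commutator_form c (single (False, - j) 1) f" for j
    have T': "T' j = (\<Sum>i\<in>uminus ` A True. \<phi> True (- i) * \<kappa> (j - i))" for j
    proof -
      have "T' j = (\<Sum>i\<in>A True. \<phi> True i * \<kappa> (i - - j))"
        using lin_part[of True "\<lambda>i. \<kappa> (i - - j)" f]
        unfolding T'_def A_def \<phi>_def commutator_form_single_False mult_1 eq_True
        by (simp only: eq_True)
      also have "\<dots> = (\<Sum>i\<in>uminus ` A True. \<phi> True (- i) * \<kappa> (j - i))"
        by (subst sum.reindex) (auto simp: inj_on_def add.commute)
      finally show ?thesis .
    qed
    interpret test_system \<rho> \<nu> "\<lambda>i. \<phi> True (- i)" "uminus ` A True" n P T'
    proof unfold_locales
      show "P (m * T' j) (\<bar>m\<bar> + 2 * pnorm j)" for m j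
        using Psingle[of m False "- j"] by (simp add: T'_def)
      show "(\<Sum>i\<in>uminus ` A True. \<bar>\<phi> True (- i)\<bar>) \<le> n"
        using l1A[of True] by (subst sum.reindex) (auto simp: inj_on_def)
      show "pnorm i \<le> n" if "i \<in> uminus ` A True" for i
        using that phiA(2)[of _ True] by (metis imageE pnorm_uminus)
    qed (use finA ne phiA P0 Padd Pmono T' in auto)
    have "e dvd z - y" if "\<And>i. i \<in> uminus ` A True \<Longrightarrow> e dvd \<phi> True (- i)" for e
    proof -
      have "e dvd \<phi> True i" if "i \<in> A True" for i
        using \<open>\<And>i. i \<in> uminus ` A True \<Longrightarrow> e dvd \<phi> True (- i)\<close>[OF imageI[OF that]] by simp
      then have "e dvd d" unfolding d_def by (auto intro: Gcd_greatest simp del: split_paired_All)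
      then show ?thesis using a' unfolding y_def by (meson dvd_trans)
    qed
    then have "P (z - y) (100 * (n ^ 3 + int (\<rho> K)))" using K(1) zy by (intro cheap_multiples) blast+
    from Padd[OF this Py] have "P z (100 * (n ^ 3 + int (\<rho> K)) + 5 * n ^ 3)" by simp
    then have "P z (105 * (n ^ 3 + int (\<rho> K)))" by (rule Pmono) simp
    then show ?thesis by (simp add: P_def)
  qed
qed

text \<open>If the translation part is zero, the translation part of a conjugator is the difference of two points of
the supports, hence short. What remains of the conjugacy equation is an equation for the commutator
form, and any short solution of it may replace the vector of the given conjugator.\<close>

theorem short_conjugator:
  assumes n: "1 \<le> n" and g: "near g\<^sub>1 n" "near g\<^sub>2 n" "conjugate (ext c) g\<^sub>1 g\<^sub>2"
    and K: "\<And>k. int (\<rho> k) \<le> 3 * n \<Longrightarrow> k \<le> K" "\<And>k. int (\<nu> k) \<le> 3 * n \<Longrightarrow> Suc k \<le> K"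
  shows "\<exists>x. conjugates (ext c) x g\<^sub>1 g\<^sub>2 \<and> near x (1400 * (n ^ 3 + int (\<rho> K)))"
proof -
  obtain s f\<^sub>1 z\<^sub>1 where g1: "g\<^sub>1 = (s, f\<^sub>1, z\<^sub>1)" by (cases g\<^sub>1)
  obtain x where x: "conjugates (ext c) x g\<^sub>1 g\<^sub>2" using g(3) by (auto simp: conjugate_def)
  obtain u h w where xu: "x = (u, h, w)" by (cases x)
  obtain f\<^sub>2 z\<^sub>2 where g2: "g\<^sub>2 = (s, f\<^sub>2, z\<^sub>2)"
    using x by (cases g\<^sub>2) (auto simp: g1 xu conjugates_ext)
  have nn: "n ^ 2 \<le> n ^ 3" "n \<le> n ^ 3" "1 \<le> n ^ 3"
    using n power_increasing[of 2 3 n] power_increasing[of 1 3 n] by auto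
  show ?thesis
  proof (cases "s = 0")
    case False
    obtain u' h' w' where "conjugates (ext c) (u', h', w') g\<^sub>1 g\<^sub>2" "pnorm u' \<le> 2 * n"
      using conjugator_reduce[of u h w s f\<^sub>1 z\<^sub>1 f\<^sub>2 z\<^sub>2 n] x g n by (auto simp: g1 g2 xu)
    then obtain x where "conjugates (ext c) x g\<^sub>1 g\<^sub>2" "near x (1400 * n ^ 3)"
      using near_conjugator[OF _ False n] g by (metis g1 g2)
    moreover have "1400 * n ^ 3 \<le> 1400 * (n ^ 3 + int (\<rho> K))" by simp
    ultimately show ?thesis using ext.in_ball_mono by blast
  next
    case s: True
    have eq: "f\<^sub>2 = shift u f\<^sub>1" "z\<^sub>2 - z\<^sub>1 = commutator_form c h f\<^sub>2"
      using x by (auto simp: g1 g2 xu conjugates_ext s commutator_form_def)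
    show ?thesis
    proof (cases "f\<^sub>1 = 0")
      case True
      then have "g\<^sub>1 = g\<^sub>2" using eq by (simp add: g1 g2 commutator_form_def)
      then have "conjugates (ext c) \<one>\<^bsub>ext c\<^esub> g\<^sub>1 g\<^sub>2" by (simp add: conjugates_def ext.l_one ext.r_one ext.inv_one del: one_ext)
      moreover have "near \<one>\<^bsub>ext c\<^esub> (1400 * (n ^ 3 + int (\<rho> K)))" using n by (intro ext.in_ball_one) simp
      ultimately show ?thesis by blast
    next
      case False
      then obtain \<tau> i where i: "(\<tau>, i) \<in> keys f\<^sub>1" by (metis all_not_in_conv keys_eq_empty surj_pair)
      then have iu: "(\<tau>, i + u) \<in> keys f\<^sub>2" by (auto simp: eq keys_shift)
      then have f2: "f\<^sub>2 \<noteq> 0" by auto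
      have u: "pnorm u \<le> 2 * n"
        using near_bounds(2)[OF g(1)[unfolded g1] i] near_bounds(2)[OF g(2)[unfolded g2] iu]
          pnorm_triangle_diff[of "i + u" i] by simp
      have W: "\<bar>c \<tau> \<sigma> v\<bar> \<le> V K" if "pnorm v \<le> n" for \<tau> \<sigma> v
        by (rule kernel_bound[of "3 * n"]) (use K that n in auto)
      have "\<bar>z\<^sub>2 - z\<^sub>1\<bar> \<le> 2 * n ^ 2 * V K"
        using near_bounds_kernel[OF g(1)[unfolded g1] W] near_bounds_kernel[OF g(2)[unfolded g2] W]
        by (auto simp: power2_eq_square)
      then obtain h' where h': "commutator_form c h' f\<^sub>2 = z\<^sub>2 - z\<^sub>1" "reach h' (105 * (n ^ 3 + int (\<rho> K)))"
        using cheap_commutator[OF f2 near_bounds(2,3)[OF g(2)[unfolded g2]] K eq(2)] by auto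
      then obtain w' where w': "near (0, h', w') (105 * (n ^ 3 + int (\<rho> K)))" by (auto simp: reach_def)
      have "near (u, h', w') (105 * (n ^ 3 + int (\<rho> K)) + pnorm u)"
        using near_mult[OF w' near_translation[of u]] by simp
      then have "near (u, h', w') (1400 * (n ^ 3 + int (\<rho> K)))"
        by (rule ext.in_ball_mono) (use u nn n in auto)
      moreover have "conjugates (ext c) (u, h', w') g\<^sub>1 g\<^sub>2"
        using h'(1) by (simp add: g1 g2 conjugates_ext s eq(1) commutator_form_def)
      ultimately show ?thesis by blast
    qed
  qed
qed

text \<open>The exponent of \<open>g\<^sub>2\<close> is the commutator of \<open>b\<close> with its translate to \<open>(\<nu> k, k)\<close>. A conjugator has no
translation part, since it fixes the vector of \<open>g\<^sub>1\<close>, and its vector \<open>h\<close> is tested by \<open>\<kappa>\<close>. The values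
of \<open>\<kappa>\<close> divisible by \<open>V (k + 1)\<close> cannot produce an odd multiple of half of \<open>V (k + 1)\<close>, and the others
are at most \<open>V k\<close>.\<close>

theorem long_conjugator:
  fixes k :: nat
  defines "g\<^sub>1 \<equiv> (0, single (False, 0) 1, 0)"
    and "g\<^sub>2 \<equiv> (0, single (False, 0) 1, int (\<rho> (Suc k)) * V k)"
  shows "near g\<^sub>1 (13 * int (\<nu> k))" "near g\<^sub>2 (13 * int (\<nu> k))" "conjugate (ext c) g\<^sub>1 g\<^sub>2"
    "conjugates (ext c) x g\<^sub>1 g\<^sub>2 \<Longrightarrow> near x d \<Longrightarrow> int (\<rho> (Suc k)) \<le> d"
proof -
  have nu: "int k + 1 \<le> int (\<nu> k)" using nu_gt[of k] by simp
  have z0: "(0, 0) = (0::pt)" by (simp add: zero_prod_def)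
  have single: "near (0, single (\<tau>, 0) 1, 0) 1" for \<tau>
    by (rule ext.in_ball_letter) (auto simp: letters_gens)
  then show "near g\<^sub>1 (13 * int (\<nu> k))" unfolding g\<^sub>1_def
    by (rule ext.in_ball_mono) (use nu in auto)
  define i where "i = (int (\<nu> k), int k)"
  have xi: "\<xi> i = int (\<rho> (Suc k)) * V k" "\<xi> (- i) = 0" "\<xi> 0 = 0"
    using nu nu_gt[of 0] by (auto simp: i_def \<xi>_def)
  define b b' where "b = (0 :: pt, single (True, 0 :: pt) (1::int), 0 :: int)"
    and "b' = (i, 0, 0) \<otimes>\<^bsub>ext c\<^esub> b \<otimes>\<^bsub>ext c\<^esub> (- i, 0, 0)"
  have b: "near b 1" unfolding b_def by (rule single)
  have b': "near b' (pnorm i + 1 + pnorm (- i))"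
    unfolding b'_def by (intro near_mult near_translation b)
  have inv: "near (inv\<^bsub>ext c\<^esub> b) 1" "near (inv\<^bsub>ext c\<^esub> b') (pnorm i + 1 + pnorm (- i))"
    using b b' by (auto intro: ext.in_ball_inv)
  have "near ((0, single (False, 0) 1, 0) \<otimes>\<^bsub>ext c\<^esub> (b \<otimes>\<^bsub>ext c\<^esub> b' \<otimes>\<^bsub>ext c\<^esub> inv\<^bsub>ext c\<^esub> b \<otimes>\<^bsub>ext c\<^esub> inv\<^bsub>ext c\<^esub> b'))
     (1 + (1 + (pnorm i + 1 + pnorm (- i)) + 1 + (pnorm i + 1 + pnorm (- i))))"
    by (intro near_mult single b b' inv)
  moreover have "b \<otimes>\<^bsub>ext c\<^esub> b' \<otimes>\<^bsub>ext c\<^esub> inv\<^bsub>ext c\<^esub> b \<otimes>\<^bsub>ext c\<^esub> inv\<^bsub>ext c\<^esub> b' = (0, 0, \<xi> i)"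
    using xi by (simp add: b_def b'_def pairing_add_left pairing_add_right pairing_uminus_left
        pairing_uminus_right pairing_single_left lin_add lin_uminus)
  ultimately have "near g\<^sub>2 (1 + (1 + (pnorm i + 1 + pnorm (- i)) + 1 + (pnorm i + 1 + pnorm (- i))))"
    by (simp add: g\<^sub>2_def xi)
  then show "near g\<^sub>2 (13 * int (\<nu> k))"
    by (rule ext.in_ball_mono) (use nu in \<open>simp add: i_def pnorm_def\<close>)
  have "conjugates (ext c) (0, single (True, (0, 1)) (- (int (\<rho> (Suc k)) * V k)), 0) g\<^sub>1 g\<^sub>2"
    by (simp add: g\<^sub>1_def g\<^sub>2_def conjugates_ext pairing_single_left \<kappa>_def rho_0 add.commute)
  then show "conjugate (ext c) g\<^sub>1 g\<^sub>2" unfolding conjugate_def by blast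
  show "int (\<rho> (Suc k)) \<le> d" if x: "conjugates (ext c) x g\<^sub>1 g\<^sub>2" "near x d"
  proof -
    obtain u h w where xu: "x = (u, h, w)" by (cases x)
    define \<psi> where "\<psi> = (\<lambda>(\<sigma>, j). if \<sigma> then \<kappa> j else 0)"
    have "lookup (single (False, 0 :: pt) (1::int)) (False, - u) = lookup (single (False, 0) 1) (False, 0)"
    proof -
      have "shift u (single (False, 0) 1) = single (False, 0) 1"
        using x(1) by (simp add: xu g\<^sub>1_def g\<^sub>2_def conjugates_ext)
      from arg_cong[OF this, of "\<lambda>f. lookup f (False, 0)"] show ?thesis by simp
    qed
    then have u: "u = 0" by (simp add: lookup_single when_def split: if_splits)
    have "lin \<psi> h = lin (\<lambda>(\<sigma>, j). c False \<sigma> j) h"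
      by (rule lin_cong) (auto simp: \<psi>_def c_def)
    then have L: "lin \<psi> h = - (int (\<rho> (Suc k)) * V k)"
      using x(1) by (simp add: xu u g\<^sub>1_def g\<^sub>2_def conjugates_ext pairing_single_left pairing_single_right case_prod_unfold)
    have psi: "V (Suc k) dvd \<psi> p \<or> \<bar>\<psi> p\<bar> \<le> V k" for p
    proof (cases "\<psi> p = 0")
      case False
      then have p: "\<psi> p = \<kappa> (snd p)" "\<kappa> (snd p) \<noteq> 0" by (auto simp: \<psi>_def case_prod_unfold split: if_splits)
      from kappa_nonzero[OF p(2)] obtain l where "\<psi> p = V l" by (auto simp: p(1))
      then show ?thesis using V_dvd[of "Suc k" l] V_mono[of l k] by (cases "l \<le> k") auto
    qed simp
    define \<psi>1 where "\<psi>1 p = (if V (Suc k) dvd \<psi> p then \<psi> p else 0)" for p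
    define \<psi>2 where "\<psi>2 p = (if V (Suc k) dvd \<psi> p then 0 else \<psi> p)" for p
    have "\<psi> = (\<lambda>p. \<psi>1 p + \<psi>2 p)" by (auto simp: \<psi>1_def \<psi>2_def)
    then have L12: "lin \<psi> h = lin \<psi>1 h + lin \<psi>2 h" by (metis lin_add_fun)
    have "V (Suc k) dvd lin \<psi>1 h" by (rule lin_dvd) (auto simp: \<psi>1_def simp del: V.simps)
    then obtain q where q: "lin \<psi>1 h = V (Suc k) * q" by (auto elim: dvdE)
    have "\<bar>lin \<psi>2 h\<bar> \<le> l1 h * V k" by (rule abs_lin_le) (use psi in \<open>auto simp: \<psi>2_def simp del: V.simps\<close>)
    moreover have "int (\<rho> (Suc k)) * V k \<le> \<bar>lin \<psi>2 h\<bar>"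
    proof -
      define M where "M = int (\<rho> (Suc k)) * V k"
      have "lin \<psi>2 h = - (M * (1 + 2 * q))" using L L12 q by (simp add: M_def algebra_simps)
      moreover have "1 \<le> \<bar>1 + 2 * q\<bar>" by presburger
      moreover have M: "0 \<le> M" by (simp add: M_def)
      ultimately have "M * 1 \<le> M * \<bar>1 + 2 * q\<bar>" "\<bar>lin \<psi>2 h\<bar> = M * \<bar>1 + 2 * q\<bar>"
        by (auto simp only: abs_minus_cancel abs_mult abs_of_nonneg intro!: mult_left_mono)
      then show ?thesis by (simp add: M_def)
    qed
    ultimately have "int (\<rho> (Suc k)) * V k \<le> l1 h * V k" by linarith
    then have "int (\<rho> (Suc k)) \<le> l1 h" by simp
    then show ?thesis using near_bounds(3)[OF x(2)[unfolded xu]] by linarith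
  qed
qed

end

section \<open>Digits adapted to a growth function\<close>

text \<open>Between two scales \<open>\<Phi>\<close> grows by less than the factor 3, so it is determined by its values at the
scales up to a constant.\<close>

fun nu :: "(nat \<Rightarrow> nat) \<Rightarrow> nat \<Rightarrow> nat" where
  "nu \<Phi> 0 = 1"
| "nu \<Phi> (Suc k) = (LEAST n. nu \<Phi> k < n \<and> 3 * \<Phi> (nu \<Phi> k) \<le> \<Phi> n)"

fun rho :: "(nat \<Rightarrow> nat) \<Rightarrow> nat \<Rightarrow> nat" where
  "rho \<Phi> 0 = 1"
| "rho \<Phi> (Suc k) = 3 * \<Phi> (nu \<Phi> k)"

declare nu.simps(2) [simp del]

locale growth =
  fixes \<Phi> :: "nat \<Rightarrow> nat" and C :: nat
  assumes pos: "\<And>i. 1 \<le> i \<Longrightarrow> 1 \<le> \<Phi> i"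
    and mono: "mono_on {1..} \<Phi>"
    and C: "1 \<le> C" and cubic: "\<And>n. 1 \<le> n \<Longrightarrow> n ^ 3 \<le> C * \<Phi> (C * n)"
begin

lemma Phi_mono: "1 \<le> i \<Longrightarrow> i \<le> j \<Longrightarrow> \<Phi> i \<le> \<Phi> j"
  using mono_onD[OF mono, of i j] by simp

lemma unbounded: "\<exists>n. m < n \<and> b \<le> \<Phi> n"
proof -
  define n where "n = C * b + m + 1"
  have "n * 1 \<le> n * (n * n)" by (intro mult_left_mono) (auto simp: n_def)
  then have "n \<le> n ^ 3" by (simp add: power3_eq_cube)
  also have "\<dots> \<le> C * \<Phi> (C * n)" by (rule cubic) (simp add: n_def)
  finally have "n \<le> C * \<Phi> (C * n)" .
  moreover have "C * b \<le> n" by (simp add: n_def)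
  ultimately have "C * b \<le> C * \<Phi> (C * n)" by (rule le_trans[rotated])
  then have "b \<le> \<Phi> (C * n)" using C by simp
  moreover have "1 * n \<le> C * n" using C by (intro mult_right_mono) auto
  then have "m < C * n" by (simp add: n_def)
  ultimately show ?thesis by blast
qed

lemma nu_Suc: "nu \<Phi> k < nu \<Phi> (Suc k)" "3 * \<Phi> (nu \<Phi> k) \<le> \<Phi> (nu \<Phi> (Suc k))"
proof -
  have "nu \<Phi> k < nu \<Phi> (Suc k) \<and> 3 * \<Phi> (nu \<Phi> k) \<le> \<Phi> (nu \<Phi> (Suc k))"
    unfolding nu.simps by (rule LeastI_ex) (rule unbounded)
  then show "nu \<Phi> k < nu \<Phi> (Suc k)" "3 * \<Phi> (nu \<Phi> k) \<le> \<Phi> (nu \<Phi> (Suc k))" by auto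
qed

lemma before_nu_Suc:
  assumes "nu \<Phi> k \<le> n" "n < nu \<Phi> (Suc k)" "1 \<le> n"
  shows "\<Phi> n < 3 * \<Phi> (nu \<Phi> k)"
proof (cases "n = nu \<Phi> k")
  case True
  then show ?thesis using pos[OF assms(3)] by simp
next
  case False
  then show ?thesis using not_less_Least[OF assms(2)[unfolded nu.simps]] assms(1) by simp
qed

sublocale digits "rho \<Phi>" "nu \<Phi>"
proof
  show nu: "k < nu \<Phi> k" for k
  proof (induction k)
    case (Suc k)
    then show ?case using nu_Suc(1)[of k] by simp
  qed simp
  show "3 * rho \<Phi> k \<le> rho \<Phi> (Suc k)" for k
  proof (cases k)
    case 0
    then show ?thesis using pos[of 1] by simp
  next
    case (Suc l)
    then show ?thesis using nu_Suc(2)[of l] by simp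
  qed
qed simp

text \<open>\<open>K\<close> is the last level whose digit can appear in the kernel on the ball of radius \<open>3 * n\<close>. Either its
point lies in that ball, or \<open>K\<close> is the successor of a level with scale at most \<open>3 * n\<close>; in both cases
\<open>\<rho> K\<close> is bounded by \<open>n\<close> and \<open>\<Phi> (3 * n)\<close>.\<close>

lemma conjugator_upper:
  assumes "1 \<le> n" "near g\<^sub>1 (int n)" "near g\<^sub>2 (int n)" "conjugate (ext c) g\<^sub>1 g\<^sub>2"
  shows "\<exists>x. conjugates (ext c) x g\<^sub>1 g\<^sub>2 \<and> near x (int (11200 * C * \<Phi> (11200 * C * n)))"
proof -
  define A where "A = {0} \<union> {k. rho \<Phi> k \<le> 3 * n} \<union> Suc ` {k. nu \<Phi> k \<le> 3 * n}"
  have "{k. rho \<Phi> k \<le> 3 * n} \<subseteq> {..3 * n}" "{k. nu \<Phi> k \<le> 3 * n} \<subseteq> {..3 * n}"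
    using less_rho nu_gt by (auto intro: less_imp_le less_le_trans)
  then have fin: "finite A" unfolding A_def by (auto intro: finite_subset)
  define K where "K = Max A"
  have K: "k \<le> K" if "k \<in> A" for k unfolding K_def using fin that by simp
  have "K \<in> A" unfolding K_def using fin by (intro Max_in) (auto simp: A_def)
  then consider "K = 0" | "rho \<Phi> K \<le> 3 * n" | k where "K = Suc k" "nu \<Phi> k \<le> 3 * n"
    unfolding A_def by auto
  then have rK: "rho \<Phi> K \<le> 1 + 3 * n + 3 * \<Phi> (3 * n)"
  proof cases
    case 3
    then have "\<Phi> (nu \<Phi> k) \<le> \<Phi> (3 * n)" using nu_gt[of k] by (intro Phi_mono) auto
    then show ?thesis by (simp add: 3)
  qed auto
  obtain x where x: "conjugates (ext c) x g\<^sub>1 g\<^sub>2" "near x (1400 * (int n ^ 3 + int (rho \<Phi> K)))"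
    using short_conjugator[of "int n" g\<^sub>1 g\<^sub>2 K] assms K
    by (auto simp: A_def)
  have "n * 1 \<le> n * (n * n)" using assms(1) by (intro mult_left_mono) auto
  then have n3: "n \<le> n ^ 3" "1 \<le> n ^ 3" using assms(1) by (simp_all add: power3_eq_cube)
  have m: "\<Phi> (C * n) \<le> \<Phi> (11200 * C * n)" "\<Phi> (3 * n) \<le> \<Phi> (11200 * C * n)"
  proof -
    have "1 * (3 * n) \<le> C * (11200 * n)" using C by (intro mult_mono) auto
    then show "\<Phi> (3 * n) \<le> \<Phi> (11200 * C * n)" using assms(1) by (intro Phi_mono) (auto simp: ac_simps)
    have "1 * 1 \<le> C * n" using C assms(1) by (intro mult_mono) auto
    then show "\<Phi> (C * n) \<le> \<Phi> (11200 * C * n)" by (intro Phi_mono) auto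
  qed
  have "1400 * (n ^ 3 + rho \<Phi> K) \<le> 1400 * (5 * n ^ 3 + 3 * \<Phi> (3 * n))"
    using rK n3 by simp
  also have "\<dots> \<le> 1400 * (5 * (C * \<Phi> (11200 * C * n)) + 3 * (C * \<Phi> (11200 * C * n)))"
  proof -
    have "n ^ 3 \<le> C * \<Phi> (11200 * C * n)"
      using cubic[OF assms(1)] m(1) by (meson le_trans mult_le_mono2)
    moreover have "1 * \<Phi> (3 * n) \<le> C * \<Phi> (11200 * C * n)" using C m(2) by (intro mult_mono) auto
    ultimately show ?thesis by simp
  qed
  finally have "1400 * (n ^ 3 + rho \<Phi> K) \<le> 11200 * C * \<Phi> (11200 * C * n)" by simp
  then have "1400 * (int n ^ 3 + int (rho \<Phi> K)) \<le> int (11200 * C * \<Phi> (11200 * C * n))"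

  proof -
    assume "1400 * (n ^ 3 + rho \<Phi> K) \<le> 11200 * C * \<Phi> (11200 * C * n)"
    then have "int (1400 * (n ^ 3 + rho \<Phi> K)) \<le> int (11200 * C * \<Phi> (11200 * C * n))" by (simp only: of_nat_le_iff)
    then show ?thesis by simp
  qed
  from ext.in_ball_mono[OF x(2) this] x(1) show ?thesis by blast
qed

lemma conjugator_lower:
  assumes "1 \<le> n"
  shows "\<exists>g\<^sub>1 g\<^sub>2. near g\<^sub>1 (int (13 * n)) \<and> near g\<^sub>2 (int (13 * n)) \<and> conjugate (ext c) g\<^sub>1 g\<^sub>2 \<and>
    (\<forall>x d. conjugates (ext c) x g\<^sub>1 g\<^sub>2 \<longrightarrow> near x d \<longrightarrow> int (\<Phi> n) \<le> d)"
proof -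
  define A where "A = {k. nu \<Phi> k \<le> n}"
  have "A \<subseteq> {..n}" using nu_gt by (auto simp: A_def intro: less_imp_le less_le_trans)
  then have fin: "finite A" by (rule finite_subset) simp
  have "0 \<in> A" using assms by (simp add: A_def)
  define k where "k = Max A"
  have "k \<in> A" unfolding k_def using fin \<open>0 \<in> A\<close> by (intro Max_in) auto
  then have k: "nu \<Phi> k \<le> n" by (simp add: A_def)
  have "Suc k \<notin> A" using Max_ge[OF fin, of "Suc k"] unfolding k_def by auto
  then have "n < nu \<Phi> (Suc k)" by (simp add: A_def)
  then have Phi: "\<Phi> n \<le> rho \<Phi> (Suc k)" using before_nu_Suc[OF k _ assms] by simp
  have le: "13 * int (nu \<Phi> k) \<le> int (13 * n)" using k by simp
  show ?thesis
  proof (intro exI conjI allI impI)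
    show "near (0, single (False, 0) 1, 0) (int (13 * n))"
      "near (0, single (False, 0) 1, int (rho \<Phi> (Suc k)) * V k) (int (13 * n))"
      using ext.in_ball_mono[OF long_conjugator(1)[of k] le] ext.in_ball_mono[OF long_conjugator(2)[of k] le] .
    show "conjugate (ext c) (0, single (False, 0) 1, 0)
        (0, single (False, 0) 1, int (rho \<Phi> (Suc k)) * V k)" by (rule long_conjugator(3))
    fix x d
    assume "conjugates (ext c) x (0, single (False, 0) 1, 0)
        (0, single (False, 0) 1, int (rho \<Phi> (Suc k)) * V k)" "near x d"
    then have "int (rho \<Phi> (Suc k)) \<le> d" by (rule long_conjugator(4))
    then show "int (\<Phi> n) \<le> d" using Phi by linarith
  qed
qed

end

section \<open>Transport along isomorphisms\<close>

locale group_iso = G: group G + H: group H for G :: "('a, 'b) monoid_scheme" and H :: "('c, 'd) monoid_scheme" +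
  fixes \<psi> :: "'a \<Rightarrow> 'c"
  assumes iso: "\<psi> \<in> iso G H"
begin

sublocale group_hom G H \<psi>
  by unfold_locales (use iso in \<open>simp add: iso_def\<close>)

lemma bij: "bij_betw \<psi> (carrier G) (carrier H)"
  using iso by (simp add: iso_def)

lemma image_carrier: "\<psi> ` carrier G = carrier H"
  using bij by (rule bij_betw_imp_surj_on)

lemma inj: "inj_on \<psi> (carrier G)"
  using bij by (rule bij_betw_imp_inj_on)

lemma eq_iff: "x \<in> carrier G \<Longrightarrow> y \<in> carrier G \<Longrightarrow> \<psi> x = \<psi> y \<longleftrightarrow> x = y"
  using inj by (auto dest: inj_onD)

lemma finite_generating_set_image:
  "finite_generating_set G S \<Longrightarrow> finite_generating_set H (\<psi> ` S)"
  unfolding finite_generating_set_def using generate_img[of S] image_carrier by auto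

lemma conjugates_image:
  assumes "h \<in> carrier G" "a \<in> carrier G" "b \<in> carrier G"
  shows "conjugates H (\<psi> h) (\<psi> a) (\<psi> b) \<longleftrightarrow> conjugates G h a b"
proof -
  have "\<psi> h \<otimes>\<^bsub>H\<^esub> \<psi> a \<otimes>\<^bsub>H\<^esub> inv\<^bsub>H\<^esub> \<psi> h = \<psi> (h \<otimes>\<^bsub>G\<^esub> a \<otimes>\<^bsub>G\<^esub> inv\<^bsub>G\<^esub> h)" using assms by simp
  then show ?thesis unfolding conjugates_def
    using assms eq_iff[of "h \<otimes>\<^bsub>G\<^esub> a \<otimes>\<^bsub>G\<^esub> inv\<^bsub>G\<^esub> h" b] by auto
qed

lemma foldr_image:
  "set ws \<subseteq> carrier G \<Longrightarrow> foldr (mult H) (map \<psi> ws) \<one>\<^bsub>H\<^esub> = \<psi> (foldr (mult G) ws \<one>\<^bsub>G\<^esub>)"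
  by (induction ws) auto

lemma word_norm_image:
  assumes "S \<subseteq> carrier G" "g \<in> carrier G"
  shows "word_norm H (\<psi> ` S) (\<psi> g) = word_norm G S g"
proof -
  have L: "\<psi> ` S \<union> m_inv H ` \<psi> ` S = \<psi> ` letters G S"
    using assms(1) by (force simp: letters_def image_Un image_image)
  have "(\<exists>ws. length ws = k \<and> set ws \<subseteq> \<psi> ` letters G S \<and> foldr (mult H) ws \<one>\<^bsub>H\<^esub> = \<psi> g) \<longleftrightarrow>
      (\<exists>ws. length ws = k \<and> set ws \<subseteq> letters G S \<and> foldr (mult G) ws \<one>\<^bsub>G\<^esub> = g)" for k
  proof
    assume "\<exists>ws. length ws = k \<and> set ws \<subseteq> \<psi> ` letters G S \<and> foldr (mult H) ws \<one>\<^bsub>H\<^esub> = \<psi> g"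
    then obtain ws where ws: "length ws = k" "set ws \<subseteq> \<psi> ` letters G S" "foldr (mult H) ws \<one>\<^bsub>H\<^esub> = \<psi> g" by blast
    from ws(2) have "ws \<in> map \<psi> ` lists (letters G S)" by (simp add: lists_image[symmetric] in_lists_conv_set subset_iff)
    then obtain us where us: "ws = map \<psi> us" "set us \<subseteq> letters G S" by auto
    then have "set us \<subseteq> carrier G" using G.letters_subset[OF assms(1)] by blast
    then have "foldr (mult G) us \<one>\<^bsub>G\<^esub> = g" using ws(3) foldr_image[of us] assms(2) by (simp add: us eq_iff)
    then show "\<exists>ws. length ws = k \<and> set ws \<subseteq> letters G S \<and> foldr (mult G) ws \<one>\<^bsub>G\<^esub> = g"
      using us ws(1) by auto
  next
    assume "\<exists>ws. length ws = k \<and> set ws \<subseteq> letters G S \<and> foldr (mult G) ws \<one>\<^bsub>G\<^esub> = g"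
    then obtain ws where ws: "length ws = k" "set ws \<subseteq> letters G S" "foldr (mult G) ws \<one>\<^bsub>G\<^esub> = g" by blast
    then have "foldr (mult H) (map \<psi> ws) \<one>\<^bsub>H\<^esub> = \<psi> g"
      using foldr_image[of ws] G.letters_subset[OF assms(1)] by auto
    then show "\<exists>ws. length ws = k \<and> set ws \<subseteq> \<psi> ` letters G S \<and> foldr (mult H) ws \<one>\<^bsub>H\<^esub> = \<psi> g"
      using ws by (intro exI[of _ "map \<psi> ws"]) auto
  qed
  then show ?thesis unfolding word_norm_def L by (simp add: letters_def)
qed

lemma torsion_free_image:
  assumes "torsion_free G"
  shows "torsion_free H"
  unfolding torsion_free_def
proof (intro ballI allI impI)
  fix x n assume x: "x \<in> carrier H" "0 < (n :: nat)" "x [^]\<^bsub>H\<^esub> n = \<one>\<^bsub>H\<^esub>"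
  obtain g where g: "g \<in> carrier G" "x = \<psi> g" using x(1) image_carrier by blast
  then have "\<psi> (g [^]\<^bsub>G\<^esub> n) = \<psi> \<one>\<^bsub>G\<^esub>" using x(3) by (simp add: hom_nat_pow)
  then have "g [^]\<^bsub>G\<^esub> n = \<one>\<^bsub>G\<^esub>" using g by (subst (asm) eq_iff) auto
  then have "g = \<one>\<^bsub>G\<^esub>" using assms g(1) x(2) unfolding torsion_free_def by blast
  then show "x = \<one>\<^bsub>H\<^esub>" using g(2) by simp
qed

lemma derived_length_image: "derived_length H = derived_length G"
proof -
  have "(derived H ^^ n) (carrier H) = {\<one>\<^bsub>H\<^esub>} \<longleftrightarrow> (derived G ^^ n) (carrier G) = {\<one>\<^bsub>G\<^esub>}" for n
  proof -
    have sub: "(derived G ^^ n) (carrier G) \<subseteq> carrier G"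
      by (rule G.exp_of_derived_in_carrier) simp
    have "(derived H ^^ n) (carrier H) = \<psi> ` (derived G ^^ n) (carrier G)"
      using exp_of_derived_img[of "carrier G" n] image_carrier by simp
    moreover have "{\<one>\<^bsub>H\<^esub>} = \<psi> ` {\<one>\<^bsub>G\<^esub>}" by simp
    ultimately show ?thesis using inj_on_image_eq_iff[OF inj sub, of "{\<one>\<^bsub>G\<^esub>}"] by simp
  qed
  then show ?thesis by (simp add: derived_length_def)
qed

lemma solvable_image: "solvable G \<Longrightarrow> solvable H"
  using surj_hom_imp_solvable image_carrier by blast

lemma recursively_presented_image:
  assumes "recursively_presented G"
  shows "recursively_presented H"
proof -
  have "H \<cong> G" using iso G.iso_sym unfolding is_iso_def by blast
  then show ?thesis using assms unfolding recursively_presented_def by (meson iso_trans)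
qed

end

section \<open>Groups with prescribed conjugator length function\<close>

text \<open>In the second case the exponent is at least 3 as soon as \<open>log 3 i \<ge> 9\<close>. Evaluating \<open>\<Phi>\<close> at \<open>3\<^sup>9 * n\<close>
avoids the smaller arguments.\<close>

lemma cubic_growth:
  fixes \<Phi> :: "nat \<Rightarrow> nat"
  assumes "(\<forall>i\<ge>1. \<Phi> i \<ge> i ^ 3 \<and> \<Phi> (3 * i) \<ge> 3 * \<Phi> i) \<or>
         (\<forall>i\<ge>2. real (\<Phi> i) \<ge> real i powr (1 + log 3 2 + log 3 (log 3 (real i))))"
  shows "\<exists>C\<ge>1. \<forall>n\<ge>1. n ^ 3 \<le> C * \<Phi> (C * n)"
  using assms
proof
  assume "\<forall>i\<ge>1. \<Phi> i \<ge> i ^ 3 \<and> \<Phi> (3 * i) \<ge> 3 * \<Phi> i"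
  then show ?thesis by (intro exI[of _ 1]) simp
next
  assume b: "\<forall>i\<ge>2. real (\<Phi> i) \<ge> real i powr (1 + log 3 2 + log 3 (log 3 (real i)))"
  define C :: nat where "C = 3 ^ 9"
  have "n ^ 3 \<le> C * \<Phi> (C * n)" if n: "1 \<le> n" for n
  proof -
    define m where "m = C * n"
    have m: "3 ^ 9 \<le> m" "n \<le> m" using n by (auto simp: m_def C_def)
    then have mr: "(3::real) ^ 9 \<le> real m" by (metis of_nat_le_iff of_nat_numeral of_nat_power)
    have "log 3 ((3::real) ^ 9) \<le> log 3 (real m)" using mr m by (intro log_mono) auto
    then have "9 \<le> log 3 (real m)" by (simp only: log_pow_cancel)
    then have "log 3 ((3::real) ^ 2) \<le> log 3 (log 3 (real m))" by (intro log_mono) auto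
    then have "2 \<le> log 3 (log 3 (real m))" by (simp only: log_pow_cancel)
    moreover have "0 \<le> log 3 (2::real)" by simp
    ultimately have "3 \<le> 1 + log 3 2 + log 3 (log 3 (real m))" by linarith
    moreover have "1 \<le> real m" using m by simp
    ultimately have "real m powr 3 \<le> real m powr (1 + log 3 2 + log 3 (log 3 (real m)))"
      by (rule powr_mono)
    also have "\<dots> \<le> real (\<Phi> m)" using b m by auto
    finally have "real (m ^ 3) \<le> real (\<Phi> m)" using m by simp
    then have "m ^ 3 \<le> \<Phi> m" by (simp only: of_nat_le_iff)
    moreover have "n ^ 3 \<le> m ^ 3" using m(2) by (intro power_mono) auto
    ultimately have "n ^ 3 \<le> 1 * \<Phi> m" by linarith
    also have "\<dots> \<le> C * \<Phi> m" by (intro mult_right_mono) (auto simp: C_def)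
    finally show ?thesis by (simp add: m_def)
  qed
  then show ?thesis by (intro exI[of _ C]) (simp add: C_def)
qed

text \<open>Some extension on this type is finitely generated, which makes the type countable.\<close>

lemma countable_elt: "countable (UNIV :: elt set)"
proof -
  interpret growth "\<lambda>n. n ^ 3" 1
    by unfold_locales (auto intro!: mono_onI power_mono)
  have "(UNIV :: elt set) = (\<lambda>ws. foldr (mult (ext c)) ws \<one>\<^bsub>ext c\<^esub>) ` lists (letters (ext c) gens)"
  proof -
    have "g \<in> (\<lambda>ws. foldr (mult (ext c)) ws \<one>\<^bsub>ext c\<^esub>) ` lists (letters (ext c) gens)" for g
    proof -
      have "near g (int (word_norm (ext c) gens g))"
        using ext.in_ball_word_norm[OF gens_generate] by simp
      then show ?thesis by (auto simp: ext.in_ball_def)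
    qed
    then show ?thesis by blast
  qed
  moreover have "finite (letters (ext c) gens)" by (simp add: letters_def gens_def)
  ultimately show ?thesis by (metis countable_image countable_lists countable_finite)
qed

text \<open>
The type of the extension is countable, so the group can be moved to the natural numbers.
\<close>

theorem (in growth) group_with_conjugator_length:
  "\<exists>G :: nat monoid.
    group G \<and> torsion_free G \<and> finitely_generated G \<and> solvable G \<and> derived_length G = 3 \<and>
    (\<forall>S. finite_generating_set G S \<longrightarrow>
      asymp_equiv (\<lambda>n. real (conjugator_length G S n)) (\<lambda>n. real (\<Phi> n))) \<and>
    (recursively_presented (ext c) \<longrightarrow> recursively_presented G)"
proof -
  define \<psi> :: "elt \<Rightarrow> nat" where "\<psi> = to_nat_on UNIV"
  have inj: "inj \<psi>" unfolding \<psi>_def by (rule inj_on_to_nat_on[OF countable_elt])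
  define \<phi> where "\<phi> = inv_into UNIV \<psi>"
  have \<phi>: "\<phi> (\<psi> g) = g" for g unfolding \<phi>_def using inj by simp
  define G where "G = \<lparr>carrier = range \<psi>, mult = (\<lambda>x y. \<psi> (\<phi> x \<otimes>\<^bsub>ext c\<^esub> \<phi> y)), one = \<psi> \<one>\<^bsub>ext c\<^esub>\<rparr>"
  have iso: "\<psi> \<in> iso (ext c) G"
    using inj by (simp add: G_def iso_def hom_def bij_betw_def \<phi>)
  have "group (G\<lparr>one := \<psi> \<one>\<^bsub>ext c\<^esub>\<rparr>)" using group.iso_imp_img_group[OF group_ext iso] .
  then have "group G" by (simp add: G_def)
  interpret H: group G by fact
  interpret group_iso "ext c" G \<psi> by unfold_locales (rule iso)
  have \<psi>: "\<psi> (\<phi> x) = x" if "x \<in> carrier G" for x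
  proof -
    obtain g where "x = \<psi> g" using \<open>x \<in> carrier G\<close> image_carrier by blast
    then show ?thesis by (simp only: \<phi>)
  qed
  define N where "N x = word_norm (ext c) gens (\<phi> x)" for x
  have N: "near (\<phi> x) n \<longleftrightarrow> int (N x) \<le> n" for x n
    unfolding N_def by (rule ext.in_ball_iff_word_norm[OF gens_generate]) simp
  have gen: "finite_generating_set G (\<psi> ` gens)" by (rule finite_generating_set_image[OF gens_generate])
  have NG: "N x = word_norm G (\<psi> ` gens) x" if "x \<in> carrier G" for x
    using word_norm_image[of gens "\<phi> x"] \<psi>[OF that] by (simp add: N_def)
  have conj: "conjugates G h a b \<longleftrightarrow> conjugates (ext c) (\<phi> h) (\<phi> a) (\<phi> b)"
    if "h \<in> carrier G" "a \<in> carrier G" "b \<in> carrier G" for h a b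
    using conjugates_image[of "\<phi> h" "\<phi> a" "\<phi> b"] \<psi>[OF that(1)] \<psi>[OF that(2)] \<psi>[OF that(3)] by simp
  have conjh: "h \<in> carrier G" if "conjugates G h a b" for h a b using that by (simp add: conjugates_def)
  have "asymp_equiv (\<lambda>n. real (conjugator_length G S n)) (\<lambda>n. real (\<Phi> n))" if S: "finite_generating_set G S" for S
  proof -
    obtain C1 where C1: "C1 \<ge> 1" "\<And>g. g \<in> carrier G \<Longrightarrow> word_norm G S g \<le> C1 * N g"
      using H.word_norm_change[OF S gen] NG by auto
    obtain C2 where C2: "C2 \<ge> 1" "\<And>g. g \<in> carrier G \<Longrightarrow> N g \<le> C2 * word_norm G S g"
      using H.word_norm_change[OF gen S] NG by auto
    show ?thesis
    proof (rule H.conjugator_length_asymp_equiv[OF S mono C1 C2])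
      show "1 \<le> 11200 * C" "1 \<le> (13::nat)" using C by auto
    next
      fix n g\<^sub>1 g\<^sub>2
      assume n: "1 \<le> n" and g: "g\<^sub>1 \<in> carrier G" "g\<^sub>2 \<in> carrier G" and "N g\<^sub>1 \<le> n" "N g\<^sub>2 \<le> n" "conjugate G g\<^sub>1 g\<^sub>2"
      then have "near (\<phi> g\<^sub>1) (int n)" "near (\<phi> g\<^sub>2) (int n)" by (simp_all add: N)
      moreover have "conjugate (ext c) (\<phi> g\<^sub>1) (\<phi> g\<^sub>2)"
        using \<open>conjugate G g\<^sub>1 g\<^sub>2\<close> conj[OF conjh g] unfolding conjugate_def by blast
      ultimately obtain x where x: "conjugates (ext c) x (\<phi> g\<^sub>1) (\<phi> g\<^sub>2)" "near x (int (11200 * C * \<Phi> (11200 * C * n)))"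
        using conjugator_upper[OF n] by blast
      have "\<psi> x \<in> carrier G" using image_carrier by auto
      then have "conjugates G (\<psi> x) g\<^sub>1 g\<^sub>2" using x(1) conj[of "\<psi> x", OF _ g] by (simp add: \<phi>)
      moreover have "N (\<psi> x) \<le> 11200 * C * \<Phi> (11200 * C * n)" using x(2) N[of "\<psi> x"] by (simp only: \<phi> of_nat_le_iff)
      ultimately show "\<exists>h. conjugates G h g\<^sub>1 g\<^sub>2 \<and> N h \<le> 11200 * C * \<Phi> (11200 * C * n)" by blast
    next
      fix n :: nat assume n: "1 \<le> n"
      obtain g\<^sub>1 g\<^sub>2 where g: "near g\<^sub>1 (int (13 * n))" "near g\<^sub>2 (int (13 * n))" "conjugate (ext c) g\<^sub>1 g\<^sub>2"
        "\<And>x d. conjugates (ext c) x g\<^sub>1 g\<^sub>2 \<Longrightarrow> near x d \<Longrightarrow> int (\<Phi> n) \<le> d"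
        using conjugator_lower[OF n] by blast
      have carr: "\<psi> g \<in> carrier G" for g using image_carrier by auto
      have N': "N (\<psi> g\<^sub>1) \<le> 13 * n" "N (\<psi> g\<^sub>2) \<le> 13 * n"
        using g(1,2) N[of "\<psi> g\<^sub>1"] N[of "\<psi> g\<^sub>2"] by (simp_all only: \<phi> of_nat_le_iff)
      obtain x where "conjugates (ext c) x g\<^sub>1 g\<^sub>2" using g(3) by (auto simp: conjugate_def simp del: split_paired_Ex)
      then have "conjugates G (\<psi> x) (\<psi> g\<^sub>1) (\<psi> g\<^sub>2)"
        using conj[OF carr[of x] carr[of g\<^sub>1] carr[of g\<^sub>2]] by (simp only: \<phi>)
      then have "conjugate G (\<psi> g\<^sub>1) (\<psi> g\<^sub>2)" unfolding conjugate_def by blast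
      moreover have "\<Phi> n \<le> N h" if h: "conjugates G h (\<psi> g\<^sub>1) (\<psi> g\<^sub>2)" for h
      proof -
        have "conjugates (ext c) (\<phi> h) g\<^sub>1 g\<^sub>2" 
          using conj[OF conjh[OF h] carr[of g\<^sub>1] carr[of g\<^sub>2]] h by (simp only: \<phi>)
        moreover have "near (\<phi> h) (int (N h))" by (simp add: N)
        ultimately show ?thesis using g(4) by (simp only: of_nat_le_iff[symmetric, where 'a = int])
      qed
      ultimately show "\<exists>g\<^sub>1 g\<^sub>2. g\<^sub>1 \<in> carrier G \<and> g\<^sub>2 \<in> carrier G \<and> N g\<^sub>1 \<le> 13 * n \<and> N g\<^sub>2 \<le> 13 * n \<and>
        conjugate G g\<^sub>1 g\<^sub>2 \<and> (\<forall>h. conjugates G h g\<^sub>1 g\<^sub>2 \<longrightarrow> \<Phi> n \<le> N h)"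
        using N' carr by blast
    qed
  qed
  moreover have "torsion_free G" by (rule torsion_free_image[OF torsion_free_ext])
  moreover have "finitely_generated G" using gen by (auto simp: finitely_generated_def)
  moreover have "solvable (ext c)" using derived_ext_3 ext.solvable_iff_trivial_derived_seq by blast
  then have "solvable G" by (rule solvable_image)
  moreover have "derived_length (ext c) = 3"
    by (rule derived_length_ext) (simp_all add: \<kappa>_def)
  then have "derived_length G = 3" by (simp add: derived_length_image)
  ultimately show ?thesis using \<open>group G\<close> recursively_presented_image by blast
qed

section \<open>Computable functions of several arguments\<close>

text \<open>\<open>F\<close> is a total computable function of \<open>k\<close> arguments. Keeping the arguments in a list lets functions with
different numbers of arguments share the closure lemmas below, which are stated so that they can be
used as introduction rules on explicit expressions.\<close>

definition recursive :: "nat \<Rightarrow> (nat list \<Rightarrow> nat) \<Rightarrow> bool" where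
  "recursive k F \<longleftrightarrow> (\<exists>r. \<forall>xs. length xs = k \<longrightarrow> rec_eval r xs (F xs))"

lemma recursive_cong:
  assumes "recursive k F" "\<And>xs. length xs = k \<Longrightarrow> F xs = G xs"
  shows "recursive k G"
  using assms unfolding recursive_def by metis

lemma recursive_nth: "i < k \<Longrightarrow> recursive k (\<lambda>xs. xs ! i)"
  unfolding recursive_def by (metis rec_eval.proj)

lemma recursive_comp:
  assumes "recursive m F" "\<And>i. i < m \<Longrightarrow> recursive k (G i)"
  shows "recursive k (\<lambda>xs. F (map (\<lambda>i. G i xs) [0..<m]))"
proof -
  obtain r where r: "\<And>xs. length xs = m \<Longrightarrow> rec_eval r xs (F xs)" using assms(1) by (auto simp: recursive_def)
  have "\<forall>i. \<exists>s. i < m \<longrightarrow> (\<forall>xs. length xs = k \<longrightarrow> rec_eval s xs (G i xs))"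
    using assms(2) unfolding recursive_def by blast
  from choice[OF this] obtain s where s: "\<And>i xs. i < m \<Longrightarrow> length xs = k \<Longrightarrow> rec_eval (s i) xs (G i xs)" by blast
  have "rec_eval (Comp r (map s [0..<m])) xs (F (map (\<lambda>i. G i xs) [0..<m]))" if "length xs = k" for xs
  proof (rule rec_eval.comp)
    show "list_all2 (\<lambda>g. rec_eval g xs) (map s [0..<m]) (map (\<lambda>i. G i xs) [0..<m])"
      using s that by (simp add: list_all2_conv_all_nth)
  qed (simp add: r)
  then show ?thesis unfolding recursive_def by blast
qed

lemma recursive_tl:
  assumes "recursive k F"
  shows "recursive (Suc k) (\<lambda>ys. F (tl ys))"
proof (rule recursive_cong[OF recursive_comp[OF assms, of "Suc k" "\<lambda>i ys. ys ! Suc i"]])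
  fix ys :: "nat list" assume "length ys = Suc k"
  then have "map (\<lambda>i. ys ! Suc i) [0..<k] = tl ys" by (intro nth_equalityI) (auto simp: nth_tl)
  then show "F (map (\<lambda>i. ys ! Suc i) [0..<k]) = F (tl ys)" by simp
qed (simp add: recursive_nth)

lemma recursive_Cons:
  assumes "recursive (Suc k) H" "recursive k N"
  shows "recursive k (\<lambda>xs. H (N xs # xs))"
proof (rule recursive_cong[OF recursive_comp[OF assms(1), of k "\<lambda>i xs. case i of 0 \<Rightarrow> N xs | Suc i \<Rightarrow> xs ! i"]])
  fix xs :: "nat list" assume "length xs = k"
  then have "map (\<lambda>i. case i of 0 \<Rightarrow> N xs | Suc i \<Rightarrow> xs ! i) [0..<Suc k] = N xs # xs"
    by (intro nth_equalityI) (auto simp del: upt_Suc split: nat.split)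
  then show "H (map (\<lambda>i. case i of 0 \<Rightarrow> N xs | Suc i \<Rightarrow> xs ! i) [0..<Suc k]) = H (N xs # xs)" by simp
next
  fix i assume "i < Suc k"
  then show "recursive k (\<lambda>xs. case i of 0 \<Rightarrow> N xs | Suc i \<Rightarrow> xs ! i)"
    using assms(2) by (cases i) (simp_all add: recursive_nth)
qed

lemma recursive_rec:
  assumes F: "recursive k F" and G: "recursive (Suc (Suc k)) (\<lambda>ys. G (hd ys) (hd (tl ys)) (tl (tl ys)))" and N: "recursive k N"
  shows "recursive k (\<lambda>xs. rec_nat (F xs) (\<lambda>n y. G n y xs) (N xs))"
proof -
  obtain r s where r: "\<And>xs. length xs = k \<Longrightarrow> rec_eval r xs (F xs)"
    and s: "\<And>n y xs. length xs = k \<Longrightarrow> rec_eval s (n # y # xs) (G n y xs)"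
    using F G unfolding recursive_def by (metis length_Cons list.sel)
  have "rec_eval (Prec r s) (n # xs) (rec_nat (F xs) (\<lambda>n y. G n y xs) n)" if "length xs = k" for n xs
    by (induction n) (auto intro: rec_eval.prec_0 rec_eval.prec_Suc r s that)
  then have "recursive (Suc k) (\<lambda>ys. rec_nat (F (tl ys)) (\<lambda>n y. G n y (tl ys)) (hd ys))"
    unfolding recursive_def by (intro exI[of _ "Prec r s"]) (auto simp: length_Suc_conv)
  from recursive_Cons[OF this N] show ?thesis by simp
qed

lemma recursive_const: "recursive k (\<lambda>_. m)"
proof (induction m)
  case 0
  show ?case unfolding recursive_def by (blast intro: rec_eval.zero)
next
  case (Suc m)
  then obtain r where "\<And>xs. length xs = k \<Longrightarrow> rec_eval r xs m" by (auto simp: recursive_def)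
  then have "rec_eval (Comp Succ [r]) xs (Suc m)" if "length xs = k" for xs
    using that by (intro rec_eval.comp[of xs "[r]" "[m]"]) (auto intro: rec_eval.succ)
  then show ?case unfolding recursive_def by blast
qed

lemma recursive_app:
  assumes "computable f" "recursive k G"
  shows "recursive k (\<lambda>xs. f (G xs))"
proof -
  obtain r s where "\<And>x. rec_eval r [x] (f x)" "\<And>xs. length xs = k \<Longrightarrow> rec_eval s xs (G xs)"
    using assms unfolding recursive_def computable_def by blast
  then have "rec_eval (Comp r [s]) xs (f (G xs))" if "length xs = k" for xs
    using that by (intro rec_eval.comp[of xs "[s]" "[G xs]"]) auto
  then show ?thesis unfolding recursive_def by blast
qed

lemma computable_iff_recursive: "computable f \<longleftrightarrow> recursive (Suc 0) (\<lambda>xs. f (hd xs))"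
proof
  assume "computable f"
  moreover have "recursive (Suc 0) (\<lambda>xs. hd xs)" by (rule recursive_cong[OF recursive_nth[of 0]]) (auto simp: length_Suc_conv)
  ultimately show "recursive (Suc 0) (\<lambda>xs. f (hd xs))" by (rule recursive_app)
next
  assume "recursive (Suc 0) (\<lambda>xs. f (hd xs))"
  then obtain r where r: "\<And>xs. length xs = Suc 0 \<Longrightarrow> rec_eval r xs (f (hd xs))" by (auto simp: recursive_def)
  have "rec_eval r [x] (f x)" for x using r[of "[x]"] by simp
  then show "computable f" unfolding computable_def by blast
qed

definition computable2 :: "(nat \<Rightarrow> nat \<Rightarrow> nat) \<Rightarrow> bool" where
  "computable2 f \<longleftrightarrow> recursive (Suc (Suc 0)) (\<lambda>xs. f (hd xs) (hd (tl xs)))"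

definition computable3 :: "(nat \<Rightarrow> nat \<Rightarrow> nat \<Rightarrow> nat) \<Rightarrow> bool" where
  "computable3 f \<longleftrightarrow> recursive (Suc (Suc (Suc 0))) (\<lambda>xs. f (hd xs) (hd (tl xs)) (hd (tl (tl xs))))"

lemma recursive_app2:
  assumes "computable2 f" "recursive k G" "recursive k H"
  shows "recursive k (\<lambda>xs. f (G xs) (H xs))"
proof (rule recursive_cong[OF recursive_comp[OF assms(1)[unfolded computable2_def], of k "\<lambda>i. if i = 0 then G else H"]])
qed (use assms in auto)

lemma recursive_app3:
  assumes "computable3 f" "recursive k G" "recursive k H" "recursive k I"
  shows "recursive k (\<lambda>xs. f (G xs) (H xs) (I xs))"
proof (rule recursive_cong[OF recursive_comp[OF assms(1)[unfolded computable3_def], of k "\<lambda>i. if i = 0 then G else if i = 1 then H else I"]])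
qed (use assms in auto)

lemma recursive_hd: "recursive (Suc k) (\<lambda>xs. hd xs)"
  by (rule recursive_cong[OF recursive_nth[of 0]]) (auto simp: length_Suc_conv)

lemmas recursive_hd_tl = recursive_hd recursive_tl[OF recursive_hd] recursive_tl[OF recursive_tl[OF recursive_hd]] recursive_tl[OF recursive_tl[OF recursive_tl[OF recursive_hd]]]
  recursive_tl[OF recursive_tl[OF recursive_tl[OF recursive_tl[OF recursive_hd]]]]

lemma recursive_Suc: "recursive k F \<Longrightarrow> recursive k (\<lambda>xs. Suc (F xs))"
  by (rule recursive_app[of Suc]) (auto simp: computable_def intro: rec_eval.succ)

lemma recursive_add:
  assumes "recursive k F" "recursive k G"
  shows "recursive k (\<lambda>xs. F xs + G xs)"
proof (rule recursive_cong[OF recursive_rec[OF assms(2) _ assms(1), of "\<lambda>_ y _. Suc y"]])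
  show "rec_nat (G xs) (\<lambda>n y. Suc y) (F xs) = F xs + G xs" for xs
    by (induction "F xs") (auto intro: nat.induct[of "\<lambda>m. rec_nat (G xs) (\<lambda>n y. Suc y) m = m + G xs"])
qed (intro recursive_Suc recursive_hd_tl)

lemma recursive_mult:
  assumes "recursive k F" "recursive k G"
  shows "recursive k (\<lambda>xs. F xs * G xs)"
proof (rule recursive_cong[OF recursive_rec[OF recursive_const[of k 0] _ assms(1), of "\<lambda>_ y xs. y + G xs"]])
  have "rec_nat 0 (\<lambda>n y. y + g) m = m * g" for m g :: nat by (induction m) auto
  then show "rec_nat 0 (\<lambda>n y. y + G xs) (F xs) = F xs * G xs" for xs .
qed (intro recursive_add recursive_hd_tl recursive_tl[OF recursive_tl[OF assms(2)]])

lemma recursive_diff: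
  assumes "recursive k F" "recursive k G"
  shows "recursive k (\<lambda>xs. F xs - G xs)"
proof -
  have "computable (\<lambda>m. m - 1)" unfolding computable_iff_recursive
  proof (rule recursive_cong[OF recursive_rec[OF recursive_const[of _ 0] _ recursive_hd[of 0], of "\<lambda>n _ _. n"]])
    show "rec_nat 0 (\<lambda>n y. n) (hd xs) = hd xs - 1" for xs :: "nat list" by (cases "hd xs") auto
  qed (intro recursive_hd_tl)
  then have pred: "recursive l (\<lambda>xs. H xs - 1)" if "recursive l H" for l H using that by (rule recursive_app)
  show ?thesis
  proof (rule recursive_cong[OF recursive_rec[OF assms(1) _ assms(2), of "\<lambda>_ y _. y - 1"]])
    have "rec_nat f (\<lambda>n y. y - 1) m = f - m" for f m :: nat by (induction m) auto
    then show "rec_nat (F xs) (\<lambda>n y. y - 1) (G xs) = F xs - G xs" for xs .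
  qed (intro pred recursive_hd_tl)
qed

lemma recursive_sum:
  assumes "recursive (Suc k) (\<lambda>ys. F (hd ys) (tl ys))" "recursive k B"
  shows "recursive k (\<lambda>xs. \<Sum>i<B xs. F i xs)"
proof -
  have F: "recursive (Suc (Suc k)) (\<lambda>ys. F (hd ys) (tl (tl ys)))"
  proof (rule recursive_cong[OF recursive_comp[OF assms(1), of "Suc (Suc k)" "\<lambda>i ys. ys ! (if i = 0 then 0 else Suc i)"]])
    fix ys :: "nat list" assume "length ys = Suc (Suc k)"
    then obtain a b zs where "ys = a # b # zs" "length zs = k" by (auto simp: length_Suc_conv)
    then have "map (\<lambda>i. ys ! (if i = 0 then 0 else Suc i)) [0..<Suc k] = hd ys # tl (tl ys)"
      by (intro nth_equalityI) (auto simp: nth_Cons simp del: upt_Suc split: nat.split)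
    then show "F (hd (map (\<lambda>i. ys ! (if i = 0 then 0 else Suc i)) [0..<Suc k]))
        (tl (map (\<lambda>i. ys ! (if i = 0 then 0 else Suc i)) [0..<Suc k])) = F (hd ys) (tl (tl ys))" by simp
  qed (simp add: recursive_nth)
  show ?thesis
  proof (rule recursive_cong[OF recursive_rec[OF recursive_const[of k 0] _ assms(2), of "\<lambda>n y xs. y + F n xs"]])
    have "rec_nat 0 (\<lambda>n y. y + F n xs) m = (\<Sum>i<m. F i xs)" for m xs by (induction m) auto
    then show "rec_nat 0 (\<lambda>n y. y + F n xs) (B xs) = (\<Sum>i<B xs. F i xs)" for xs .
  qed (intro recursive_add recursive_hd_tl F)
qed

lemma recursive_le:
  assumes "recursive k F" "recursive k G"
  shows "recursive k (\<lambda>xs. of_bool (F xs \<le> G xs))"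
  by (rule recursive_cong[of _ "\<lambda>xs. 1 - (F xs - G xs)"]) (auto intro!: recursive_diff recursive_const assms)

lemma recursive_not: "recursive k (\<lambda>xs. of_bool (P xs)) \<Longrightarrow> recursive k (\<lambda>xs. of_bool (\<not> P xs))"
  by (rule recursive_cong[of _ "\<lambda>xs. 1 - of_bool (P xs)"]) (auto intro!: recursive_diff recursive_const)

lemma recursive_conj:
  "recursive k (\<lambda>xs. of_bool (P xs)) \<Longrightarrow> recursive k (\<lambda>xs. of_bool (Q xs)) \<Longrightarrow> recursive k (\<lambda>xs. of_bool (P xs \<and> Q xs))"
  by (rule recursive_cong[of _ "\<lambda>xs. of_bool (P xs) * of_bool (Q xs)"]) (auto intro!: recursive_mult)

lemma recursive_disj:
  "recursive k (\<lambda>xs. of_bool (P xs)) \<Longrightarrow> recursive k (\<lambda>xs. of_bool (Q xs)) \<Longrightarrow> recursive k (\<lambda>xs. of_bool (P xs \<or> Q xs))"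
  by (rule recursive_cong[OF recursive_not[OF recursive_conj[OF recursive_not recursive_not]]]) auto

lemma recursive_imp:
  "recursive k (\<lambda>xs. of_bool (P xs)) \<Longrightarrow> recursive k (\<lambda>xs. of_bool (Q xs)) \<Longrightarrow> recursive k (\<lambda>xs. of_bool (P xs \<longrightarrow> Q xs))"
  by (rule recursive_cong[OF recursive_disj[OF recursive_not]]) auto

lemma recursive_iff:
  assumes "recursive k (\<lambda>xs. of_bool (P xs))" "recursive k (\<lambda>xs. of_bool (Q xs))"
  shows "recursive k (\<lambda>xs. of_bool (P xs \<longleftrightarrow> Q xs))"
  by (rule recursive_cong[OF recursive_conj[OF recursive_imp[OF assms] recursive_imp[OF assms(2,1)]]]) auto

lemma recursive_eq:
  assumes "recursive k F" "recursive k G"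
  shows "recursive k (\<lambda>xs. of_bool (F xs = G xs))"
  by (rule recursive_cong[OF recursive_conj[OF recursive_le[OF assms] recursive_le[OF assms(2,1)]]]) auto

lemma recursive_less:
  assumes "recursive k F" "recursive k G"
  shows "recursive k (\<lambda>xs. of_bool (F xs < G xs))"
  by (rule recursive_cong[OF recursive_not[OF recursive_le[OF assms(2,1)]]]) auto

lemma recursive_all:
  assumes "recursive (Suc k) (\<lambda>ys. of_bool (P (hd ys) (tl ys)))" "recursive k B"
  shows "recursive k (\<lambda>xs. of_bool (\<forall>i<B xs. P i xs))"
  by (rule recursive_cong[OF recursive_eq[OF recursive_sum[OF recursive_not[OF assms(1)] assms(2)] recursive_const[of k 0]]]) auto

lemma recursive_least:
  assumes "recursive (Suc k) (\<lambda>ys. of_bool (P (hd ys) (tl ys)))" "\<And>xs. length xs = k \<Longrightarrow> \<exists>n. P n xs"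
  shows "recursive k (\<lambda>xs. LEAST n. P n xs)"
proof -
  obtain r where r: "\<And>ys. length ys = Suc k \<Longrightarrow> rec_eval r ys (of_bool (\<not> P (hd ys) (tl ys)))"
    using recursive_not[OF assms(1)] by (auto simp: recursive_def)
  have "rec_eval (Mu r) xs (LEAST n. P n xs)" if xs: "length xs = k" for xs
  proof (rule rec_eval.mu)
    have "P (LEAST n. P n xs) xs" using assms(2)[OF xs] by (rule LeastI_ex)
    then show "rec_eval r ((LEAST n. P n xs) # xs) 0" using r[of "(LEAST n. P n xs) # xs"] xs by simp
    fix m assume "m < (LEAST n. P n xs)"
    then have "\<not> P m xs" by (rule not_less_Least)
    then show "\<exists>y. rec_eval r (m # xs) (Suc y)" using r[of "m # xs"] xs by auto
  qed
  then show ?thesis unfolding recursive_def by blast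
qed

lemma recursively_enumerable_decidable:
  assumes "computable (\<lambda>x. of_bool (P x))"
  shows "recursively_enumerable {x. P x}"
proof -
  obtain r where r: "\<And>x. rec_eval r [x] (of_bool (P x))" using assms by (auto simp: computable_def)
  have "recursive (Suc (Suc 0)) (\<lambda>xs. of_bool (\<not> P (hd (tl xs))))"
    by (intro recursive_not recursive_app[OF assms] recursive_hd_tl)
  then obtain s where s: "\<And>xs. length xs = Suc (Suc 0) \<Longrightarrow> rec_eval s xs (of_bool (\<not> P (hd (tl xs))))"
    by (auto simp: recursive_def)
  have s': "rec_eval s [n, x] (of_bool (\<not> P x))" for n x using s[of "[n, x]"] by simp
  have "(\<exists>y. rec_eval (Mu s) [x] y) \<longleftrightarrow> P x" for x
  proof
    assume "\<exists>y. rec_eval (Mu s) [x] y"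
    then obtain y where "rec_eval s [y, x] 0" by (auto elim: rec_eval_MuE)
    then have "of_bool (\<not> P x) = (0::nat)" using s' rec_eval_deterministic by blast
    then show "P x" by (simp split: if_splits)
  next
    assume "P x"
    then have "rec_eval (Mu s) [x] 0" using s'[of 0 x] by (intro rec_eval.mu) auto
    then show "\<exists>y. rec_eval (Mu s) [x] y" by blast
  qed
  then show ?thesis unfolding recursively_enumerable_def by blast
qed

lemmas recursive_intros = recursive_hd_tl recursive_Suc recursive_add recursive_mult recursive_diff recursive_sum recursive_le recursive_not recursive_conj recursive_disj recursive_imp recursive_iff
  recursive_eq recursive_less recursive_all recursive_const

subsection \<open>Lists\<close>

lemma computable_triangle: "computable triangle"
  unfolding computable_iff_recursive
proof (rule recursive_cong)
  show "recursive (Suc 0) (\<lambda>xs. \<Sum>i<Suc (hd xs). i)" by (intro recursive_intros)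
  have "(\<Sum>i<Suc m. i) = triangle m" for m by (induction m) (auto simp: triangle_def)
  then show "(\<Sum>i<Suc (hd xs). i) = triangle (hd xs)" for xs .
qed

lemma recursive_prod_encode:
  assumes "recursive k F" "recursive k G"
  shows "recursive k (\<lambda>xs. prod_encode (F xs, G xs))"
  unfolding prod_encode_def case_prod_conv
  by (intro recursive_add recursive_app[OF computable_triangle] assms)

text \<open>Unpairing by search: only the pair coded by \<open>y\<close> contributes to the bounded double sum.\<close>

lemma prod_decode_sum:
  "(\<Sum>m<Suc y. \<Sum>k<Suc y. of_bool (prod_encode (m, k) = y) * f m k) = f (fst (prod_decode y)) (snd (prod_decode y))"
    (is "?S = _") for f :: "nat \<Rightarrow> nat \<Rightarrow> nat"
proof -
  obtain a b where ab: "prod_decode y = (a, b)" by (cases "prod_decode y")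
  then have y: "y = prod_encode (a, b)" by (metis prod_decode_inverse)
  have "of_bool (prod_encode (m, k) = y) * f m k = (if k = b then if m = a then f a b else 0 else 0)" for m k
    unfolding y prod_encode_eq by auto
  then have "?S = (\<Sum>m<Suc y. \<Sum>k<Suc y. if k = b then if m = a then f a b else 0 else 0)" by simp
  also have "\<dots> = f a b"
    using le_prod_encode_1[of a b] le_prod_encode_2[of b a] by (simp add: y less_Suc_eq_le)
  finally show ?thesis by (simp add: ab)
qed

lemma computable_prod_decode:
  "computable (\<lambda>y. fst (prod_decode y))" "computable (\<lambda>y. snd (prod_decode y))"
proof -
  show "computable (\<lambda>y. fst (prod_decode y))" unfolding computable_iff_recursive
    by (rule recursive_cong[OF _ prod_decode_sum[of _ "\<lambda>m k. m"]]) (intro recursive_intros recursive_prod_encode)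
  show "computable (\<lambda>y. snd (prod_decode y))" unfolding computable_iff_recursive
    by (rule recursive_cong[OF _ prod_decode_sum[of _ "\<lambda>m k. k"]]) (intro recursive_intros recursive_prod_encode)
qed

definition tail_code :: "nat \<Rightarrow> nat" where
  "tail_code n = of_bool (n \<noteq> 0) * snd (prod_decode (n - 1))"

definition drop_code :: "nat \<Rightarrow> nat \<Rightarrow> nat" where
  "drop_code n q = rec_nat n (\<lambda>_ y. tail_code y) q"

definition item :: "nat \<Rightarrow> nat \<Rightarrow> nat" where
  "item n q = fst (prod_decode (drop_code n q - 1))"

text \<open>A list is no longer than its code, so the summation range is large enough.\<close>

definition len :: "nat \<Rightarrow> nat" where
  "len n = (\<Sum>q<n. of_bool (drop_code n q \<noteq> 0))"

lemma computable_list: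
  "computable2 drop_code" "computable2 item" "computable len"
proof -
  have "computable tail_code"
    unfolding computable_iff_recursive tail_code_def by (intro recursive_intros recursive_app[OF computable_prod_decode(2)])
  then show d: "computable2 drop_code" unfolding computable2_def drop_code_def
    by (intro recursive_rec[where G = "\<lambda>_ y _. tail_code y"] recursive_hd_tl recursive_app[where f = tail_code])
  show "computable2 item" unfolding computable2_def item_def
    by (intro recursive_intros recursive_app[OF computable_prod_decode(1)] recursive_app2[OF d])
  show "computable len" unfolding computable_iff_recursive len_def by (intro recursive_intros recursive_app2[OF d])
qed

lemma drop_code_encode: "drop_code (list_encode ls) q = list_encode (drop q ls)"
proof (induction q)
  case 0
  show ?case by (simp add: drop_code_def)
next
  case (Suc q)
  have "tail_code (list_encode l) = list_encode (tl l)" for l by (cases l) (simp_all add: tail_code_def)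
  then show ?case using Suc by (simp add: drop_code_def drop_Suc tl_drop)
qed

lemma item_encode: "q < length ls \<Longrightarrow> item (list_encode ls) q = ls ! q"
  unfolding item_def drop_code_encode by (subst Cons_nth_drop_Suc[symmetric]) auto

lemma len_encode: "len (list_encode ls) = length ls"
proof -
  have le: "length l \<le> list_encode l" for l
  proof (induction l)
    case (Cons x l)
    then show ?case using le_prod_encode_2[of "list_encode l" x] by simp
  qed simp
  have "list_encode (drop q ls) \<noteq> 0 \<longleftrightarrow> q < length ls" for q
  proof -
    have "list_encode l \<noteq> 0 \<longleftrightarrow> l \<noteq> []" for l by (cases l) auto
    then show ?thesis by (simp add: not_le)
  qed
  then have "len (list_encode ls) = (\<Sum>q<list_encode ls. of_bool (q < length ls))"
    by (simp add: len_def drop_code_encode)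
  also have "\<dots> = (\<Sum>q<length ls. of_bool (q < length ls))"
    using le[of ls] by (intro sum.mono_neutral_right) auto
  finally show ?thesis by simp
qed

section \<open>Presentations by all relations\<close>

locale marked_group = group G for G (structure) +
  fixes \<gamma> :: "nat \<Rightarrow> 'a" and X :: "nat set"
  assumes gamma: "\<gamma> ` X \<subseteq> carrier G" and generates: "generate G (\<gamma> ` X) = carrier G"
begin

definition letter_value :: "letter \<Rightarrow> 'a" where
  "letter_value = (\<lambda>(x, b). if b then \<gamma> x else inv (\<gamma> x))"

definition word_value :: "letter list \<Rightarrow> 'a" where
  "word_value w = foldr (mult G) (map letter_value w) \<one>"

definition relations :: "letter list set" where
  "relations = {w \<in> words X. word_value w = \<one>}"

lemma letter_value_closed: "l \<in> X \<times> UNIV \<Longrightarrow> letter_value l \<in> carrier G"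
  using gamma by (auto simp: letter_value_def)

lemma word_value_Cons [simp]: "word_value (l # w) = letter_value l \<otimes> word_value w"
  and word_value_Nil [simp]: "word_value [] = \<one>"
  by (simp_all add: word_value_def)

lemma word_value_closed [simp]: "w \<in> words X \<Longrightarrow> word_value w \<in> carrier G"
  by (induction w) (auto simp: words_def letter_value_closed)

lemma word_value_append: "u \<in> words X \<Longrightarrow> v \<in> words X \<Longrightarrow> word_value (u @ v) = word_value u \<otimes> word_value v"
proof (induction u)
  case (Cons l u)
  then have "l \<in> X \<times> UNIV" "u \<in> words X" by (auto simp: words_def)
  then show ?case using Cons by (simp add: m_assoc letter_value_closed)
qed simp

lemma word_value_surj: "g \<in> carrier G \<Longrightarrow> \<exists>w\<in>words X. word_value w = g"
proof -
  assume "g \<in> carrier G"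
  then have "g \<in> generate G (\<gamma> ` X)" by (simp add: generates)
  then show ?thesis
  proof (induction rule: generate.induct)
    case one
    then show ?case by (intro bexI[of _ "[]"]) auto
  next
    case (incl h)
    then obtain x where "x \<in> X" "h = \<gamma> x" by blast
    then show ?case using gamma by (intro bexI[of _ "[(x, True)]"]) (auto simp: letter_value_def words_def)
  next
    case (inv h)
    then obtain x where "x \<in> X" "h = \<gamma> x" by blast
    then show ?case using gamma by (intro bexI[of _ "[(x, False)]"]) (auto simp: letter_value_def words_def)
  next
    case (eng h1 h2)
    then obtain w1 w2 where w: "w1 \<in> words X" "word_value w1 = h1" "w2 \<in> words X" "word_value w2 = h2" by blast
    then show ?case using word_value_append[of w1 w2] by (intro bexI[of _ "w1 @ w2"]) simp_all
  qed
qed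

lemma presentation_rel_imp_word_value_eq:
  assumes "(u, v) \<in> presentation_rel X relations"
  shows "word_value u = word_value v"
  using assms
proof (induction rule: presentation_rel.induct)
  case (cancel u v x b)
  have "\<gamma> x \<in> carrier G" using gamma cancel by blast
  then have "word_value ([(x, b), (x, \<not> b)] @ v) = word_value v"
    using word_value_closed[OF cancel(2)] by (cases b) (simp_all add: letter_value_def m_assoc[symmetric])
  moreover have "[(x, b), (x, \<not> b)] @ v \<in> words X" using cancel by (simp add: words_def)
  ultimately show ?case using cancel by (simp add: word_value_append del: append_Cons append_Nil)
next
  case (relator u v r)
  then show ?case by (simp add: word_value_append relations_def)
qed auto

text \<open>If \<open>u\<close> and \<open>v\<close> have the same value and \<open>v'\<close> is an inverse word of \<open>v\<close>, then \<open>u @ v'\<close> is a relator, and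
both \<open>u\<close> and \<open>v\<close> are equivalent to \<open>u @ v' @ v\<close>.\<close>

lemma presentation_rel_relations:
  "(u, v) \<in> presentation_rel X relations \<longleftrightarrow> u \<in> words X \<and> v \<in> words X \<and> word_value u = word_value v"
proof
  assume "(u, v) \<in> presentation_rel X relations"
  then show "u \<in> words X \<and> v \<in> words X \<and> word_value u = word_value v"
    using presentation_rel_words presentation_rel_imp_word_value_eq by blast
next
  assume h: "u \<in> words X \<and> v \<in> words X \<and> word_value u = word_value v"
  obtain v' where v': "v' \<in> words X" "(v' @ v, []) \<in> presentation_rel X relations"
    using inverse_word h by blast
  then have "word_value v' \<otimes> word_value v = \<one>" using presentation_rel_imp_word_value_eq[OF v'(2)] h v'(1) by (simp add: word_value_append)
  then have "word_value u \<otimes> word_value v' = \<one>" using h v'(1) by (metis inv_comm word_value_closed)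
  then have "u @ v' \<in> relations" using h v'(1) by (simp add: relations_def word_value_append)
  then have "([] @ (u @ v') @ v, [] @ v) \<in> presentation_rel X relations"
    using h v'(1) by (intro presentation_rel.relator) auto
  moreover have "(u @ (v' @ v) @ [], u @ [] @ []) \<in> presentation_rel X relations"
    using h by (intro presentation_rel_context[OF v'(2)]) auto
  ultimately show "(u, v) \<in> presentation_rel X relations"
    by (auto intro: presentation_rel.sym presentation_rel.trans)
qed

lemma iso_presented_group: "G \<cong> presented_group X relations"
proof -
  let ?H = "presented_group X relations" and ?E = "presentation_rel X relations"
  define \<psi> where "\<psi> g = {w \<in> words X. word_value w = g}" for g
  have cls: "\<psi> (word_value w) = ?E `` {w}" if "w \<in> words X" for w
    using that by (auto simp: \<psi>_def presentation_rel_relations)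
  have "\<psi> \<in> iso G ?H" unfolding iso_def
  proof (intro CollectI conjI)
    show "\<psi> \<in> hom G ?H"
    proof (rule homI)
      fix g h assume "g \<in> carrier G" "h \<in> carrier G"
      then obtain u v where uv: "u \<in> words X" "g = word_value u" "v \<in> words X" "h = word_value v"
        using word_value_surj by metis
      show "\<psi> g \<in> carrier ?H" using uv(1) by (auto simp: uv(2) cls presented_group_def quotient_def)
      have "\<psi> (g \<otimes> h) = ?E `` {u @ v}" using uv cls[of "u @ v"] by (simp add: word_value_append)
      then show "\<psi> (g \<otimes> h) = \<psi> g \<otimes>\<^bsub>?H\<^esub> \<psi> h" using uv by (simp add: cls presented_group_mult)
    qed
    show "bij_betw \<psi> (carrier G) (carrier ?H)"
    proof (rule bij_betwI')
      fix g h assume "g \<in> carrier G" "h \<in> carrier G"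
      then obtain u where "u \<in> words X" "g = word_value u" using word_value_surj by metis
      then show "\<psi> g = \<psi> h \<longleftrightarrow> g = h" by (auto simp: \<psi>_def)
    next
      fix g assume "g \<in> carrier G"
      then obtain u where "u \<in> words X" "g = word_value u" using word_value_surj by metis
      then show "\<psi> g \<in> carrier ?H" by (auto simp: cls presented_group_def quotient_def)
    next
      fix A assume "A \<in> carrier ?H"
      then obtain u where "u \<in> words X" "A = ?E `` {u}" by (auto simp: presented_group_def quotient_def)
      then show "\<exists>g\<in>carrier G. A = \<psi> g" using cls[of u] by (intro bexI[of _ "word_value u"]) simp_all
    qed
  qed
  then show ?thesis unfolding is_iso_def by blast
qed

end

section \<open>The word problem\<close>

text \<open>A letter is coded by a number below 8: twice the index of the generator, plus 1 unless it is
inverted. The codes 0 to 3 belong to the two translations, 4 and 5 to \<open>a\<close>, 6 and 7 to \<open>b\<close>.\<close>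

definition step :: "nat \<Rightarrow> pt" where
  "step l = (if l = 1 then (1, 0) else if l = 0 then (- 1, 0) else if l = 3 then (0, 1)
     else if l = 2 then (0, - 1) else 0)"

definition positive :: "nat \<Rightarrow> bool" where
  "positive l \<longleftrightarrow> l = 5 \<or> l = 7"

definition letter_sign :: "nat \<Rightarrow> int" where
  "letter_sign l = (if positive l then 1 else - 1)"

definition letter_vector :: "nat \<Rightarrow> pt \<Rightarrow> vec" where
  "letter_vector l p = (if 4 \<le> l then single (6 \<le> l, p) (letter_sign l) else 0)"

definition letter_element :: "nat \<Rightarrow> elt" where
  "letter_element l = (step l, letter_vector l 0, 0)"

text \<open>For a word given by the sequence \<open>it\<close> of its letter codes, this is the translation part of the prefix
before letter \<open>r\<close>, that is, the point at which that letter contributes to the vector.\<close>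

definition position :: "(nat \<Rightarrow> nat) \<Rightarrow> nat \<Rightarrow> pt" where
  "position it r = (\<Sum>i<r. step (it i))"

definition vector_of :: "(nat \<Rightarrow> nat) \<Rightarrow> nat \<Rightarrow> vec" where
  "vector_of it m = (\<Sum>r<m. letter_vector (it r) (position it r))"

definition letter_count :: "(nat \<Rightarrow> nat) \<Rightarrow> nat \<Rightarrow> nat \<Rightarrow> nat" where
  "letter_count it j q = (\<Sum>i<q. of_bool (it i = j))"

text \<open>These express the coordinates of the difference of two positions as differences of natural numbers,
so that the tests below avoid negative numbers.\<close>

definition shift_x :: "(nat \<Rightarrow> nat) \<Rightarrow> nat \<Rightarrow> nat \<Rightarrow> nat" where
  "shift_x it r r' = letter_count it 1 r' + letter_count it 0 r"

definition shift_y :: "(nat \<Rightarrow> nat) \<Rightarrow> nat \<Rightarrow> nat \<Rightarrow> nat" where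
  "shift_y it r r' = letter_count it 3 r' + letter_count it 2 r"

lemma position_count: "position it r = (int (letter_count it 1 r) - int (letter_count it 0 r), int (letter_count it 3 r) - int (letter_count it 2 r))"
proof (induction r)
  case 0
  show ?case by (simp add: position_def letter_count_def zero_prod_def)
next
  case (Suc r)
  then have "position it (Suc r) = (int (letter_count it 1 r) - int (letter_count it 0 r), int (letter_count it 3 r) - int (letter_count it 2 r)) + step (it r)"
    by (simp add: position_def)
  then show ?case by (simp add: letter_count_def step_def zero_prod_def)
qed

lemma position_diff: "position it r' - position it r = (int (shift_x it r r') - int (shift_x it r' r), int (shift_y it r r') - int (shift_y it r' r))"
  by (simp add: position_count shift_x_def shift_y_def)

lemma position_eq_iff: "position it r' = position it r \<longleftrightarrow> shift_x it r r' = shift_x it r' r \<and> shift_y it r r' = shift_y it r' r"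
  unfolding right_minus_eq[symmetric, of "position it r'"] position_diff by (simp add: zero_prod_def)

definition sign_count :: "(nat \<Rightarrow> nat) \<Rightarrow> nat \<Rightarrow> bool \<Rightarrow> nat \<Rightarrow> nat" where
  "sign_count it m b r = (\<Sum>r'<m. of_bool (4 \<le> it r' \<and> (6 \<le> it r' \<longleftrightarrow> 6 \<le> it r) \<and>
     shift_x it r r' = shift_x it r' r \<and> shift_y it r r' = shift_y it r' r \<and> (positive (it r') \<longleftrightarrow> b)))"

lemma lookup_vector_of: "lookup (vector_of it m) (\<tau>, p) =
    (\<Sum>r<m. if 4 \<le> it r \<and> (6 \<le> it r) = \<tau> \<and> position it r = p then letter_sign (it r) else 0)"
  unfolding vector_of_def lookup_sum by (intro sum.cong) (auto simp: letter_vector_def lookup_single when_def)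

lemma vector_of_zero_iff: "vector_of it m = 0 \<longleftrightarrow> (\<forall>r<m. 4 \<le> it r \<longrightarrow> sign_count it m True r = sign_count it m False r)"
proof -
  have sign_count: "lookup (vector_of it m) (6 \<le> it r, position it r) = int (sign_count it m True r) - int (sign_count it m False r)" for r
  proof -
    have "int (sign_count it m True r) - int (sign_count it m False r) =
      (\<Sum>r'<m. int (of_bool (4 \<le> it r' \<and> (6 \<le> it r' \<longleftrightarrow> 6 \<le> it r) \<and> position it r' = position it r \<and> positive (it r'))) -
        int (of_bool (4 \<le> it r' \<and> (6 \<le> it r' \<longleftrightarrow> 6 \<le> it r) \<and> position it r' = position it r \<and> \<not> positive (it r'))))"
      by (simp add: sign_count_def sum_subtractf position_eq_iff)
    also have "\<dots> = lookup (vector_of it m) (6 \<le> it r, position it r)"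
      unfolding lookup_vector_of by (intro sum.cong) (auto simp: letter_sign_def)
    finally show ?thesis by simp
  qed
  show ?thesis
  proof
    assume v: "vector_of it m = 0"
    show "\<forall>r<m. 4 \<le> it r \<longrightarrow> sign_count it m True r = sign_count it m False r"
      using sign_count by (simp add: v)
  next
    assume h: "\<forall>r<m. 4 \<le> it r \<longrightarrow> sign_count it m True r = sign_count it m False r"
    show "vector_of it m = 0"
    proof (rule vec_eqI)
      fix \<tau> p
      show "lookup (vector_of it m) (\<tau>, p) = lookup 0 (\<tau>, p)"
      proof (cases "\<exists>r<m. 4 \<le> it r \<and> (6 \<le> it r) = \<tau> \<and> position it r = p")
        case True
        then obtain r where "r < m" "4 \<le> it r" "(6 \<le> it r) = \<tau>" "position it r = p" by blast
        then show ?thesis using sign_count[of r] h by simp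
      next
        case False
        then have "lookup (vector_of it m) (\<tau>, p) = (\<Sum>r<m. 0)"
          unfolding lookup_vector_of by (intro sum.cong) auto
        then show ?thesis by simp
      qed
    qed
  qed
qed

lemma pairing_sum_left: "pairing c (\<Sum>r<m. F r) g = (\<Sum>r<m. pairing c (F r) g)" for m :: nat
  by (induction m) (simp_all add: pairing_add_left)

context growth
begin

text \<open>The contribution of letters \<open>r\<close> and \<open>r'\<close>, in this order, to the central exponent of the word.\<close>

definition center_term :: "(nat \<Rightarrow> nat) \<Rightarrow> nat \<Rightarrow> nat \<Rightarrow> int" where
  "center_term it r r' = (if 4 \<le> it r \<and> 4 \<le> it r'
     then letter_sign (it r) * letter_sign (it r') * c (6 \<le> it r) (6 \<le> it r') (position it r' - position it r) else 0)"

lemma eval_letters: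
  "foldr (mult (ext c)) (map (\<lambda>i. letter_element (it i)) [0..<m]) \<one>\<^bsub>ext c\<^esub> =
     (position it m, vector_of it m, \<Sum>r'<m. \<Sum>r<r'. center_term it r r')"
proof (induction m)
  case 0
  show ?case by (simp add: position_def vector_of_def)
next
  case (Suc m)
  have sh: "shift s (letter_vector l 0) = letter_vector l s" for s l by (simp add: letter_vector_def)
  have "pairing c (letter_vector (it r) (position it r)) (letter_vector (it m) (position it m)) = center_term it r m" for r
    by (simp add: letter_vector_def center_term_def pairing_single_left)
  then have p: "pairing c (vector_of it m) (letter_vector (it m) (position it m)) = (\<Sum>r<m. center_term it r m)"
    unfolding vector_of_def pairing_sum_left by simp
  have "foldr (mult (ext c)) (map (\<lambda>i. letter_element (it i)) [0..<Suc m]) \<one>\<^bsub>ext c\<^esub> =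
    foldr (mult (ext c)) (map (\<lambda>i. letter_element (it i)) [0..<m]) \<one>\<^bsub>ext c\<^esub> \<otimes>\<^bsub>ext c\<^esub> foldr (mult (ext c)) [letter_element (it m)] \<one>\<^bsub>ext c\<^esub>"
    unfolding upt_Suc_append[OF le0] map_append list.map by (rule ext.foldr_mult_append) auto
  also have "\<dots> = (position it m, vector_of it m, \<Sum>r'<m. \<Sum>r<r'. center_term it r r') \<otimes>\<^bsub>ext c\<^esub> letter_element (it m)"
    unfolding Suc by (simp add: letter_element_def)
  also have "\<dots> = (position it (Suc m), vector_of it (Suc m), \<Sum>r'<Suc m. \<Sum>r<r'. center_term it r r')"
    by (simp add: letter_element_def sh p) (simp add: position_def vector_of_def)
  finally show ?case .
qed

definition V_nat :: "nat \<Rightarrow> nat" where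
  "V_nat k = rec_nat 1 (\<lambda>k y. 2 * rho \<Phi> (Suc k) * y) k"

lemma V_eq_V_nat: "V k = int (V_nat k)"
  by (induction k) (simp_all add: V_nat_def)

text \<open>The kernel between letters \<open>r\<close> and \<open>r'\<close> as a natural number; the letter \<open>r'\<close> has to be a \<open>b\<close>, since
the kernel vanishes otherwise.\<close>

definition kernel_nat :: "(nat \<Rightarrow> nat) \<Rightarrow> nat \<Rightarrow> nat \<Rightarrow> nat" where
  "kernel_nat it r r' = of_bool (4 \<le> it r \<and> 6 \<le> it r') *
     (of_bool (6 \<le> it r \<and> shift_y it r' r \<le> shift_y it r r' \<and> shift_x it r r' = shift_x it r' r + nu \<Phi> (shift_y it r r' - shift_y it r' r)) *
        (rho \<Phi> (Suc (shift_y it r r' - shift_y it r' r)) * V_nat (shift_y it r r' - shift_y it r' r)) +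
      of_bool (\<not> 6 \<le> it r \<and> shift_x it r' r \<le> shift_x it r r' \<and> shift_y it r r' = shift_y it r' r + rho \<Phi> (shift_x it r r' - shift_x it r' r)) *
        V_nat (shift_x it r r' - shift_x it r' r))"

lemma kappa_nat: "\<kappa> (int a - int b, int d - int e) = (if b \<le> a \<and> d = e + rho \<Phi> (a - b) then int (V_nat (a - b)) else 0)"
proof (cases "b \<le> a")
  case True
  then obtain k where k: "a = b + k" by (auto simp: le_iff_add)
  show ?thesis unfolding k by (auto simp: \<kappa>_def V_eq_V_nat)
qed (simp add: \<kappa>_def)

lemma xi_nat: "\<xi> (int a - int b, int d - int e) =
    (if e \<le> d \<and> a = b + nu \<Phi> (d - e) then int (rho \<Phi> (Suc (d - e)) * V_nat (d - e)) else 0)"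
proof (cases "e \<le> d")
  case True
  then obtain k where k: "d = e + k" by (auto simp: le_iff_add)
  show ?thesis unfolding k by (auto simp: \<xi>_def V_eq_V_nat)
qed (simp add: \<xi>_def)

lemma center_term_kernel_nat: "center_term it r r' = (if positive (it r) = positive (it r') then 1 else - 1) * int (kernel_nat it r r')"
  unfolding center_term_def kernel_nat_def position_diff c_def kappa_nat xi_nat
  by (cases "6 \<le> it r"; cases "6 \<le> it r'"; cases "4 \<le> it r")
    (simp_all add: letter_sign_def del: rho.simps)

definition pair_total :: "(nat \<Rightarrow> nat) \<Rightarrow> nat \<Rightarrow> bool \<Rightarrow> nat" where
  "pair_total it m b = (\<Sum>r'<m. \<Sum>r<r'. of_bool ((positive (it r) \<longleftrightarrow> positive (it r')) \<longleftrightarrow> b) * kernel_nat it r r')"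

lemma sum_center_term: "(\<Sum>r'<m. \<Sum>r<r'. center_term it r r') = int (pair_total it m True) - int (pair_total it m False)"
  unfolding pair_total_def of_nat_sum sum_subtractf[symmetric]
  by (intro sum.cong refl) (auto simp: center_term_kernel_nat)

definition trivial_code :: "nat \<Rightarrow> bool" where
  "trivial_code n \<longleftrightarrow> (\<forall>i<len n. item n i < 8) \<and>
     shift_x (item n) 0 (len n) = shift_x (item n) (len n) 0 \<and> shift_y (item n) 0 (len n) = shift_y (item n) (len n) 0 \<and>
     (\<forall>r<len n. 4 \<le> item n r \<longrightarrow> sign_count (item n) (len n) True r = sign_count (item n) (len n) False r) \<and>
     pair_total (item n) (len n) True = pair_total (item n) (len n) False"

lemma trivial_code_iff:
  "trivial_code n \<longleftrightarrow> (\<forall>i<len n. item n i < 8) \<and>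
     foldr (mult (ext c)) (map (\<lambda>i. letter_element (item n i)) [0..<len n]) \<one>\<^bsub>ext c\<^esub> = \<one>\<^bsub>ext c\<^esub>"
proof -
  have "position (item n) (len n) = 0 \<longleftrightarrow>
    shift_x (item n) 0 (len n) = shift_x (item n) (len n) 0 \<and> shift_y (item n) 0 (len n) = shift_y (item n) (len n) 0"
    using position_eq_iff[of "item n" "len n" 0] by (simp add: position_def[of _ 0])
  then show ?thesis unfolding trivial_code_def eval_letters
    unfolding one_ext prod.inject vector_of_zero_iff sum_center_term by simp
qed

lemma computable_trivial_code:
  assumes "computable \<Phi>"
  shows "computable (\<lambda>n. of_bool (trivial_code n))"
proof -
  note app = recursive_app[OF assms]
  have next_nu: "computable (\<lambda>y. LEAST n. y < n \<and> 3 * \<Phi> y \<le> \<Phi> n)"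
    unfolding computable_iff_recursive by (intro recursive_least recursive_intros app unbounded)
  have "nu \<Phi> k = rec_nat 1 (\<lambda>_ y. LEAST n. y < n \<and> 3 * \<Phi> y \<le> \<Phi> n) k" for k
    by (induction k) (simp_all add: nu.simps)
  moreover have "computable (\<lambda>k. rec_nat 1 (\<lambda>_ y. LEAST n. y < n \<and> 3 * \<Phi> y \<le> \<Phi> n) k)"
    unfolding computable_iff_recursive
    by (intro recursive_rec[where G = "\<lambda>_ y _. LEAST n. y < n \<and> 3 * \<Phi> y \<le> \<Phi> n"] recursive_const recursive_hd_tl recursive_app[OF next_nu])
  ultimately have nu: "computable (nu \<Phi>)" by (simp add: computable_def)
  have "rho \<Phi> k = of_bool (k = 0) + of_bool (k \<noteq> 0) * (3 * \<Phi> (nu \<Phi> (k - 1)))" for k by (cases k) auto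
  moreover have "computable (\<lambda>k. of_bool (k = 0) + of_bool (k \<noteq> 0) * (3 * \<Phi> (nu \<Phi> (k - 1))))"
    unfolding computable_iff_recursive by (intro recursive_intros app recursive_app[OF nu])
  ultimately have rho: "computable (rho \<Phi>)" by (simp add: computable_def)
  have "computable (\<lambda>k. rec_nat 1 (\<lambda>k y. 2 * rho \<Phi> (Suc k) * y) k)"
    unfolding computable_iff_recursive
    by (intro recursive_rec[where G = "\<lambda>k y _. 2 * rho \<Phi> (Suc k) * y"] recursive_intros recursive_app[OF rho])
  then have V_nat: "computable V_nat" unfolding computable_def V_nat_def .
  note it = recursive_app2[OF computable_list(2)] recursive_app[OF computable_list(3)]
  have letter_count: "computable2 (\<lambda>n q. letter_count (item n) j q)" for j
    unfolding computable2_def letter_count_def by (intro recursive_intros it)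
  have shift_x: "computable3 (\<lambda>n r r'. shift_x (item n) r r')" and shift_y: "computable3 (\<lambda>n r r'. shift_y (item n) r r')"
    unfolding computable3_def shift_x_def shift_y_def by (intro recursive_intros recursive_app2[OF letter_count])+
  note it = it recursive_app3[OF shift_x] recursive_app3[OF shift_y]
  have positive: "recursive k (\<lambda>xs. of_bool (positive (F xs)))" if "recursive k F" for k F
    unfolding positive_def using that by (intro recursive_intros)
  have sign_count: "computable2 (\<lambda>n r. sign_count (item n) (len n) b r)" for b
    unfolding computable2_def sign_count_def by (intro recursive_intros it positive)
  have kernel_nat: "computable3 (\<lambda>n r r'. kernel_nat (item n) r r')"
    unfolding computable3_def kernel_nat_def by (intro recursive_intros it recursive_app[OF nu] recursive_app[OF rho] recursive_app[OF V_nat])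
  have pair_total: "computable (\<lambda>n. pair_total (item n) (len n) b)" for b
    unfolding computable_iff_recursive pair_total_def by (intro recursive_intros it positive recursive_app3[OF kernel_nat])
  show ?thesis
    unfolding computable_iff_recursive trivial_code_def by (intro recursive_intros it recursive_app2[OF sign_count] recursive_app[OF pair_total])
qed

lemma recursively_presented_ext:
  assumes "computable \<Phi>"
  shows "recursively_presented (ext c)"
proof -
  define \<gamma> where "\<gamma> x = letter_element (2 * x + 1)" for x
  have gens: "\<gamma> ` {..<4} = gens"
    by (auto simp: \<gamma>_def gens_def letter_element_def step_def letter_vector_def letter_sign_def positive_def lessThan_nat_numeral image_Un zero_prod_def)
  interpret marked_group "ext c" \<gamma> "{..<4}"
    by unfold_locales (use gens gens_generate in \<open>auto simp: finite_generating_set_def\<close>)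
  define code :: "letter \<Rightarrow> nat" where "code = (\<lambda>(x, b). 2 * x + of_bool b)"
  have letter: "letter_value l = letter_element (code l)" if h: "l \<in> {..<4} \<times> UNIV" for l
  proof -
    obtain x b where l: "l = (x, b)" "x < 4" using h by (cases l) auto
    have xi_0: "\<xi> (0, 0) = 0" by (simp add: \<xi>_def)
    have "x = 0 \<or> x = 1 \<or> x = 2 \<or> x = 3" using l by auto
    then show ?thesis unfolding l
      by (elim disjE; cases b)
        (simp_all add: letter_value_def code_def \<gamma>_def letter_element_def step_def letter_vector_def letter_sign_def positive_def shift_uminus
          single_uminus[symmetric] pairing_single_left xi_0 zero_prod_def)
  qed
  have enc: "word_encode w = list_encode (map code w)" for w
    by (simp add: word_encode_def code_def)
  have word: "word_value w = foldr (mult (ext c)) (map (\<lambda>i. letter_element (item (word_encode w) i)) [0..<len (word_encode w)]) \<one>\<^bsub>ext c\<^esub>"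
    "\<forall>i<len (word_encode w). item (word_encode w) i < 8" if w: "w \<in> words {..<4}" for w
  proof -
    have el: "\<And>l. l \<in> set w \<Longrightarrow> l \<in> {..<4} \<times> UNIV" using w by (auto simp: words_def)
    have "map letter_value w = map (\<lambda>i. letter_element (item (word_encode w) i)) [0..<len (word_encode w)]"
      by (rule nth_equalityI) (auto simp: enc len_encode item_encode letter el)
    then show "word_value w = foldr (mult (ext c)) (map (\<lambda>i. letter_element (item (word_encode w) i)) [0..<len (word_encode w)]) \<one>\<^bsub>ext c\<^esub>"
      by (simp add: word_value_def)
    have "code l < 8" if "l \<in> set w" for l using el[OF that] by (auto simp: code_def)
    then show "\<forall>i<len (word_encode w). item (word_encode w) i < 8"
      by (auto simp: enc len_encode item_encode)
  qed
  have "word_encode ` relations = {n. trivial_code n}"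
  proof (intro equalityI subsetI)
    fix n assume "n \<in> word_encode ` relations"
    then show "n \<in> {n. trivial_code n}" using word by (auto simp: relations_def trivial_code_iff)
  next
    fix n assume "n \<in> {n. trivial_code n}"
    then have n: "trivial_code n" by simp
    define w where "w = map (\<lambda>l. (l div 2, odd l)) (list_decode n)"
    have ls: "l < 8" if "l \<in> set (list_decode n)" for l
    proof -
      obtain i where i: "i < length (list_decode n)" "l = list_decode n ! i"
        using \<open>l \<in> set (list_decode n)\<close> by (metis in_set_conv_nth)
      then have "item n i = l" "i < len n"
        using len_encode[of "list_decode n"] item_encode[of i "list_decode n"] by simp_all
      moreover have "\<forall>i<len n. item n i < 8" using n unfolding trivial_code_def by (rule conjunct1)
      ultimately show ?thesis by blast
    qed
    have "l div 2 < 4" if "l \<in> set (list_decode n)" for l using ls[OF that] by simp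
    then have w: "w \<in> words {..<4}" by (auto simp: w_def words_def)
    have "map code w = list_decode n"
      by (auto simp: w_def code_def o_def intro!: map_idI)
    then have "word_encode w = n" by (simp add: enc)
    then show "n \<in> word_encode ` relations" using word(1)[OF w] w n by (auto simp: relations_def trivial_code_iff)
  qed
  then have "recursively_enumerable (word_encode ` relations)"
    using recursively_enumerable_decidable[OF computable_trivial_code[OF assms]] by simp
  moreover have "computable_set {..<4}"
    unfolding computable_set_def computable_iff_recursive lessThan_iff by (intro recursive_intros)
  moreover have "relations \<subseteq> words {..<4}" by (auto simp: relations_def)
  ultimately show ?thesis unfolding recursively_presented_def using iso_presented_group by blast
qed

end

section \<open>Realization by recursively presented groups\<close>

text \<open>Each alternative of the hypothesis puts \<open>\<Phi>\<close> into the locale \<open>growth\<close>, with a different constant.\<close>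

theorem theorem3:
  fixes \<Phi> :: "nat \<Rightarrow> nat"
  assumes "\<forall>i\<ge>1. \<Phi> i \<ge> 1"
    and "mono_on {1..} \<Phi>"
    and "(\<forall>i\<ge>1. \<Phi> i \<ge> i ^ 3 \<and> \<Phi> (3 * i) \<ge> 3 * \<Phi> i) \<or>
         (\<forall>i\<ge>2. real (\<Phi> i) \<ge> real i powr (1 + log 3 2 + log 3 (log 3 (real i))))"
  shows "\<exists>G :: nat monoid.
    group G \<and> torsion_free G \<and> finitely_generated G \<and> solvable G \<and> derived_length G = 3 \<and>
    (\<forall>S. finite_generating_set G S \<longrightarrow>
      asymp_equiv (\<lambda>n. real (conjugator_length G S n)) (\<lambda>n. real (\<Phi> n))) \<and>
    (computable \<Phi> \<longrightarrow> recursively_presented G)"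
proof -
  obtain C where "C \<ge> 1" "\<forall>n\<ge>1. n ^ 3 \<le> C * \<Phi> (C * n)" using cubic_growth[OF assms(3)] by blast
  then interpret growth \<Phi> C by unfold_locales (use assms(1,2) in auto)
  show ?thesis using group_with_conjugator_length recursively_presented_ext by blast
qed

end
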